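(* Let $p(y^N|x^N)$ be an $N$-node discrete memoryless multicast relay network in which source node $1$ communicates a single common message to every node of the destination set $\mathcal{D}\subseteq[2:N]$, and let $C$ be its capacity. Then $$C\ge\max_{p(x^N,u_2^N,q)}\ \min_{d\in\mathcal{D}}\ \min_{\substack{\mathcal{S}\subseteq[1:N]:\\1\in\mathcal{S},\,d\in\mathcal{S}^c}}\Bigl\{I(X(\mathcal{S});U(\mathcal{S}^c),Y_d\,|\,X(\mathcal{S}^c),Q)-\sum_{k\in\mathcal{S}^c}\bigl[I(U_k;U(\mathcal{S}_k^c),X^N\,|\,X_k,Y_k,Q)+I(X_k;X(\mathcal{S}_k^c)\,|\,Q)\bigr]\Bigr\}.$$
   Context: Notation. $[1:N]=\{1,\dots,N\}$; $X^N=(X_1,\dots,X_N)$, $U_2^N=(U_2,\dots,U_N)$, $X(\mathcal{A})=(X_k:k\in\mathcal{A})$; complements are taken in $[1:N]$; for $\mathcal{S}\subseteq[1:N]$, $\mathcal{S}_k^c=\mathcal{S}^c\cap[1:k-1]$. Logarithms are to base 2, and $[1:2^{nR}]$ denotes $\{1,\dots,2^{\lceil nR\rceil}\}$. Network. An $N$-node discrete memoryless network has finite alphabets $\mathcal{X}_k,\mathcal{Y}_k$, $k\in[1:N]$, and a conditional pmf $p(y^N|x^N)$; at each time $i$, given the message, all past inputs and outputs and the current inputs $x_{1i},\dots,x_{Ni}$, the outputs $(Y_{1i},\dots,Y_{Ni})$ are distributed according to $p(y^N|x^N)$. Code. A $(2^{nR},n)$ code for the multicast relay network consists of a message set $[1:2^{nR}]$,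 a source encoder assigning a symbol $x_{1i}(m,y_1^{i-1})$ to each message $m$ and $y_1^{i-1}$ for $i\in[1:n]$, relay encoders $k\in[2:N]$ assigning $x_{ki}(y_k^{i-1})$ to each $y_k^{i-1}$ for $i\in[1:n]$, and decoders $d\in\mathcal{D}$ assigning an estimate $\hat m_d$ (or an error message) of $m$ to each $y_d^n$. The message $M$ is uniform and $P_e^{(n)}=\mathsf{P}\{\hat M_d\ne M\text{ for some }d\in\mathcal{D}\}$. A rate $R\ge0$ is achievable if there is a sequence of $(2^{nR},n)$ codes with $P_e^{(n)}\to0$; the capacity $C$ is the supremum of achievable rates. Maximization. The maximum (understood as a supremum) is over all joint pmfs $p(x^N,u_2^N,q)$, where $X_k\in\mathcal{X}_k$ and the auxiliary random variables $U_2,\dots,U_N,Q$ have arbitrary finite alphabets; the information quantities are computed under $p(x^N,u_2^N,q)\,p(y^N|x^N)$. *)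

theory Defs
  imports "HOL-Probability.Probability" "HOL-Library.Extended_Real"
begin

(* The alphabets of the nodes are subsets of common types 'x and 'y.  A vector x^N is a function
   on node indices in PiE {1..N} X, and p(y^N|x^N) is the pmf (chan G x). *)
record ('x, 'y) network =
  nodes :: nat
  inp :: "nat \<Rightarrow> 'x set"
  outp :: "nat \<Rightarrow> 'y set"
  chan :: "(nat \<Rightarrow> 'x) \<Rightarrow> (nat \<Rightarrow> 'y) pmf"

definition dm_network :: "('x, 'y) network \<Rightarrow> bool" where
  "dm_network G \<longleftrightarrow>
     1 \<le> nodes G \<and>
     (\<forall>k\<in>{1..nodes G}. finite (inp G k) \<and> inp G k \<noteq> {} \<and> finite (outp G k) \<and> outp G k \<noteq> {}) \<and>
     (\<forall>x\<in>PiE {1..nodes G} (inp G). set_pmf (chan G x) \<subseteq> PiE {1..nodes G} (outp G))"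

(* src c i m ys is x_1i(m, y_1^(i-1)) and relay c k i ys is x_ki(y_k^(i-1)); dec c d ys = None is
   the error message of destination d. *)
record ('x, 'y) code =
  src :: "nat \<Rightarrow> nat \<Rightarrow> 'y list \<Rightarrow> 'x"
  relay :: "nat \<Rightarrow> nat \<Rightarrow> 'y list \<Rightarrow> 'x"
  dec :: "nat \<Rightarrow> 'y list \<Rightarrow> nat option"

definition messages :: "real \<Rightarrow> nat \<Rightarrow> nat set" where
  "messages R n = {1..2 ^ nat \<lceil>real n * R\<rceil>}"

definition seqs :: "'y set \<Rightarrow> nat \<Rightarrow> 'y list set" where
  "seqs A l = {ys. set ys \<subseteq> A \<and> length ys = l}"

definition is_code ::
  "('x, 'y) network \<Rightarrow> nat set \<Rightarrow> real \<Rightarrow> nat \<Rightarrow> ('x, 'y) code \<Rightarrow> bool" where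
  "is_code G D R n c \<longleftrightarrow>
     (\<forall>m\<in>messages R n. \<forall>i\<in>{1..n}. \<forall>ys\<in>seqs (outp G 1) (i - 1). src c i m ys \<in> inp G 1) \<and>
     (\<forall>k\<in>{2..nodes G}. \<forall>i\<in>{1..n}. \<forall>ys\<in>seqs (outp G k) (i - 1). relay c k i ys \<in> inp G k) \<and>
     (\<forall>d\<in>D. \<forall>ys\<in>seqs (outp G d) n. dec c d ys \<in> {None} \<union> Some ` messages R n)"

definition observed :: "nat \<Rightarrow> (nat \<Rightarrow> 'y) list \<Rightarrow> 'y list" where
  "observed k h = map (\<lambda>y. y k) h"

(* The inputs x_1i, ..., x_Ni at time i for message m, after the output vectors h of the times
   1, ..., i - 1. *)
definition inputs ::
  "('x, 'y) network \<Rightarrow> ('x, 'y) code \<Rightarrow> nat \<Rightarrow> nat \<Rightarrow> (nat \<Rightarrow> 'y) list \<Rightarrow> nat \<Rightarrow> 'x" where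
  "inputs G c m i h =
     (\<lambda>k\<in>{1..nodes G}. if k = 1 then src c i m (observed 1 h) else relay c k i (observed k h))"

primrec outputs ::
  "('x, 'y) network \<Rightarrow> ('x, 'y) code \<Rightarrow> nat \<Rightarrow> nat \<Rightarrow> (nat \<Rightarrow> 'y) list pmf" where
  "outputs G c m 0 = return_pmf []"
| "outputs G c m (Suc i) =
     bind_pmf (outputs G c m i)
       (\<lambda>h. map_pmf (\<lambda>y. h @ [y]) (chan G (inputs G c m (Suc i) h)))"

definition error_prob ::
  "('x, 'y) network \<Rightarrow> nat set \<Rightarrow> real \<Rightarrow> nat \<Rightarrow> ('x, 'y) code \<Rightarrow> real" where
  "error_prob G D R n c =
     measure_pmf.prob
       (bind_pmf (pmf_of_set (messages R n)) (\<lambda>m. map_pmf (Pair m) (outputs G c m n)))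
       {(m, h). \<exists>d\<in>D. dec c d (observed d h) \<noteq> Some m}"

definition achievable :: "('x, 'y) network \<Rightarrow> nat set \<Rightarrow> real \<Rightarrow> bool" where
  "achievable G D R \<longleftrightarrow> 0 \<le> R \<and>
     (\<exists>c. (\<forall>n\<ge>1. is_code G D R n (c n)) \<and> (\<lambda>n. error_prob G D R n (c n)) \<longlonglongrightarrow> 0)"

definition capacity :: "('x, 'y) network \<Rightarrow> nat set \<Rightarrow> ereal" where
  "capacity G D = (SUP R\<in>{R. achievable G D R}. ereal R)"

(* Joint pmfs p(x^N, u_2^N, q).  Every finite alphabet embeds into the naturals, so the finite
   subsets of nat cover all choices of alphabets for the auxiliary variables. *)
type_synonym 'x input_pmf = "((nat \<Rightarrow> 'x) \<times> (nat \<Rightarrow> nat) \<times> nat) pmf"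

definition input_pmfs :: "('x, 'y) network \<Rightarrow> 'x input_pmf set" where
  "input_pmfs G = {p. \<exists>AU AQ. (\<forall>k\<in>{2..nodes G}. finite (AU k)) \<and> finite AQ \<and>
     set_pmf p \<subseteq> PiE {1..nodes G} (inp G) \<times> PiE {2..nodes G} AU \<times> AQ}"

type_synonym ('x, 'y) outcome = "(nat \<Rightarrow> 'x) \<times> (nat \<Rightarrow> nat) \<times> nat \<times> (nat \<Rightarrow> 'y)"

definition joint_pmf :: "('x, 'y) network \<Rightarrow> 'x input_pmf \<Rightarrow> ('x, 'y) outcome pmf" where
  "joint_pmf G p = bind_pmf p (\<lambda>(x, u, q). map_pmf (\<lambda>y. (x, u, q, y)) (chan G x))"

definition rvX :: "nat \<Rightarrow> ('x, 'y) outcome \<Rightarrow> 'x" where "rvX k = (\<lambda>(x, u, q, y). x k)"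
definition rvU :: "nat \<Rightarrow> ('x, 'y) outcome \<Rightarrow> nat" where "rvU k = (\<lambda>(x, u, q, y). u k)"
definition rvQ :: "('x, 'y) outcome \<Rightarrow> nat" where "rvQ = (\<lambda>(x, u, q, y). q)"
definition rvY :: "nat \<Rightarrow> ('x, 'y) outcome \<Rightarrow> 'y" where "rvY k = (\<lambda>(x, u, q, y). y k)"

definition rvXs :: "nat set \<Rightarrow> ('x, 'y) outcome \<Rightarrow> nat \<Rightarrow> 'x" where
  "rvXs A = (\<lambda>\<omega>. \<lambda>k\<in>A. rvX k \<omega>)"
definition rvUs :: "nat set \<Rightarrow> ('x, 'y) outcome \<Rightarrow> nat \<Rightarrow> nat" where
  "rvUs A = (\<lambda>\<omega>. \<lambda>k\<in>A. rvU k \<omega>)"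

(* The library's I(V ; W | Z) in bits.  Restricting the sample space to the support, which is
   finite for the pmfs used here, makes all random variables simple functions. *)
definition cond_info ::
  "'s pmf \<Rightarrow> ('s \<Rightarrow> 'a) \<Rightarrow> ('s \<Rightarrow> 'b) \<Rightarrow> ('s \<Rightarrow> 'c) \<Rightarrow> real"
  (\<open>I[_]'(_ ; _ | _')\<close>) where
  "I[P](V ; W | Z) =
     information_space.conditional_mutual_information_Pow
       (restrict_space (measure_pmf P) (set_pmf P)) 2 V W Z"

lemma cond_info_eq:
  fixes P :: "'s pmf"
  assumes fin: "finite (set_pmf P)"
  shows "I[P](V ; W | Z) =
    (\<Sum>(v, w, z)\<in>set_pmf (map_pmf (\<lambda>\<omega>. (V \<omega>, W \<omega>, Z \<omega>)) P).
       pmf (map_pmf (\<lambda>\<omega>. (V \<omega>, W \<omega>, Z \<omega>)) P) (v, w, z) *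
       log 2 (pmf (map_pmf (\<lambda>\<omega>. (V \<omega>, W \<omega>, Z \<omega>)) P) (v, w, z) * pmf (map_pmf Z P) z /
         (pmf (map_pmf (\<lambda>\<omega>. (V \<omega>, Z \<omega>)) P) (v, z) * pmf (map_pmf (\<lambda>\<omega>. (W \<omega>, Z \<omega>)) P) (w, z))))"
proof -
  let ?M = "restrict_space (measure_pmf P) (set_pmf P)"
  have "emeasure (measure_pmf P) (set_pmf P) = 1"
    by (simp add: measure_pmf.emeasure_eq_measure measure_pmf.prob_eq_1 AE_measure_pmf)
  then interpret prob_space ?M
    by (intro prob_space_restrict_space) auto
  interpret information_space ?M 2 by standard simp
  have sp: "space ?M = set_pmf P" by (simp add: space_restrict_space)
  have sets: "sets ?M = Pow (set_pmf P)" by (auto simp: sets_restrict_space)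
  have sd: "simple_distributed ?M f (pmf (map_pmf f P))" for f :: "'s \<Rightarrow> 'd"
  proof (rule simple_distributedI)
    show "simple_function ?M f" using fin by (auto simp: simple_function_def sp sets)
    fix x
    have "measure ?M (f -` {x} \<inter> space ?M) = measure (measure_pmf P) (f -` {x} \<inter> set_pmf P)"
      by (simp add: sp measure_restrict_space)
    then show "pmf (map_pmf f P) x = measure ?M (f -` {x} \<inter> space ?M)"
      by (simp add: pmf_map measure_Int_set_pmf)
  qed auto
  show ?thesis unfolding cond_info_def
    by (subst conditional_mutual_information_eq[OF sd sd sd sd])
       (auto simp: sp intro!: sum.cong)
qed

end

theory Submission
  imports Defs "HOL-Probability.Hoeffding"
begin

text \<open>
  Block-Markov random coding in the style of distributed decode-forward. In every block relay \<open>k\<close>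
  sends \<open>x\<^sub>k(l)\<close>, where \<open>l\<close> is the index it found in the previous block, and decodes from its output
  the index \<open>l'\<close> of \<open>u\<^sub>k(l' | l)\<close>; the source sends \<open>x\<^sub>1(m | l\<^sub>2, ..., l\<^sub>N)\<close>. A path chooses all indices
  over \<open>b\<close> blocks. The messages are identified with paths all of whose blocks are typical, and a
  destination decodes the whole path with the help of the indices it decoded as a relay.

  No covering lemma is needed. The expected sum of the error probabilities of the typical paths is a
  small multiple of their expected number, hence some codebook has as many typical paths as expected
  and a small average error among them, even if most codebooks have no typical path at all. The bound
  for a wrong branch in a block does not depend on the index that the branch announces for the next
  block, so the sum over the wrong paths factorizes into \<open>b\<close> equal factors.

  All decoders compare a product of density ratios with a threshold. Under an independent codeword the
  ratios have mean at most one, so Markov's inequality gives the packing bounds. An input block is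
  typical if its output passes all thresholds with probability at least \<open>1 - \<epsilon>\<close>; a change of measure
  bounds the probability that a codeword is typical from below. The rates are just below
  \<open>I(U\<^sub>k; Y\<^sub>k | X\<^sub>k, Q)\<close> for the relay indices; the source index gets the remaining rate, which may
  be negative.
\<close>

subsection \<open>Product distributions\<close>

text \<open>The rate account behind the construction: let I_k be \<open>relay_info k\<close> and R_1
  the rate of the source index. Per block the number of typical paths has exponent R_1 plus all I_k
  minus \<open>code_div\<close>, the relative entropy between the wanted law of a letter and the law
  by which separate codebooks generate it. A destination can exclude states that are wrong at the
  relays in S if R_1 plus the I_k over S stays below \<open>dest_info d S\<close>. Eliminating R_1
  leaves \<open>dest_info d S - code_div\<close> plus the I_k outside S, and
  \<open>cut_value\<close> identifies this with the cut of the theorem. Two obstacles shape the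
  proof. The blocks of a path are coupled, as the index announced in one block belongs to the state
  of the next; so every block has its own independent codebook, and bounds are uniform in all words
  that are not redrawn. Moreover relays react to their outputs, so the output law is no product; it
  is replaced by a process with predetermined inputs that gives the same probability to every
  history without errors. Fixing the index vectors at both ends loses the index rate of one block,
  which many blocks make negligible.\<close>

lemma Pi_pmf_two_components:
  assumes "finite A" "i \<in> A" "j \<in> A" "i \<noteq> j"
  shows "map_pmf (\<lambda>f. (f i, f j)) (Pi_pmf A d p) = pair_pmf (p i) (p j)"
proof -
  have A: "A = insert i (A - {i})" using assms by auto
  have "map_pmf (\<lambda>f. (f i, f j)) (Pi_pmf A d p)
      = map_pmf (\<lambda>(y, f). (y, f j)) (pair_pmf (p i) (Pi_pmf (A - {i}) d p))"
    by (subst A, subst Pi_pmf_insert) (use assms in \<open>auto simp: pmf.map_comp o_def case_prod_unfold\<close>)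
  also have "\<dots> = pair_pmf (p i) (map_pmf (\<lambda>f. f j) (Pi_pmf (A - {i}) d p))"
    by (simp add: map_pair[where f = "\<lambda>x. x", simplified, symmetric])
  also have "\<dots> = pair_pmf (p i) (p j)"
    using assms by (subst Pi_pmf_component) auto
  finally show ?thesis .
qed

lemma map_Pi_pmf_restrict:
  assumes "finite A"
  shows "map_pmf (\<lambda>g. \<lambda>k\<in>A. f k (g k)) (Pi_pmf A d p) = Pi_pmf A undefined (\<lambda>k. map_pmf (f k) (p k))"
proof -
  have "Pi_pmf A undefined (\<lambda>k. map_pmf (f k) (p k))
      = Pi_pmf A undefined (\<lambda>k. bind_pmf (p k) (\<lambda>x. return_pmf (f k x)))"
    by (simp add: map_pmf_def)
  also have "\<dots> = bind_pmf (Pi_pmf A d p) (\<lambda>g. return_pmf (\<lambda>k\<in>A. f k (g k)))"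
    using assms by (subst Pi_pmf_bind[where d' = d]) (auto simp: restrict_def)
  finally show ?thesis by (simp add: map_pmf_def)
qed

text \<open>Independent two-stage experiments can be run stage by stage. Used for products over the
  relays as well as over the time instants of a block.\<close>

lemma Pi_pmf_pair_bind:
  assumes "finite A"
  shows "map_pmf (\<lambda>g. (\<lambda>k\<in>A. fst (g k), \<lambda>k\<in>A. snd (g k)))
      (Pi_pmf A d (\<lambda>k. bind_pmf (p k) (\<lambda>w. map_pmf (Pair w) (q k w))))
    = bind_pmf (Pi_pmf A undefined p) (\<lambda>w. map_pmf (Pair w) (Pi_pmf A undefined (\<lambda>k. q k (w k))))"
    (is "?lhs = ?rhs")
proof -
  let ?d = undefined
  have "?lhs = bind_pmf (Pi_pmf A ?d p) (\<lambda>w. map_pmf (\<lambda>g. (\<lambda>k\<in>A. fst (g k), \<lambda>k\<in>A. snd (g k)))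
      (Pi_pmf A d (\<lambda>k. map_pmf (Pair (w k)) (q k (w k)))))"
    using assms by (subst Pi_pmf_bind[where d' = ?d]) (auto simp: map_bind_pmf)
  also have "\<dots> = bind_pmf (Pi_pmf A ?d p) (\<lambda>w. map_pmf (Pair w) (Pi_pmf A undefined (\<lambda>k. q k (w k))))"
  proof (rule bind_pmf_cong[OF refl])
    fix w assume "w \<in> set_pmf (Pi_pmf A ?d p)"
    then have w: "(\<lambda>k\<in>A. w k) = w" using set_Pi_pmf_subset[OF assms, of ?d p]
      by (auto simp: restrict_def fun_eq_iff)
    let ?P = "Pi_pmf A ?d (\<lambda>k. q k (w k))"
    have "Pi_pmf A d (\<lambda>k. map_pmf (Pair (w k)) (q k (w k)))
       = Pi_pmf A d (\<lambda>k. bind_pmf (q k (w k)) (\<lambda>x. return_pmf (w k, x)))"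
      by (simp add: map_pmf_def)
    also have "\<dots> = bind_pmf ?P (\<lambda>g. return_pmf (\<lambda>k. if k \<in> A then (w k, g k) else d))"
      using assms by (subst Pi_pmf_bind[where d' = ?d]) auto
    finally have "map_pmf (\<lambda>g. (\<lambda>k\<in>A. fst (g k), \<lambda>k\<in>A. snd (g k))) (Pi_pmf A d (\<lambda>k. map_pmf (Pair (w k)) (q k (w k))))
       = map_pmf (\<lambda>g. (\<lambda>k\<in>A. w k, \<lambda>k\<in>A. g k)) ?P"
      by (simp add: map_pmf_def bind_assoc_pmf bind_return_pmf restrict_def cong: if_cong)
    also have "\<dots> = map_pmf (Pair w) ?P"
      unfolding w
    proof (rule pmf.map_cong0)
      fix g assume "g \<in> set_pmf ?P"
      then have "(\<lambda>k\<in>A. g k) = g" using set_Pi_pmf_subset[OF assms, of ?d]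
        by (force simp: restrict_def fun_eq_iff)
      then show "(w, \<lambda>k\<in>A. g k) = (w, g)" by simp
    qed
    finally show "map_pmf (\<lambda>g. (\<lambda>k\<in>A. fst (g k), \<lambda>k\<in>A. snd (g k))) (Pi_pmf A d (\<lambda>k. map_pmf (Pair (w k)) (q k (w k))))
       = map_pmf (Pair w) ?P" .
  qed
  finally show ?thesis .
qed

text \<open>Both sides multiply the same entry probabilities in swapped order. Arrays that leave the
  default value off \<open>A\<close> and \<open>B\<close> are the only separate case; either side
  gives them probability zero.\<close>

lemma Pi_pmf_transpose:
  assumes "finite A" "finite B"
  shows "Pi_pmf B (\<lambda>_. d) (\<lambda>t. Pi_pmf A d (\<lambda>k. p k t))
    = map_pmf (\<lambda>x t k. x k t) (Pi_pmf A (\<lambda>_. d) (\<lambda>k. Pi_pmf B d (p k)))"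
proof (rule pmf_eqI)
  fix f :: "'b \<Rightarrow> 'a \<Rightarrow> 'c"
  have inj: "inj (\<lambda>(x::'a \<Rightarrow> 'b \<Rightarrow> 'c) t k. x k t)"
    by (rule injI) (metis ext)
  have "pmf (map_pmf (\<lambda>x t k. x k t) (Pi_pmf A (\<lambda>_. d) (\<lambda>k. Pi_pmf B d (p k)))) f
     = pmf (Pi_pmf A (\<lambda>_. d) (\<lambda>k. Pi_pmf B d (p k))) (\<lambda>k t. f t k)"
    using pmf_map_inj'[OF inj, of _ "\<lambda>k t. f t k"] by simp
  also have "\<dots> = pmf (Pi_pmf B (\<lambda>_. d) (\<lambda>t. Pi_pmf A d (\<lambda>k. p k t))) f"
  proof (cases "\<forall>t k. t \<notin> B \<or> k \<notin> A \<longrightarrow> f t k = d")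
    case True
    then show ?thesis using assms
      by (auto simp: pmf_Pi fun_eq_iff intro: prod.swap)
  next
    case False
    then obtain t k where tk: "t \<notin> B \<or> k \<notin> A" "f t k \<noteq> d" by auto
    have z1: "pmf (Pi_pmf A (\<lambda>_. d) (\<lambda>k. Pi_pmf B d (p k))) (\<lambda>k t. f t k) = 0"
    proof (cases "k \<in> A")
      case True
      then have "pmf (Pi_pmf B d (p k)) (\<lambda>t. f t k) = 0"
        using tk assms by (intro pmf_Pi_outside) auto
      then have "(\<Prod>k\<in>A. pmf (Pi_pmf B d (p k)) (\<lambda>t. f t k)) = 0"
        using True assms by (intro prod_zero) auto
      then show ?thesis by (subst pmf_Pi[OF assms(1)]) simp
    qed (use tk assms in \<open>auto simp: pmf_Pi fun_eq_iff\<close>)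
    have z2: "pmf (Pi_pmf B (\<lambda>_. d) (\<lambda>t. Pi_pmf A d (\<lambda>k. p k t))) f = 0"
    proof (cases "t \<in> B")
      case True
      then have "pmf (Pi_pmf A d (\<lambda>k. p k t)) (f t) = 0"
        using tk assms by (intro pmf_Pi_outside) auto
      then have "(\<Prod>t\<in>B. pmf (Pi_pmf A d (\<lambda>k. p k t)) (f t)) = 0"
        using True assms by (intro prod_zero) auto
      then show ?thesis by (subst pmf_Pi[OF assms(2)]) simp
    qed (use tk assms in \<open>auto simp: pmf_Pi fun_eq_iff\<close>)
    show ?thesis using z1 z2 by simp
  qed
  finally show "pmf (Pi_pmf B (\<lambda>_. d) (\<lambda>t. Pi_pmf A d (\<lambda>k. p k t))) f
    = pmf (map_pmf (\<lambda>x t k. x k t) (Pi_pmf A (\<lambda>_. d) (\<lambda>k. Pi_pmf B d (p k)))) f" by simp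
qed

subsection \<open>Random codebooks\<close>

text \<open>\<open>\<kappa> k\<close> generates a transmitted word of relay \<open>k\<close>,
  \<open>\<mu> k x\<close> an auxiliary word around \<open>x\<close>, and \<open>\<nu>\<close> a
  source word given the transmitted words of all relays. Words are values of abstract types, so
  block length and letters enter only later.\<close>

locale random_codebook =
  fixes K :: "nat set" and L :: "nat \<Rightarrow> nat" and M :: nat
    and \<kappa> :: "nat \<Rightarrow> 'x pmf" and \<mu> :: "nat \<Rightarrow> 'x \<Rightarrow> 'u pmf" and \<nu> :: "(nat \<Rightarrow> 'x) \<Rightarrow> 'v pmf"
  assumes fin_K [simp]: "finite K" and L_pos: "k \<in> K \<Longrightarrow> 0 < L k"
begin

definition letter :: "nat \<Rightarrow> ('x \<times> 'u) pmf" where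
  "letter k = bind_pmf (\<kappa> k) (\<lambda>x. map_pmf (Pair x) (\<mu> k x))"

text \<open>A superposition codebook: \<open>L k\<close> cloud centres with \<open>L k\<close>
  satellites each, since the index to be decoded in a block ranges over the same set as the index
  being sent.\<close>

definition relay_book :: "nat \<Rightarrow> (nat \<Rightarrow> 'x \<times> (nat \<Rightarrow> 'u)) pmf" where
  "relay_book k = Pi_pmf {..<L k} undefined
     (\<lambda>l. bind_pmf (\<kappa> k) (\<lambda>x. map_pmf (Pair x) (Pi_pmf {..<L k} undefined (\<lambda>_. \<mu> k x))))"

definition pick :: "(nat \<Rightarrow> 'x \<times> (nat \<Rightarrow> 'u)) \<Rightarrow> nat \<Rightarrow> nat \<Rightarrow> 'x \<times> 'u" where
  "pick r l l' = (fst (r l), snd (r l) l')"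

definition states :: "((nat \<Rightarrow> nat) \<times> nat) set" where
  "states = PiE K (\<lambda>k. {..<L k}) \<times> {..<M}"

definition xs_of :: "(nat \<Rightarrow> 'x \<times> 'c) \<Rightarrow> nat \<Rightarrow> 'x" where
  "xs_of w = (\<lambda>k\<in>K. fst (w k))"

definition source_book :: "(nat \<Rightarrow> nat \<Rightarrow> 'x \<times> (nat \<Rightarrow> 'u)) \<Rightarrow> ((nat \<Rightarrow> nat) \<times> nat \<Rightarrow> 'v) pmf" where
  "source_book r = Pi_pmf states undefined (\<lambda>s. \<nu> (xs_of (\<lambda>k. r k (fst s k))))"

definition book :: "((nat \<Rightarrow> nat \<Rightarrow> 'x \<times> (nat \<Rightarrow> 'u)) \<times> ((nat \<Rightarrow> nat) \<times> nat \<Rightarrow> 'v)) pmf" where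
  "book = bind_pmf (Pi_pmf K undefined relay_book) (\<lambda>r. map_pmf (Pair r) (source_book r))"

definition picks :: "(nat \<Rightarrow> nat \<Rightarrow> 'x \<times> (nat \<Rightarrow> 'u)) \<Rightarrow> (nat \<Rightarrow> nat) \<Rightarrow> (nat \<Rightarrow> nat) \<Rightarrow> nat \<Rightarrow> 'x \<times> 'u" where
  "picks r l l' = (\<lambda>k\<in>K. pick (r k) (l k) (l' k))"

text \<open>The words in play in one block: the source word of state \<open>s\<close> and, for every
  relay, its transmitted word with the auxiliary word of the index \<open>l'\<close> that it is
  meant to decode.\<close>

definition branch where
  "branch c s l' = (snd c s, picks (fst c) (fst s) l')"

definition word :: "('v \<times> (nat \<Rightarrow> 'x \<times> 'u)) pmf" where
  "word = bind_pmf (Pi_pmf K undefined letter) (\<lambda>w. map_pmf (\<lambda>v. (v, w)) (\<nu> (xs_of w)))"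

text \<open>The law of a second pick from the codebook of relay \<open>k\<close>, given the first one.\<close>
definition repick :: "nat \<Rightarrow> nat \<Rightarrow> nat \<Rightarrow> nat \<Rightarrow> nat \<Rightarrow> 'x \<times> 'u \<Rightarrow> ('x \<times> 'u) pmf" where
  "repick k l l' m m' w =
     (if m \<noteq> l then letter k else if m' \<noteq> l' then map_pmf (Pair (fst w)) (\<mu> k (fst w)) else return_pmf w)"

lemma finite_states [simp]: "finite states"
  unfolding states_def by (intro finite_cartesian_product finite_PiE) auto

lemma map_pick_law:
  assumes "l' < L k" 
  shows "map_pmf (\<lambda>z. (fst z, snd z l')) (bind_pmf (\<kappa> k) (\<lambda>x. map_pmf (Pair x) (Pi_pmf {..<L k} undefined (\<lambda>_. \<mu> k x))))
    = letter k"
  unfolding letter_def map_bind_pmf pmf.map_comp o_def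
proof (intro bind_pmf_cong refl)
  fix x
  have "map_pmf (\<lambda>f. (x, f l')) (Pi_pmf {..<L k} undefined (\<lambda>_. \<mu> k x))
      = map_pmf (Pair x) (map_pmf (\<lambda>f. f l') (Pi_pmf {..<L k} undefined (\<lambda>_. \<mu> k x)))"
    by (simp add: pmf.map_comp o_def)
  then show "map_pmf (\<lambda>xa. (fst (x, xa), snd (x, xa) l')) (Pi_pmf {..<L k} undefined (\<lambda>_. \<mu> k x))
      = map_pmf (Pair x) (\<mu> k x)"
    using assms by (simp add: Pi_pmf_component)
qed

lemma pick_pair_law:
  assumes "l < L k" "l' < L k" "m < L k" "m' < L k"
  shows "map_pmf (\<lambda>r. (pick r l l', pick r m m')) (relay_book k)
    = bind_pmf (letter k) (\<lambda>w. map_pmf (Pair w) (repick k l l' m m' w))"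
proof -
  let ?Z = "bind_pmf (\<kappa> k) (\<lambda>x. map_pmf (Pair x) (Pi_pmf {..<L k} undefined (\<lambda>_. \<mu> k x)))"
  show ?thesis
  proof (cases "m = l")
    case False
    have "map_pmf (\<lambda>r. (pick r l l', pick r m m')) (relay_book k)
        = map_pmf (\<lambda>(a, b). ((fst a, snd a l'), (fst b, snd b m'))) (map_pmf (\<lambda>r. (r l, r m)) (relay_book k))"
      by (simp add: pmf.map_comp o_def pick_def)
    also have "map_pmf (\<lambda>r. (r l, r m)) (relay_book k) = pair_pmf ?Z ?Z"
      unfolding relay_book_def using assms False by (intro Pi_pmf_two_components) auto
    also have "map_pmf (\<lambda>(a, b). ((fst a, snd a l'), (fst b, snd b m'))) (pair_pmf ?Z ?Z)
        = pair_pmf (letter k) (letter k)"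
      unfolding map_pair using assms by (simp add: map_pick_law)
    finally show ?thesis using False
      by (simp add: repick_def pair_pmf_def map_pmf_def)
  next
    case True
    have "map_pmf (\<lambda>r. (pick r l l', pick r m m')) (relay_book k)
        = map_pmf (\<lambda>a. ((fst a, snd a l'), (fst a, snd a m'))) (map_pmf (\<lambda>r. r l) (relay_book k))"
      using True by (simp add: pmf.map_comp o_def pick_def)
    also have "map_pmf (\<lambda>r. r l) (relay_book k) = ?Z"
      unfolding relay_book_def using assms by (subst Pi_pmf_component) auto
    finally have *: "map_pmf (\<lambda>r. (pick r l l', pick r m m')) (relay_book k)
        = map_pmf (\<lambda>a. ((fst a, snd a l'), (fst a, snd a m'))) ?Z" .
    show ?thesis
    proof (cases "m' = l'")
      case True
      have "map_pmf (\<lambda>a. ((fst a, snd a l'), (fst a, snd a m'))) ?Z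
          = map_pmf (\<lambda>w. (w, w)) (map_pmf (\<lambda>z. (fst z, snd z l')) ?Z)"
        using True by (simp add: pmf.map_comp o_def)
      also have "\<dots> = map_pmf (\<lambda>w. (w, w)) (letter k)"
        using assms by (simp add: map_pick_law)
      finally show ?thesis using * True \<open>m = l\<close>
        by (simp add: repick_def map_pmf_def bind_return_pmf)
    next
      case False
      have "map_pmf (\<lambda>a. ((fst a, snd a l'), (fst a, snd a m'))) ?Z
          = bind_pmf (\<kappa> k) (\<lambda>x. map_pmf (\<lambda>(a, b). ((x, a), (x, b)))
              (map_pmf (\<lambda>f. (f l', f m')) (Pi_pmf {..<L k} undefined (\<lambda>_. \<mu> k x))))"
        by (simp add: map_bind_pmf pmf.map_comp o_def)
      also have "\<dots> = bind_pmf (\<kappa> k) (\<lambda>x. map_pmf (\<lambda>(a, b). ((x, a), (x, b))) (pair_pmf (\<mu> k x) (\<mu> k x)))"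
        using assms False by (subst Pi_pmf_two_components) auto
      also have "\<dots> = bind_pmf (letter k) (\<lambda>w. map_pmf (Pair w) (map_pmf (Pair (fst w)) (\<mu> k (fst w))))"
        by (simp add: letter_def pair_pmf_def map_pmf_def bind_assoc_pmf bind_return_pmf)
      finally show ?thesis using * False \<open>m = l\<close>
        by (simp add: repick_def)
    qed
  qed
qed

definition indices :: "(nat \<Rightarrow> nat) set" where
  "indices = PiE K (\<lambda>k. {..<L k})"

lemma picks_pair_law:
  assumes "l \<in> indices" "l' \<in> indices" "m \<in> indices" "m' \<in> indices"
  shows "map_pmf (\<lambda>r. (picks r l l', picks r m m')) (Pi_pmf K undefined relay_book)
    = bind_pmf (Pi_pmf K undefined letter)
        (\<lambda>w. map_pmf (Pair w) (Pi_pmf K undefined (\<lambda>k. repick k (l k) (l' k) (m k) (m' k) (w k))))"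
proof -
  have "map_pmf (\<lambda>r. (picks r l l', picks r m m')) (Pi_pmf K undefined relay_book)
     = map_pmf (\<lambda>g. (\<lambda>k\<in>K. fst (g k), \<lambda>k\<in>K. snd (g k)))
        (map_pmf (\<lambda>r. \<lambda>k\<in>K. (pick (r k) (l k) (l' k), pick (r k) (m k) (m' k))) (Pi_pmf K undefined relay_book))"
    by (simp add: pmf.map_comp o_def picks_def restrict_def cong: if_cong)
  also have "map_pmf (\<lambda>r. \<lambda>k\<in>K. (pick (r k) (l k) (l' k), pick (r k) (m k) (m' k))) (Pi_pmf K undefined relay_book)
     = Pi_pmf K undefined (\<lambda>k. map_pmf (\<lambda>r. (pick r (l k) (l' k), pick r (m k) (m' k))) (relay_book k))"
    by (rule map_Pi_pmf_restrict) simp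
  also have "\<dots> = Pi_pmf K undefined (\<lambda>k. bind_pmf (letter k) (\<lambda>w. map_pmf (Pair w) (repick k (l k) (l' k) (m k) (m' k) w)))"
    using assms by (intro Pi_pmf_cong refl pick_pair_law) (auto simp: indices_def PiE_iff)
  also have "map_pmf (\<lambda>g. (\<lambda>k\<in>K. fst (g k), \<lambda>k\<in>K. snd (g k))) \<dots>
     = bind_pmf (Pi_pmf K undefined letter)
        (\<lambda>w. map_pmf (Pair w) (Pi_pmf K undefined (\<lambda>k. repick k (l k) (l' k) (m k) (m' k) (w k))))"
    by (rule Pi_pmf_pair_bind) simp
  finally show ?thesis .
qed

lemma picks_law:
  assumes "l \<in> indices" "l' \<in> indices"
  shows "map_pmf (\<lambda>r. picks r l l') (Pi_pmf K undefined relay_book) = Pi_pmf K undefined letter"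
proof -
  have "map_pmf (\<lambda>r. picks r l l') (Pi_pmf K undefined relay_book)
     = map_pmf fst (map_pmf (\<lambda>r. (picks r l l', picks r l l')) (Pi_pmf K undefined relay_book))"
    by (simp add: pmf.map_comp o_def)
  also have "\<dots> = Pi_pmf K undefined letter"
    unfolding picks_pair_law[OF assms assms]
    by (simp add: map_bind_pmf pmf.map_comp o_def bind_return_pmf')
  finally show ?thesis .
qed

lemma xs_of_picks [simp]: "xs_of (picks r l l') = xs_of (\<lambda>k. r k (l k))"
  by (auto simp: xs_of_def picks_def pick_def)

lemma states_iff: "s \<in> states \<longleftrightarrow> fst s \<in> indices \<and> snd s < M"
  by (cases s) (auto simp: states_def indices_def)

lemma branch_law:
  assumes "s \<in> states" "l' \<in> indices"
  shows "map_pmf (\<lambda>c. branch c s l') book = word"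
proof -
  have "map_pmf (\<lambda>c. branch c s l') book
     = bind_pmf (Pi_pmf K undefined relay_book)
        (\<lambda>r. map_pmf (\<lambda>v. (v, picks r (fst s) l')) (map_pmf (\<lambda>f. f s) (source_book r)))"
    by (simp add: book_def branch_def map_bind_pmf pmf.map_comp o_def)
  also have "\<dots> = bind_pmf (Pi_pmf K undefined relay_book)
        (\<lambda>r. map_pmf (\<lambda>v. (v, picks r (fst s) l')) (\<nu> (xs_of (picks r (fst s) l'))))"
    using assms(1) by (simp add: source_book_def Pi_pmf_component)
  also have "\<dots> = bind_pmf (map_pmf (\<lambda>r. picks r (fst s) l') (Pi_pmf K undefined relay_book))
        (\<lambda>w. map_pmf (\<lambda>v. (v, w)) (\<nu> (xs_of w)))"
    by (simp add: bind_map_pmf)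
  also have "\<dots> = word"
    using assms by (subst picks_law) (auto simp: states_iff word_def)
  finally show ?thesis .
qed

text \<open>Given the relay words, source words of distinct states are independent, even if the
  states differ in the source index alone. The two vectors of next indices are arbitrary.\<close>

lemma branch_pair_law:
  assumes "s \<in> states" "l' \<in> indices" "t \<in> states" "m' \<in> indices" "t \<noteq> s"
  shows "map_pmf (\<lambda>c. (branch c s l', branch c t m')) book
    = bind_pmf word (\<lambda>(v, w).
        bind_pmf (Pi_pmf K undefined (\<lambda>k. repick k (fst s k) (l' k) (fst t k) (m' k) (w k)))
          (\<lambda>w'. map_pmf (\<lambda>v'. ((v, w), (v', w'))) (\<nu> (xs_of w'))))"
proof -
  let ?R = "Pi_pmf K undefined relay_book" 
  let ?rep = "\<lambda>w. Pi_pmf K undefined (\<lambda>k. repick k (fst s k) (l' k) (fst t k) (m' k) (w k))"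
  have "map_pmf (\<lambda>c. (branch c s l', branch c t m')) book
     = bind_pmf ?R (\<lambda>r. map_pmf (\<lambda>(v, v'). ((v, picks r (fst s) l'), (v', picks r (fst t) m')))
          (map_pmf (\<lambda>f. (f s, f t)) (source_book r)))"
    by (simp add: book_def branch_def map_bind_pmf pmf.map_comp o_def)
  also have "\<dots> = bind_pmf ?R (\<lambda>r. map_pmf (\<lambda>(v, v'). ((v, picks r (fst s) l'), (v', picks r (fst t) m')))
          (pair_pmf (\<nu> (xs_of (picks r (fst s) l'))) (\<nu> (xs_of (picks r (fst t) m')))))"
    using assms by (simp add: source_book_def Pi_pmf_two_components)
  also have "\<dots> = bind_pmf (map_pmf (\<lambda>r. (picks r (fst s) l', picks r (fst t) m')) ?R)
      (\<lambda>(w, w'). map_pmf (\<lambda>(v, v'). ((v, w), (v', w'))) (pair_pmf (\<nu> (xs_of w)) (\<nu> (xs_of w'))))"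
    by (simp add: bind_map_pmf)
  also have "\<dots> = bind_pmf (Pi_pmf K undefined letter) (\<lambda>w. bind_pmf (?rep w)
      (\<lambda>w'. map_pmf (\<lambda>(v, v'). ((v, w), (v', w'))) (pair_pmf (\<nu> (xs_of w)) (\<nu> (xs_of w')))))"
    using assms by (subst picks_pair_law) (auto simp: states_iff bind_assoc_pmf bind_map_pmf)
  \<comment> \<open>The draws are exchanged so that the first branch is complete before anything of
    the second is drawn; the first stage is then \<open>word\<close>.\<close>
  also have "\<dots> = bind_pmf (Pi_pmf K undefined letter) (\<lambda>w. bind_pmf (\<nu> (xs_of w)) (\<lambda>v. bind_pmf (?rep w)
      (\<lambda>w'. map_pmf (\<lambda>v'. ((v, w), (v', w'))) (\<nu> (xs_of w')))))"
    by (subst bind_commute_pmf[of "\<nu> _" "?rep _"])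
       (simp add: pair_pmf_def map_pmf_def bind_assoc_pmf bind_return_pmf)
  also have "\<dots> = bind_pmf word (\<lambda>(v, w). bind_pmf (?rep w) (\<lambda>w'. map_pmf (\<lambda>v'. ((v, w), (v', w'))) (\<nu> (xs_of w'))))"
    by (simp add: word_def bind_assoc_pmf bind_map_pmf)
  finally show ?thesis .
qed

text \<open>Changing the next indices at the single coordinate \<open>k\<close> makes this an
  instance of \<open>picks_pair_law\<close>: relay \<open>k\<close> sees the same centre with
  another satellite, which is fresh.\<close>

lemma branch_relay_law:
  assumes "s \<in> states" "l' \<in> indices" "k \<in> K" "m' < L k" "m' \<noteq> l' k"
  shows "map_pmf (\<lambda>c. (branch c s l', snd (pick (fst c k) (fst s k) m'))) book
    = bind_pmf word (\<lambda>(v, w). map_pmf (Pair (v, w)) (\<mu> k (fst (w k))))"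
proof -
  let ?R = "Pi_pmf K undefined relay_book" 
  let ?m = "l'(k := m')"
  let ?rep = "\<lambda>w. Pi_pmf K undefined (\<lambda>k. repick k (fst s k) (l' k) (fst s k) (?m k) (w k))"
  have m: "?m \<in> indices" using assms by (auto simp: indices_def PiE_iff extensional_def)
  have "map_pmf (\<lambda>c. (branch c s l', snd (pick (fst c k) (fst s k) m'))) book
     = bind_pmf ?R (\<lambda>r. map_pmf (\<lambda>v. ((v, picks r (fst s) l'), snd (picks r (fst s) ?m k)))
          (map_pmf (\<lambda>f. f s) (source_book r)))"
    using assms(3) by (simp add: book_def branch_def map_bind_pmf pmf.map_comp o_def picks_def cong: if_cong)
  also have "\<dots> = bind_pmf ?R (\<lambda>r. map_pmf (\<lambda>v. ((v, picks r (fst s) l'), snd (picks r (fst s) ?m k)))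
          (\<nu> (xs_of (picks r (fst s) l'))))"
    using assms by (simp add: source_book_def Pi_pmf_component)
  also have "\<dots> = bind_pmf (map_pmf (\<lambda>r. (picks r (fst s) l', picks r (fst s) ?m)) ?R)
      (\<lambda>(w, w'). map_pmf (\<lambda>v. ((v, w), snd (w' k))) (\<nu> (xs_of w)))"
    by (simp add: bind_map_pmf)
  also have "\<dots> = bind_pmf (Pi_pmf K undefined letter) (\<lambda>w. bind_pmf (?rep w)
      (\<lambda>w'. bind_pmf (\<nu> (xs_of w)) (\<lambda>v. return_pmf ((v, w), snd (w' k)))))"
    using assms m by (subst picks_pair_law) (auto simp: states_iff bind_assoc_pmf bind_map_pmf map_pmf_def bind_return_pmf)
  also have "\<dots> = bind_pmf (Pi_pmf K undefined letter) (\<lambda>w. bind_pmf (\<nu> (xs_of w)) (\<lambda>v.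
      map_pmf (\<lambda>z. ((v, w), snd z)) (map_pmf (\<lambda>w'. w' k) (?rep w))))"
    by (subst bind_commute_pmf[of "?rep _" "\<nu> _"]) (simp add: map_pmf_def bind_assoc_pmf bind_return_pmf)
  also have "\<dots> = bind_pmf (Pi_pmf K undefined letter) (\<lambda>w. bind_pmf (\<nu> (xs_of w)) (\<lambda>v.
      map_pmf (Pair (v, w)) (\<mu> k (fst (w k)))))"
    using assms by (subst Pi_pmf_component) (auto simp: repick_def pmf.map_comp o_def)
  also have "\<dots> = bind_pmf word (\<lambda>(v, w). map_pmf (Pair (v, w)) (\<mu> k (fst (w k))))"
    by (simp add: word_def bind_assoc_pmf bind_map_pmf)
  finally show ?thesis .
qed

end

subsection \<open>Expected error of a random scheme\<close>

text \<open>Exchanging integrals amounts to commuting two draws, so no product measure has to be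
  formed.\<close>

lemma nn_integral_pmf_swap:
  "(\<integral>\<^sup>+a. \<integral>\<^sup>+b. f a b \<partial>measure_pmf B \<partial>measure_pmf A) = (\<integral>\<^sup>+b. \<integral>\<^sup>+a. f a b \<partial>measure_pmf A \<partial>measure_pmf B)"
proof -
  have "(\<integral>\<^sup>+a. \<integral>\<^sup>+b. f a b \<partial>measure_pmf B \<partial>measure_pmf A)
      = (\<integral>\<^sup>+z. case_prod f z \<partial>bind_pmf A (\<lambda>a. bind_pmf B (\<lambda>b. return_pmf (a, b))))"
    by simp
  also have "\<dots> = (\<integral>\<^sup>+z. case_prod f z \<partial>bind_pmf B (\<lambda>b. bind_pmf A (\<lambda>a. return_pmf (a, b))))"
    by (subst bind_commute_pmf) simp
  finally show ?thesis by simp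
qed

lemma emeasure_pmf_swap:
  fixes A :: "'a pmf" and B :: "'b pmf"
  shows "(\<integral>\<^sup>+a. emeasure (measure_pmf B) {b. P a b} \<partial>measure_pmf A) = (\<integral>\<^sup>+b. emeasure (measure_pmf A) {a. P a b} \<partial>measure_pmf B)"
  using nn_integral_pmf_swap[where f = "\<lambda>a b. indicator {(a, b). P a b} (a, b)" and A = A and B = B]
    nn_integral_indicator[of "{b. P a b}" "measure_pmf B" for a]
    nn_integral_indicator[of "{a. P a b}" "measure_pmf A" for b]
  by (simp add: indicator_def)

text \<open>Condition on the coordinates outside \<open>S\<close>; the bound is uniform in them, so
  nothing about their law enters. This handles a wrong branch whose relays outside \<open>S\<close>
  have the right index but may announce any next one.\<close>

lemma Pi_pmf_replace:
  assumes "finite K" "S \<subseteq> K" "\<And>w. nn_integral (Pi_pmf S undefined q) (\<lambda>w'. f (\<lambda>k. if k \<in> S then w' k else w k)) \<le> c"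
    "\<And>k. k \<in> S \<Longrightarrow> p k = q k"
  shows "nn_integral (Pi_pmf K undefined p) f \<le> (c::ennreal)"
proof -
  have fin: "finite S" "finite (K - S)" using assms by (auto dest: finite_subset)
  have K: "K = S \<union> (K - S)" using assms by auto
  have "Pi_pmf K undefined p = map_pmf (\<lambda>(w', w) k. if k \<in> S then w' k else w k)
       (pair_pmf (Pi_pmf S undefined p) (Pi_pmf (K - S) undefined p))"
    by (subst K, rule Pi_pmf_union) (use fin in auto)
  also have "Pi_pmf S undefined p = Pi_pmf S undefined q" using assms by (intro Pi_pmf_cong) auto
  finally have "nn_integral (Pi_pmf K undefined p) f = (\<integral>\<^sup>+w. \<integral>\<^sup>+w'. f (\<lambda>k. if k \<in> S then w' k else w k)
      \<partial>Pi_pmf S undefined q \<partial>Pi_pmf (K - S) undefined p)"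
    by (simp add: nn_integral_pair_pmf' nn_integral_pmf_swap[of _ "Pi_pmf (K - S) undefined p"])
  also have "\<dots> \<le> (\<integral>\<^sup>+w. c \<partial>Pi_pmf (K - S) undefined p)"
    by (intro nn_integral_mono assms)
  finally show ?thesis by simp
qed

lemma bind_pmf_le:
  fixes c :: ennreal
  assumes "\<And>z. z \<in> T \<Longrightarrow> (\<integral>\<^sup>+z'. f z z' \<partial>measure_pmf (Q z)) \<le> c"
  shows "(\<integral>\<^sup>+p. indicator T (fst p) * f (fst p) (snd p) \<partial>bind_pmf P (\<lambda>z. map_pmf (Pair z) (Q z))) \<le> emeasure P T * c"
proof -
  have "(\<integral>\<^sup>+p. indicator T (fst p) * f (fst p) (snd p) \<partial>bind_pmf P (\<lambda>z. map_pmf (Pair z) (Q z)))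
     = (\<integral>\<^sup>+z. indicator T z * (\<integral>\<^sup>+z'. f z z' \<partial>measure_pmf (Q z)) \<partial>measure_pmf P)"
    by (simp add: nn_integral_cmult)
  also have "\<dots> \<le> (\<integral>\<^sup>+z. indicator T z * c \<partial>measure_pmf P)"
    by (intro nn_integral_mono) (auto simp: indicator_def assms)
  also have "\<dots> = emeasure P T * c"
    by (simp add: nn_integral_multc)
  finally show ?thesis .
qed

text \<open>\<open>T0\<close> holds the typical branches, \<open>W\<close> is the law of an output
  block given the true branch, \<open>TR\<close> and \<open>TD\<close> are the tests of relays and
  destinations. In \<open>dest_bound\<close> the output is fixed and only the words of the relays in
  \<open>S\<close> and the source word are redrawn, for arbitrary frozen words elsewhere.\<close>

locale random_scheme = random_codebook K L M \<kappa> \<mu> \<nu>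
  for K :: "nat set" and L :: "nat \<Rightarrow> nat" and M :: nat
    and \<kappa> :: "nat \<Rightarrow> 'x pmf" and \<mu> :: "nat \<Rightarrow> 'x \<Rightarrow> 'u pmf" and \<nu> :: "(nat \<Rightarrow> 'x) \<Rightarrow> 'v pmf" +
  fixes b :: nat and D :: "nat set" and T0 :: "('v \<times> (nat \<Rightarrow> 'x \<times> 'u)) set"
    and W :: "'v \<times> (nat \<Rightarrow> 'x \<times> 'u) \<Rightarrow> 'y pmf"
    and TR :: "nat \<Rightarrow> 'x \<times> 'u \<Rightarrow> 'y \<Rightarrow> bool" and TD :: "nat \<Rightarrow> 'v \<times> (nat \<Rightarrow> 'x \<times> 'u) \<Rightarrow> 'y \<Rightarrow> bool"
    and \<epsilon> :: ennreal and \<beta> :: "nat \<Rightarrow> ennreal" and \<gamma> :: "nat \<Rightarrow> nat set \<Rightarrow> ennreal"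
  assumes b_pos: "0 < b" and D_sub: "D \<subseteq> K"
    and T0: "z \<in> T0 \<Longrightarrow> emeasure (W z) {y. \<not> ((\<forall>k\<in>K. TR k (snd z k) y) \<and> (\<forall>d\<in>D. TD d z y))} \<le> \<epsilon>"
    and relay_bound: "k \<in> K \<Longrightarrow> emeasure (\<mu> k x) {u. TR k (x, u) y} \<le> \<beta> k"
    and dest_bound: "d \<in> D \<Longrightarrow> S \<subseteq> K - {d} \<Longrightarrow>
      (\<integral>\<^sup>+w'. emeasure (\<nu> (xs_of (\<lambda>k. if k \<in> S then w' k else w k)))
          {v. TD d (v, \<lambda>k. if k \<in> S then w' k else w k) y} \<partial>Pi_pmf S undefined letter) \<le> \<gamma> d S"
begin

definition zero_idx :: "nat \<Rightarrow> nat" where "zero_idx = (\<lambda>k\<in>K. 0)"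

text \<open>The first and the last index vectors are fixed, so that every node knows them in advance.\<close>
definition paths :: "(nat \<Rightarrow> (nat \<Rightarrow> nat) \<times> nat) set" where
  "paths = {s \<in> PiE {..<b} (\<lambda>_. states). fst (s 0) = zero_idx}"

definition nxt :: "(nat \<Rightarrow> (nat \<Rightarrow> nat) \<times> nat) \<Rightarrow> nat \<Rightarrow> nat \<Rightarrow> nat" where
  "nxt s j = (if Suc j < b then fst (s (Suc j)) else zero_idx)"

definition br where "br C s j = branch (C j) (s j) (nxt s j)"

definition books where "books = Pi_pmf {..<b} undefined (\<lambda>_. book)"

definition \<tau> :: ennreal where "\<tau> = emeasure word T0"

abbreviation "accepts z y \<equiv> (\<forall>k\<in>K. TR k (snd z k) y) \<and> (\<forall>d\<in>D. TD d z y)"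

abbreviation "misled C s j k m y \<equiv> TR k (pick (fst (C j) k) (fst (s j) k) m) y"

text \<open>As a relay, a destination has decoded its own index in every block, so only paths that
  agree with the true one in coordinate \<open>d\<close> compete.\<close>

definition wrong :: "nat \<Rightarrow> (nat \<Rightarrow> (nat \<Rightarrow> nat) \<times> nat) \<Rightarrow> (nat \<Rightarrow> (nat \<Rightarrow> nat) \<times> nat) set" where
  "wrong d s = {t \<in> paths. t \<noteq> s \<and> (\<forall>j<b. fst (t j) d = fst (s j) d)}"

text \<open>A union bound for a fixed codebook: some test rejects the true branch, a relay accepts a
  wrong index, or a destination accepts an entire wrong path. Given the path the output blocks are
  independent, hence the product.\<close>

definition err where
  "err C s = (\<Sum>j<b. emeasure (W (br C s j)) {y. \<not> accepts (br C s j) y})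
     + (\<Sum>j<b. \<Sum>k\<in>K. \<Sum>m\<in>{..<L k} - {nxt s j k}. emeasure (W (br C s j)) {y. misled C s j k m y})
     + (\<Sum>d\<in>D. \<Sum>t\<in>wrong d s. \<Prod>j<b. emeasure (W (br C s j)) {y. TD d (br C t j) y})"

definition differ :: "(nat \<Rightarrow> nat) \<times> nat \<Rightarrow> (nat \<Rightarrow> nat) \<times> nat \<Rightarrow> nat set" where
  "differ s t = {k \<in> K. fst t k \<noteq> fst s k}"

text \<open>Bounds the expected number of wrong states that pass the test of \<open>d\<close> in one
  block, grouped by the set \<open>S\<close> of relays with a wrong index. \<open>S = {}\<close>
  accounts for states with just a wrong source index.\<close>

definition \<Gamma> :: "nat \<Rightarrow> ennreal" where
  "\<Gamma> d = (\<Sum>S\<in>Pow (K - {d}). (\<Prod>k\<in>S. of_nat (L k - 1)) * of_nat M * \<gamma> d S)"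

definition err_bound :: ennreal where
  "err_bound = of_nat b * \<epsilon> + of_nat b * (\<Sum>k\<in>K. of_nat (L k - 1) * \<beta> k) + (\<Sum>d\<in>D. (1 + \<Gamma> d) ^ b - 1)"

lemma finite_D [simp]: "finite D"
  using D_sub fin_K by (rule finite_subset)

lemma zero_idx: "zero_idx \<in> indices"
  using L_pos by (auto simp: zero_idx_def indices_def)

lemma pathsD: "s \<in> paths \<Longrightarrow> j < b \<Longrightarrow> s j \<in> states" "s \<in> paths \<Longrightarrow> nxt s j \<in> indices"
  using zero_idx by (auto simp: paths_def nxt_def PiE_iff states_iff)

lemma finite_paths [simp]: "finite paths"
proof -
  have "finite (PiE {..<b} (\<lambda>_. states))" by (intro finite_PiE) auto
  then show ?thesis unfolding paths_def by (rule rev_finite_subset) auto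
qed

lemma block_T0:
  assumes "s \<in> states" "l' \<in> indices"
  shows "(\<integral>\<^sup>+c. indicator T0 (branch c s l') \<partial>book) = \<tau>"
proof -
  have "\<tau> = (\<integral>\<^sup>+z. indicator T0 z \<partial>map_pmf (\<lambda>c. branch c s l') book)"
    unfolding \<tau>_def branch_law[OF assms] by simp
  then show ?thesis by simp
qed

text \<open>Given the true branch, the wrong auxiliary word is independent of the output, so the
  output can be fixed before \<open>relay_bound\<close> is applied.\<close>

lemma block_relay:
  assumes "s \<in> states" "l' \<in> indices" "k \<in> K" "m < L k" "m \<noteq> l' k"
  shows "(\<integral>\<^sup>+c. indicator T0 (branch c s l') * emeasure (W (branch c s l')) {y. TR k (pick (fst c k) (fst s k) m) y} \<partial>book)
     \<le> \<tau> * \<beta> k" (is "?lhs \<le> _")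
proof -
  let ?f = "\<lambda>z u. emeasure (measure_pmf (W z)) {y. TR k (fst (snd z k), u) y}"
  have x: "pick (fst c k) (fst s k) m = (fst (snd (branch c s l') k), snd (pick (fst c k) (fst s k) m))" for c
    using assms(3) by (simp add: pick_def branch_def picks_def)
  have "?lhs = (\<integral>\<^sup>+p. indicator T0 (fst p) * ?f (fst p) (snd p)
        \<partial>map_pmf (\<lambda>c. (branch c s l', snd (pick (fst c k) (fst s k) m))) book)"
    by (subst x) simp
  also have "\<dots> = (\<integral>\<^sup>+p. indicator T0 (fst p) * ?f (fst p) (snd p)
        \<partial>bind_pmf word (\<lambda>z. map_pmf (Pair z) (\<mu> k (fst (snd z k)))))"
    using assms by (subst branch_relay_law) (auto simp: case_prod_unfold)
  also have "\<dots> \<le> \<tau> * \<beta> k"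
    unfolding \<tau>_def
  proof (rule bind_pmf_le)
    fix z
    have "(\<integral>\<^sup>+u. ?f z u \<partial>\<mu> k (fst (snd z k)))
       = (\<integral>\<^sup>+y. emeasure (\<mu> k (fst (snd z k))) {u. TR k (fst (snd z k), u) y} \<partial>W z)"
      by (rule emeasure_pmf_swap)
    also have "\<dots> \<le> (\<integral>\<^sup>+y. \<beta> k \<partial>W z)"
      by (intro nn_integral_mono relay_bound assms)
    finally show "(\<integral>\<^sup>+u. ?f z u \<partial>\<mu> k (fst (snd z k))) \<le> \<beta> k" by simp
  qed
  finally show ?thesis .
qed

text \<open>Given the true branch, the output and the wrong branch are independent, so
  \<open>dest_bound\<close> applies at a fixed output. Under \<open>repick\<close> the relays in
  \<open>differ s t\<close> get entirely fresh pairs; the others, whatever they announce, count as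
  frozen coordinates.\<close>

lemma block_dest:
  assumes "s \<in> states" "l' \<in> indices" "t \<in> states" "m' \<in> indices" "t \<noteq> s" "d \<in> D" "fst t d = fst s d"
  shows "(\<integral>\<^sup>+c. indicator T0 (branch c s l') * emeasure (W (branch c s l')) {y. TD d (branch c t m') y} \<partial>book)
     \<le> \<tau> * \<gamma> d (differ s t)" (is "?lhs \<le> _")
proof -
  let ?S = "differ s t"
  let ?f = "\<lambda>z z'. emeasure (measure_pmf (W z)) {y. TD d z' y}"
  let ?rep = "\<lambda>w. Pi_pmf K undefined (\<lambda>k. repick k (fst s k) (l' k) (fst t k) (m' k) (w k))"
  let ?Q = "\<lambda>z. bind_pmf (?rep (snd z)) (\<lambda>w'. map_pmf (\<lambda>v'. (v', w')) (\<nu> (xs_of w')))"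
  have S: "?S \<subseteq> K - {d}" "?S \<subseteq> K" using assms by (auto simp: differ_def)
  have "?lhs = (\<integral>\<^sup>+p. indicator T0 (fst p) * ?f (fst p) (snd p)
        \<partial>map_pmf (\<lambda>c. (branch c s l', branch c t m')) book)"
    by simp
  also have "map_pmf (\<lambda>c. (branch c s l', branch c t m')) book = bind_pmf word (\<lambda>z. map_pmf (Pair z) (?Q z))"
    by (subst branch_pair_law[OF assms(1-5)]) (simp add: case_prod_unfold map_bind_pmf pmf.map_comp o_def)
  also have "(\<integral>\<^sup>+p. indicator T0 (fst p) * ?f (fst p) (snd p) \<partial>\<dots>) \<le> \<tau> * \<gamma> d ?S"
    unfolding \<tau>_def
  proof (rule bind_pmf_le)
    fix z
    have "(\<integral>\<^sup>+z'. ?f z z' \<partial>?Q z) = (\<integral>\<^sup>+y. emeasure (?Q z) {z'. TD d z' y} \<partial>W z)"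
      by (rule emeasure_pmf_swap)
    also have "\<dots> \<le> (\<integral>\<^sup>+y. \<gamma> d ?S \<partial>W z)"
    proof (intro nn_integral_mono)
      fix y
      have "emeasure (?Q z) {z'. TD d z' y}
         = (\<integral>\<^sup>+w. emeasure (\<nu> (xs_of w)) {v. TD d (v, w) y} \<partial>?rep (snd z))"
        by (simp add: vimage_def)
      also have "\<dots> \<le> \<gamma> d ?S"
      proof (rule Pi_pmf_replace[where S = ?S and q = letter])
        show "(\<integral>\<^sup>+w'. emeasure (\<nu> (xs_of (\<lambda>k. if k \<in> ?S then w' k else w k)))
          {v. TD d (v, \<lambda>k. if k \<in> ?S then w' k else w k) y} \<partial>Pi_pmf ?S undefined letter) \<le> \<gamma> d ?S" for w
          using assms(6) S(1) by (rule dest_bound)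
      qed (use S in \<open>auto simp: repick_def differ_def\<close>)
      finally show "emeasure (?Q z) {z'. TD d z' y} \<le> \<gamma> d ?S" .
    qed
    finally show "(\<integral>\<^sup>+z'. ?f z z' \<partial>?Q z) \<le> \<gamma> d ?S" by simp
  qed
  finally show ?thesis .
qed

definition good where "good C s \<longleftrightarrow> (\<forall>j<b. br C s j \<in> T0)"

text \<open>The indicator of \<open>good C s\<close>, written as a product so that its expectation
  over the independent codebooks of the blocks factorizes.\<close>

definition Ig :: "_ \<Rightarrow> _ \<Rightarrow> ennreal" where "Ig C s = (\<Prod>j<b. indicator T0 (br C s j))"

lemma Ig_eq: "Ig C s = (if good C s then 1 else 0)"
  by (auto simp: Ig_def good_def indicator_def)

lemma nn_integral_books_prod: "(\<integral>\<^sup>+C. (\<Prod>j<b. f j (C j)) \<partial>books) = (\<Prod>j<b. \<integral>\<^sup>+c. f j c \<partial>book)"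
  unfolding books_def by (rule nn_integral_prod_Pi_pmf) simp

lemma integral_Ig:
  assumes "s \<in> paths"
  shows "(\<integral>\<^sup>+C. Ig C s \<partial>books) = \<tau> ^ b"
proof -
  have "(\<integral>\<^sup>+C. Ig C s \<partial>books) = (\<Prod>j<b. \<integral>\<^sup>+c. indicator T0 (branch c (s j) (nxt s j)) \<partial>book)"
    unfolding Ig_def br_def by (rule nn_integral_books_prod)
  also have "\<dots> = (\<Prod>j<b. \<tau>)"
    using assms by (intro prod.cong refl block_T0) (auto dest: pathsD)
  finally show ?thesis by simp
qed

lemma integral_relay:
  assumes "s \<in> paths" "j < b" "k \<in> K" "m < L k" "m \<noteq> nxt s j k"
  shows "(\<integral>\<^sup>+C. Ig C s * emeasure (W (br C s j)) {y. misled C s j k m y} \<partial>books)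
     \<le> \<tau> ^ b * \<beta> k"
proof -
  let ?g = "\<lambda>i c. indicator T0 (branch c (s i) (nxt s i)) *
     (if i = j then emeasure (measure_pmf (W (branch c (s i) (nxt s i)))) {y. TR k (pick (fst c k) (fst (s i) k) m) y} else 1)"
  have "(\<integral>\<^sup>+C. Ig C s * emeasure (W (br C s j)) {y. misled C s j k m y} \<partial>books)
     = (\<integral>\<^sup>+C. (\<Prod>i<b. ?g i (C i)) \<partial>books)"
    using assms(2) by (simp add: prod.distrib Ig_def br_def)
  also have "\<dots> = (\<Prod>i<b. \<integral>\<^sup>+c. ?g i c \<partial>book)" by (rule nn_integral_books_prod)
  also have "\<dots> \<le> (\<Prod>i<b. \<tau> * (if i = j then \<beta> k else 1))"
  proof (intro prod_mono_ennreal)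
    fix i assume "i \<in> {..<b}"
    then show "(\<integral>\<^sup>+c. ?g i c \<partial>book) \<le> \<tau> * (if i = j then \<beta> k else 1)"
      using assms block_relay[of "s j" "nxt s j" k m] block_T0[of "s i" "nxt s i"] pathsD[of s]
      by (cases "i = j") auto
  qed
  also have "\<dots> = \<tau> ^ b * \<beta> k"
    using assms(2) by (simp add: prod.distrib)
  finally show ?thesis .
qed

text \<open>The expectation factorizes over the blocks. A block where both paths have the same state
  is bounded by one, even if they announce different indices there; that difference is charged to
  the next block.\<close>

lemma integral_dest:
  assumes "s \<in> paths" "t \<in> paths" "d \<in> D" "\<forall>j<b. fst (t j) d = fst (s j) d"
  shows "(\<integral>\<^sup>+C. Ig C s * (\<Prod>j<b. emeasure (W (br C s j)) {y. TD d (br C t j) y}) \<partial>books)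
     \<le> \<tau> ^ b * (\<Prod>j<b. if t j = s j then 1 else \<gamma> d (differ (s j) (t j)))"
proof -
  let ?g = "\<lambda>i c. indicator T0 (branch c (s i) (nxt s i)) *
     emeasure (measure_pmf (W (branch c (s i) (nxt s i)))) {y. TD d (branch c (t i) (nxt t i)) y}"
  have "(\<integral>\<^sup>+C. Ig C s * (\<Prod>j<b. emeasure (W (br C s j)) {y. TD d (br C t j) y}) \<partial>books)
     = (\<integral>\<^sup>+C. (\<Prod>i<b. ?g i (C i)) \<partial>books)"
    by (simp add: prod.distrib Ig_def br_def)
  also have "\<dots> = (\<Prod>i<b. \<integral>\<^sup>+c. ?g i c \<partial>book)" by (rule nn_integral_books_prod)
  also have "\<dots> \<le> (\<Prod>i<b. \<tau> * (if t i = s i then 1 else \<gamma> d (differ (s i) (t i))))"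
  proof (intro prod_mono_ennreal)
    fix i assume i: "i \<in> {..<b}"
    show "(\<integral>\<^sup>+c. ?g i c \<partial>book) \<le> \<tau> * (if t i = s i then 1 else \<gamma> d (differ (s i) (t i)))"
    proof (cases "t i = s i")
      case True
      have "(\<integral>\<^sup>+c. ?g i c \<partial>book) \<le> (\<integral>\<^sup>+c. indicator T0 (branch c (s i) (nxt s i)) * 1 \<partial>book)"
        by (intro nn_integral_mono mult_left_mono measure_pmf.emeasure_le_1) simp
      also have "\<dots> = \<tau>" using assms i block_T0[of "s i" "nxt s i"] by (auto dest: pathsD)
      finally show ?thesis using True by simp
    next
      case False
      then show ?thesis using assms i by (auto intro!: block_dest dest: pathsD)
    qed
  qed
  also have "\<dots> = \<tau> ^ b * (\<Prod>j<b. if t j = s j then 1 else \<gamma> d (differ (s j) (t j)))"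
    by (simp add: prod.distrib)
  finally show ?thesis .
qed

text \<open>The true state contributes the 1. A wrong state is classified by the set of relays where
  it differs, and each of these relays has \<open>L k - 1\<close> wrong indices.\<close>

lemma sum_states_le:
  assumes "s \<in> states" "d \<in> D"
  shows "(\<Sum>t\<in>{t \<in> states. fst t d = fst s d}. if t = s then 1 else \<gamma> d (differ s t)) \<le> 1 + \<Gamma> d"
proof -
  let ?T = "{t \<in> states. fst t d = fst s d}"
  have "(\<Sum>t\<in>?T. if t = s then 1 else \<gamma> d (differ s t)) = 1 + (\<Sum>t\<in>?T - {s}. \<gamma> d (differ s t))"
    using assms by (subst sum.remove[of _ s]) auto
  also have "(\<Sum>t\<in>?T - {s}. \<gamma> d (differ s t)) \<le> (\<Sum>t\<in>?T. \<gamma> d (differ s t))"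
    by (intro sum_mono2) auto
  also have "\<dots> = (\<Sum>S\<in>Pow (K - {d}). \<Sum>t\<in>{t \<in> ?T. differ s t = S}. \<gamma> d (differ s t))"
    by (intro sum.group[symmetric]) (auto simp: differ_def)
  also have "\<dots> \<le> \<Gamma> d"
    unfolding \<Gamma>_def
  proof (intro sum_mono)
    fix S assume S: "S \<in> Pow (K - {d})"
    let ?A = "{t \<in> ?T. differ s t = S}"
    let ?B = "PiE K (\<lambda>k. if k \<in> S then {..<L k} - {fst s k} else {fst s k})"
    have sub: "?A \<subseteq> ?B \<times> {..<M}"
      by (auto simp: states_iff indices_def differ_def PiE_iff extensional_def)
    have fB: "finite ?B" by (intro finite_PiE) auto
    have "card ?A \<le> card (?B \<times> {..<M})" using sub fB by (intro card_mono) auto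
    also have "\<dots> = (\<Prod>k\<in>K. if k \<in> S then L k - 1 else 1) * M"
      using assms by (auto simp: card_cartesian_product card_PiE states_iff indices_def PiE_iff intro!: prod.cong)
    also have "(\<Prod>k\<in>K. if k \<in> S then L k - 1 else 1) = (\<Prod>k\<in>S. L k - 1)"
      using S by (subst prod.inter_restrict[symmetric]) (auto intro!: prod.cong)
    finally have "of_nat (card ?A) \<le> (of_nat ((\<Prod>k\<in>S. L k - 1) * M) :: ennreal)"
      by (rule of_nat_mono)
    then have "of_nat (card ?A) * \<gamma> d S \<le> ((\<Prod>k\<in>S. of_nat (L k - 1)) * of_nat M) * \<gamma> d S"
      by (intro mult_right_mono) (auto simp: of_nat_prod)
    then show "(\<Sum>t\<in>?A. \<gamma> d (differ s t)) \<le> (\<Prod>k\<in>S. of_nat (L k - 1)) * of_nat M * \<gamma> d S"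
      by simp
  qed
  finally show ?thesis by (simp add: add_left_mono)
qed

text \<open>Forgetting that paths start in \<open>zero_idx\<close> enlarges the range to a product
  set, where the sum of products is a product of sums. The subtracted 1 is the term of the true
  path.\<close>

lemma sum_wrong_le:
  assumes "s \<in> paths" "d \<in> D"
  shows "(\<Sum>t\<in>wrong d s. \<Prod>j<b. if t j = s j then 1 else \<gamma> d (differ (s j) (t j))) \<le> (1 + \<Gamma> d) ^ b - 1"
proof -
  let ?g = "\<lambda>j x. if x = s j then 1 else \<gamma> d (differ (s j) x)"
  let ?P = "PiE {..<b} (\<lambda>j. {x \<in> states. fst x d = fst (s j) d})"
  have s: "s \<in> ?P" using assms by (auto simp: paths_def PiE_iff)
  have fP: "finite ?P" by (intro finite_PiE) auto
  have "wrong d s \<subseteq> ?P - {s}" by (auto simp: wrong_def paths_def PiE_iff extensional_def)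
  then have "(\<Sum>t\<in>wrong d s. \<Prod>j<b. ?g j (t j)) + 1 \<le> (\<Sum>t\<in>?P - {s}. \<Prod>j<b. ?g j (t j)) + 1"
    using fP by (intro add_right_mono sum_mono2) auto
  also have "\<dots> = (\<Sum>t\<in>?P. \<Prod>j<b. ?g j (t j))"
    using s fP by (subst sum.remove[of ?P s]) (auto simp: add.commute)
  also have "\<dots> = (\<Prod>j<b. \<Sum>x\<in>{x \<in> states. fst x d = fst (s j) d}. ?g j x)"
    by (intro prod_sum_PiE[symmetric]) auto
  also have "\<dots> \<le> (\<Prod>j<b. 1 + \<Gamma> d)"
    using assms by (intro prod_mono_ennreal sum_states_le) (auto dest: pathsD)
  finally have "(\<Sum>t\<in>wrong d s. \<Prod>j<b. ?g j (t j)) + 1 - 1 \<le> (1 + \<Gamma> d) ^ b - 1"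
    by (intro ennreal_minus_mono) simp_all
  then show ?thesis by simp
qed

text \<open>All three kinds of error carry the factor \<open>\<tau> ^ b\<close>, the probability
  that the path is typical. The expected number of typical paths carries it as well, so it cancels
  in \<open>exists_codebook\<close>, however small it is.\<close>

theorem expected_err:
  assumes "s \<in> paths"
  shows "(\<integral>\<^sup>+C. Ig C s * err C s \<partial>books) \<le> \<tau> ^ b * err_bound"
proof -
  let ?e1 = "\<lambda>C. \<Sum>j<b. emeasure (W (br C s j)) {y. \<not> accepts (br C s j) y}"
  let ?e2 = "\<lambda>C. \<Sum>j<b. \<Sum>k\<in>K. \<Sum>m\<in>{..<L k} - {nxt s j k}. emeasure (W (br C s j)) {y. misled C s j k m y}"
  let ?e3 = "\<lambda>C. \<Sum>d\<in>D. \<Sum>t\<in>wrong d s. \<Prod>j<b. emeasure (W (br C s j)) {y. TD d (br C t j) y}"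
  have "(\<integral>\<^sup>+C. Ig C s * ?e1 C \<partial>books) \<le> (\<integral>\<^sup>+C. Ig C s * (of_nat b * \<epsilon>) \<partial>books)"
  proof (intro nn_integral_mono)
    fix C
    have "?e1 C \<le> (\<Sum>j<b. \<epsilon>)" if "good C s"
      using that by (intro sum_mono T0) (auto simp: good_def)
    then show "Ig C s * ?e1 C \<le> Ig C s * (of_nat b * \<epsilon>)" by (auto simp: Ig_eq)
  qed
  also have "\<dots> = \<tau> ^ b * (of_nat b * \<epsilon>)"
    using assms by (simp add: nn_integral_multc integral_Ig)
  finally have 1: "(\<integral>\<^sup>+C. Ig C s * ?e1 C \<partial>books) \<le> \<tau> ^ b * (of_nat b * \<epsilon>)" .
  have "(\<integral>\<^sup>+C. Ig C s * ?e2 C \<partial>books) = (\<Sum>j<b. \<Sum>k\<in>K. \<Sum>m\<in>{..<L k} - {nxt s j k}.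
      (\<integral>\<^sup>+C. Ig C s * emeasure (W (br C s j)) {y. misled C s j k m y} \<partial>books))"
    by (simp add: sum_distrib_left nn_integral_sum)
  also have "\<dots> \<le> (\<Sum>j<b. \<Sum>k\<in>K. \<Sum>m\<in>{..<L k} - {nxt s j k}. \<tau> ^ b * \<beta> k)"
    using assms by (intro sum_mono integral_relay) auto
  also have "\<dots> = (\<Sum>j<b. \<Sum>k\<in>K. of_nat (L k - 1) * (\<tau> ^ b * \<beta> k))"
  proof (intro sum.cong refl)
    fix j k assume "k \<in> K"
    then have "nxt s j k \<in> {..<L k}" using pathsD(2)[OF assms, of j] by (auto simp: indices_def)
    then show "(\<Sum>m\<in>{..<L k} - {nxt s j k}. \<tau> ^ b * \<beta> k) = of_nat (L k - 1) * (\<tau> ^ b * \<beta> k)" by simp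
  qed
  also have "\<dots> = \<tau> ^ b * (of_nat b * (\<Sum>k\<in>K. of_nat (L k - 1) * \<beta> k))"
    by (simp add: sum_distrib_left ac_simps)
  finally have 2: "(\<integral>\<^sup>+C. Ig C s * ?e2 C \<partial>books) \<le> \<tau> ^ b * (of_nat b * (\<Sum>k\<in>K. of_nat (L k - 1) * \<beta> k))" .
  have "(\<integral>\<^sup>+C. Ig C s * ?e3 C \<partial>books) = (\<Sum>d\<in>D. \<Sum>t\<in>wrong d s.
      (\<integral>\<^sup>+C. Ig C s * (\<Prod>j<b. emeasure (W (br C s j)) {y. TD d (br C t j) y}) \<partial>books))"
    by (simp add: sum_distrib_left nn_integral_sum)
  also have "\<dots> \<le> (\<Sum>d\<in>D. \<Sum>t\<in>wrong d s. \<tau> ^ b * (\<Prod>j<b. if t j = s j then 1 else \<gamma> d (differ (s j) (t j))))"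
    using assms by (intro sum_mono integral_dest) (auto simp: wrong_def)
  also have "\<dots> \<le> (\<Sum>d\<in>D. \<tau> ^ b * ((1 + \<Gamma> d) ^ b - 1))"
    unfolding sum_distrib_left[symmetric] using assms
    by (intro mult_left_mono sum_mono sum_wrong_le) auto
  also have "\<dots> = \<tau> ^ b * (\<Sum>d\<in>D. (1 + \<Gamma> d) ^ b - 1)" by (simp add: sum_distrib_left)
  finally have 3: "(\<integral>\<^sup>+C. Ig C s * ?e3 C \<partial>books) \<le> \<tau> ^ b * (\<Sum>d\<in>D. (1 + \<Gamma> d) ^ b - 1)" .
  have "(\<integral>\<^sup>+C. Ig C s * err C s \<partial>books) = (\<integral>\<^sup>+C. Ig C s * ?e1 C \<partial>books) + (\<integral>\<^sup>+C. Ig C s * ?e2 C \<partial>books)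
      + (\<integral>\<^sup>+C. Ig C s * ?e3 C \<partial>books)"
    by (simp add: err_def distrib_left nn_integral_add)
  also have "\<dots> \<le> \<tau> ^ b * err_bound"
    unfolding err_bound_def distrib_left by (intro add_mono 1 2 3)
  finally show ?thesis .
qed

end

section \<open>Counting paths and extracting a codebook\<close>

context random_scheme
begin

text \<open>The source index is free in all blocks, the index vector in all but the first.\<close>

lemma card_paths: "card paths = (\<Prod>k\<in>K. L k) ^ (b - 1) * M ^ b"
proof -
  have "paths = PiE {..<b} (\<lambda>j. if j = 0 then {zero_idx} \<times> {..<M} else states)" (is "_ = PiE _ ?A")
  proof (intro set_eqI iffI)
    fix s assume "s \<in> paths"
    then show "s \<in> PiE {..<b} ?A"
      using pathsD(1)[of s 0] b_pos by (cases "s 0") (auto simp: paths_def PiE_iff states_iff)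
  next
    fix s assume s: "s \<in> PiE {..<b} ?A"
    have "s 0 \<in> ?A 0" using s b_pos by (intro PiE_mem[of s "{..<b}" ?A]) auto
    then have "s 0 \<in> {zero_idx} \<times> {..<M}" by simp
    moreover have "s i \<in> states" if "i < b" for i
    proof -
      have "s i \<in> ?A i" using s that by (intro PiE_mem[of s "{..<b}" ?A]) auto
      then show ?thesis using zero_idx by (auto simp: states_iff split: if_splits)
    qed
    ultimately show "s \<in> paths"
      using s by (auto simp: paths_def PiE_iff)
  qed
  then have "card paths = (\<Prod>j<b. card (?A j))" by (simp add: card_PiE)
  also have "\<dots> = M * (\<Prod>j\<in>{..<b} - {0}. card (?A j))"
    using b_pos by (subst prod.remove[of _ 0]) (auto simp: card_cartesian_product)
  also have "(\<Prod>j\<in>{..<b} - {0}. card (?A j)) = (\<Prod>j\<in>{..<b} - {0}. (\<Prod>k\<in>K. L k) * M)"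
    by (intro prod.cong) (auto simp: states_def card_cartesian_product card_PiE)
  also have "\<dots> = ((\<Prod>k\<in>K. L k) * M) ^ (b - 1)" using b_pos by simp
  finally show ?thesis using b_pos
    by (cases b) (auto simp: power_mult_distrib)
qed

text \<open>The number \<open>?G\<close> of typical paths has mean \<open>a\<close>, their total
  error \<open>?E\<close> has mean at most \<open>a * \<delta>\<close>. If no codebook had both
  \<open>?G\<close> at least \<open>a / 2\<close> and \<open>?E\<close> at most
  \<open>3 * \<delta> * ?G\<close>, then \<open>3 * \<delta> * ?G\<close> would be at most
  \<open>?E + 3 / 2 * \<delta> * a\<close> everywhere, and taking means would give 3 at most
  5/2.\<close>

theorem exists_codebook:
  assumes \<delta>: "err_bound \<le> ennreal \<delta>" "0 < \<delta>" and \<tau>0: "0 < \<tau>" and M: "0 < M"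
  obtains C P where "C \<in> set_pmf books" "P \<subseteq> paths" "\<And>s. s \<in> P \<Longrightarrow> err C s \<le> ennreal (6 * \<delta>)"
    "real (card paths) * enn2real \<tau> ^ b / 4 \<le> real (card P)"
proof -
  define t where "t = enn2real \<tau>"
  have "\<tau> \<le> 1" unfolding \<tau>_def by (rule measure_pmf.emeasure_le_1)
  then have "\<tau> < top" by (rule le_less_trans) simp
  then have \<tau>: "\<tau> = ennreal t" and t: "0 < t"
    using \<tau>0 by (simp_all add: t_def enn2real_positive_iff)
  define a where "a = real (card paths) * t ^ b"
  have cp: "card paths > 0" using M L_pos by (simp add: card_paths prod_pos)
  then have a: "a > 0" using t by (simp add: a_def)
  let ?G = "\<lambda>C. \<Sum>s\<in>paths. Ig C s" and ?E = "\<lambda>C. \<Sum>s\<in>paths. Ig C s * err C s"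
  have iG: "(\<integral>\<^sup>+C. ?G C \<partial>books) = ennreal a"
    by (simp add: nn_integral_sum integral_Ig \<tau> a_def ennreal_power ennreal_mult'[symmetric] t less_imp_le ennreal_of_nat_eq_real_of_nat)
  have "(\<integral>\<^sup>+C. ?E C \<partial>books) = (\<Sum>s\<in>paths. \<integral>\<^sup>+C. Ig C s * err C s \<partial>books)"
    by (rule nn_integral_sum) simp
  also have "\<dots> \<le> (\<Sum>s\<in>paths. \<tau> ^ b * err_bound)"
    by (intro sum_mono expected_err)
  also have "\<dots> \<le> (\<Sum>s\<in>paths. \<tau> ^ b * ennreal \<delta>)"
    by (intro sum_mono mult_left_mono \<delta>) auto
  also have "\<dots> = ennreal (a * \<delta>)"
    using t \<delta> by (simp add: \<tau> a_def ennreal_power ennreal_mult'[symmetric] less_imp_le ennreal_of_nat_eq_real_of_nat)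
  finally have iE: "(\<integral>\<^sup>+C. ?E C \<partial>books) \<le> ennreal (a * \<delta>)" .
  have "\<exists>C\<in>set_pmf books. ennreal (a / 2) \<le> ?G C \<and> ?E C \<le> ennreal (3 * \<delta>) * ?G C"
  proof (rule ccontr)
    assume neg: "\<not> ?thesis"
    have "(\<integral>\<^sup>+C. ennreal (3 * \<delta>) * ?G C \<partial>books) \<le> (\<integral>\<^sup>+C. ?E C + ennreal (3 / 2 * \<delta> * a) \<partial>books)"
    proof (intro nn_integral_mono_AE AE_pmfI)
      fix C assume "C \<in> set_pmf books"
      with neg have "\<not> (ennreal (a / 2) \<le> ?G C \<and> ?E C \<le> ennreal (3 * \<delta>) * ?G C)" by blast
      then consider "?G C < ennreal (a / 2)" | "ennreal (3 * \<delta>) * ?G C < ?E C"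
        unfolding de_Morgan_conj not_le by (rule disjE)
      then show "ennreal (3 * \<delta>) * ?G C \<le> ?E C + ennreal (3 / 2 * \<delta> * a)"
      proof cases
        case 1
        then have "ennreal (3 * \<delta>) * ?G C \<le> ennreal (3 * \<delta>) * ennreal (a / 2)"
          by (intro mult_left_mono) auto
        also have "\<dots> = ennreal (3 / 2 * \<delta> * a)"
          using a \<delta> by (simp add: ennreal_mult'[symmetric])
        finally show ?thesis by (rule add_increasing[OF zero_le])
      next
        case 2
        then show ?thesis by (intro add_increasing2[OF zero_le] less_imp_le)
      qed
    qed
    also have "\<dots> \<le> ennreal (a * \<delta>) + ennreal (3 / 2 * \<delta> * a)"
      using iE by (subst nn_integral_add) (auto intro: add_right_mono)
    also have "\<dots> = ennreal (a * \<delta> + 3 / 2 * \<delta> * a)"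
      using a \<delta> by (intro ennreal_plus[symmetric]) auto
    also have "(\<integral>\<^sup>+C. ennreal (3 * \<delta>) * ?G C \<partial>books) = ennreal (3 * \<delta> * a)"
      using a \<delta> by (simp add: nn_integral_cmult iG ennreal_mult'[symmetric])
    finally have "ennreal (3 * \<delta> * a) \<le> ennreal (a * \<delta> + 3 / 2 * \<delta> * a)" .
    then have "3 * \<delta> * a \<le> a * \<delta> + 3 / 2 * \<delta> * a"
      using a \<delta> by (subst (asm) ennreal_le_iff) auto
    then have "\<delta> * a \<le> 0" by (simp add: algebra_simps)
    then show False using a \<delta> by (simp add: mult_le_0_iff)
  qed
  then obtain C where C: "C \<in> set_pmf books" "ennreal (a / 2) \<le> ?G C" "?E C \<le> ennreal (3 * \<delta>) * ?G C" by auto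
  let ?good = "{s \<in> paths. good C s}"
  \<comment> \<open>Since the average error of the good paths is at most
    \<open>3 * \<delta>\<close>, at most half of them exceed twice that value. With the earlier
    factor 1/2 this gives the 1/4 in the conclusion.\<close>
  define P where "P = {s \<in> ?good. err C s \<le> ennreal (6 * \<delta>)}"
  have G: "?G C = of_nat (card ?good)"
    by (simp add: Ig_eq sum.If_cases Collect_conj_eq Int_commute)
  have "(\<Sum>s\<in>?good - P. ennreal (6 * \<delta>)) \<le> (\<Sum>s\<in>?good - P. Ig C s * err C s)"
    by (intro sum_mono) (auto simp: P_def Ig_eq)
  also have "\<dots> \<le> ?E C" by (intro sum_mono2) auto
  also note C(3)
  finally have "of_nat (card (?good - P)) * ennreal (6 * \<delta>) \<le> ennreal (3 * \<delta>) * of_nat (card ?good)"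
    by (simp add: G)
  then have "real (card (?good - P)) * (6 * \<delta>) \<le> 3 * \<delta> * real (card ?good)"
    using \<delta> by (simp add: ennreal_of_nat_eq_real_of_nat ennreal_mult'[symmetric])
  then have "real (card (?good - P)) * 2 \<le> real (card ?good)"
    using \<delta> by simp
  moreover have "card (?good - P) = card ?good - card P" "card P \<le> card ?good"
    by (auto simp: P_def intro!: card_Diff_subset card_mono)
  ultimately have "real (card ?good) / 2 \<le> real (card P)" by (simp add: of_nat_diff)
  moreover have "a / 2 \<le> real (card ?good)"
    using C(2) a by (simp add: G ennreal_of_nat_eq_real_of_nat)
  ultimately have "a / 4 \<le> real (card P)" by simp
  then show ?thesis
    by (intro that[of C P]) (use C in \<open>auto simp: P_def a_def t_def\<close>)
qed

text \<open>A code must send letters of the alphabets after every output sequence, however unlikely;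
  so each codeword has to lie in the support of its generating law.\<close>

lemma books_support:
  assumes "C \<in> set_pmf books" "j < b"
  shows "k \<in> K \<Longrightarrow> l < L k \<Longrightarrow> fst (fst (C j) k l) \<in> set_pmf (\<kappa> k)"
    and "s \<in> states \<Longrightarrow> \<exists>xs. snd (C j) s \<in> set_pmf (\<nu> xs)"
proof -
  have "C j \<in> set_pmf book"
    using assms by (auto simp: books_def set_Pi_pmf PiE_dflt_def)
  then have r: "fst (C j) \<in> set_pmf (Pi_pmf K undefined relay_book)"
    and v: "snd (C j) \<in> set_pmf (source_book (fst (C j)))"
    by (auto simp: book_def)
  show "fst (fst (C j) k l) \<in> set_pmf (\<kappa> k)" if "k \<in> K" "l < L k"
  proof -
    have "fst (C j) k \<in> set_pmf (relay_book k)"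
      using r that by (auto simp: set_Pi_pmf PiE_dflt_def)
    then have "fst (C j) k l \<in> set_pmf (bind_pmf (\<kappa> k) (\<lambda>x. map_pmf (Pair x) (Pi_pmf {..<L k} undefined (\<lambda>_. \<mu> k x))))"
      unfolding relay_book_def using that by (subst (asm) set_Pi_pmf) (auto simp: PiE_dflt_def)
    then show ?thesis by auto
  qed
  show "\<exists>xs. snd (C j) s \<in> set_pmf (\<nu> xs)" if "s \<in> states"
    using v that by (cases s) (auto simp: source_book_def set_Pi_pmf PiE_dflt_def)
qed

end

subsection \<open>Block transmission over a memoryless network\<close>

text \<open>Isolates the recursion of \<open>outputs\<close>, so that the process with feedback can
  be compared with one whose inputs are fixed in advance.\<close>

primrec process :: "(nat \<Rightarrow> 'a list \<Rightarrow> 'a pmf) \<Rightarrow> nat \<Rightarrow> 'a list pmf" where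
  "process f 0 = return_pmf []"
| "process f (Suc i) = bind_pmf (process f i) (\<lambda>h. map_pmf (\<lambda>y. h @ [y]) (f i h))"

lemma outputs_eq_process: "outputs G c m i = process (\<lambda>i h. chan G (inputs G c m (Suc i) h)) i"
  by (induction i) auto

lemma length_process: "h \<in> set_pmf (process f i) \<Longrightarrow> length h = i"
  by (induction i arbitrary: h) auto

lemma pmf_process_snoc: "pmf (process f (Suc i)) (h @ [y]) = pmf (process f i) h * pmf (f i h) y"
proof -
  have "pmf (process f (Suc i)) (h @ [y])
      = measure_pmf.expectation (process f i) (\<lambda>g. pmf (map_pmf (\<lambda>y. g @ [y]) (f i g)) (h @ [y]))"
    by (simp add: pmf_bind)
  also have "\<dots> = measure_pmf.expectation (process f i) (\<lambda>g. pmf (f i h) y * indicator {h} g)"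
  proof (intro arg_cong[where f = "measure_pmf.expectation (process f i)"] ext)
    fix g show "pmf (map_pmf (\<lambda>y. g @ [y]) (f i g)) (h @ [y]) = pmf (f i h) y * indicator {h} g"
    proof (cases "g = h")
      case True
      have "inj (\<lambda>y. h @ [y])" by (auto intro: injI)
      from pmf_map_inj'[OF this, of "f i h" y] show ?thesis using True by simp
    next
      case False
      then show ?thesis by (auto intro!: pmf_map_outside)
    qed
  qed
  also have "\<dots> = pmf (process f i) h * pmf (f i h) y"
    by (simp add: measure_pmf_single)
  finally show ?thesis .
qed

text \<open>The probability of a history is a product of factors that consult the kernel along its
  own prefixes only; two processes agree at \<open>h\<close> once their kernels agree there,
  whatever they do elsewhere.\<close>

lemma pmf_process_eqI:
  assumes "\<And>i. i < n \<Longrightarrow> f i (take i h) = g i (take i h)"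
  shows "pmf (process f n) h = pmf (process g n) h"
proof -
  have "pmf (process f i) (take i h) = pmf (process g i) (take i h)" if "i \<le> n" "i \<le> length h" for i
    using that
  proof (induction i)
    case (Suc i)
    then have "take (Suc i) h = take i h @ [h ! i]" by (simp add: take_Suc_conv_app_nth)
    then show ?case
      using Suc assms[of i] by (simp add: pmf_process_snoc del: process.simps)
  qed simp
  from this[of n] show ?thesis
  proof (cases "length h = n")
    case False
    then have "h \<notin> set_pmf (process f n)" "h \<notin> set_pmf (process g n)"
      using length_process by blast+
    then show ?thesis by (simp add: set_pmf_iff)
  qed auto
qed

lemma process_memoryless:
  "map_pmf (\<lambda>h i. if i < n then h ! i else undefined) (process (\<lambda>i _. p i) n) = Pi_pmf {..<n} undefined p"
proof (induction n)
  case (Suc n)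
  let ?f = "\<lambda>n h i. if i < n then h ! i else undefined"
  have "map_pmf (?f (Suc n)) (process (\<lambda>i _. p i) (Suc n))
      = bind_pmf (process (\<lambda>i _. p i) n) (\<lambda>h. map_pmf (\<lambda>y. (?f n h)(n := y)) (p n))"
    unfolding process.simps map_bind_pmf pmf.map_comp o_def
  proof (intro bind_pmf_cong refl map_pmf_cong)
    fix h y assume "h \<in> set_pmf (process (\<lambda>i _. p i) n)"
    then have "length h = n" by (rule length_process)
    then show "?f (Suc n) (h @ [y]) = (?f n h)(n := y)" by (auto simp: nth_append)
  qed
  also have "\<dots> = bind_pmf (map_pmf (?f n) (process (\<lambda>i _. p i) n)) (\<lambda>h. map_pmf (\<lambda>y. h(n := y)) (p n))"
    by (simp add: bind_map_pmf)
  also have "\<dots> = Pi_pmf {..<Suc n} undefined p"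
    unfolding Suc.IH lessThan_Suc
    by (subst Pi_pmf_insert') (auto simp: map_pmf_def intro: bind_commute_pmf)
  finally show ?case .
qed (auto simp: fun_eq_iff)

lemma Pi_pmf_shift:
  "map_pmf (\<lambda>y t. if t < n then y (a + t) else undefined) (Pi_pmf {a..<a + n} undefined p)
     = Pi_pmf {..<n} undefined (\<lambda>t. p (a + t :: nat))"
proof (induction n)
  case (Suc n)
  have S: "{a..<a + Suc n} = insert (a + n) {a..<a + n}" by auto
  let ?f = "\<lambda>n y t. if t < n then y (a + t) else undefined"
  have "map_pmf (?f (Suc n)) (Pi_pmf {a..<a + Suc n} undefined p)
      = bind_pmf (p (a + n)) (\<lambda>x. map_pmf (\<lambda>y. (?f n y)(n := x)) (Pi_pmf {a..<a + n} undefined p))"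
    unfolding S
    by (subst Pi_pmf_insert')
       (auto simp: map_bind_pmf map_pmf_def[symmetric] pmf.map_comp o_def fun_eq_iff intro!: bind_pmf_cong map_pmf_cong)
  also have "\<dots> = bind_pmf (p (a + n)) (\<lambda>x. map_pmf (\<lambda>y. y(n := x)) (map_pmf (?f n) (Pi_pmf {a..<a + n} undefined p)))"
    by (simp add: pmf.map_comp o_def)
  also have "\<dots> = Pi_pmf {..<Suc n} undefined (\<lambda>t. p (a + t))"
    unfolding Suc.IH lessThan_Suc by (subst Pi_pmf_insert') (auto simp: map_pmf_def)
  finally show ?case .
qed auto

lemma nn_integral_Pi_pmf_blocks:
  fixes b n :: nat
  shows "(\<integral>\<^sup>+y. (\<Prod>j<b. f j (\<lambda>t. if t < n then y (j * n + t) else undefined)) \<partial>Pi_pmf {..<b * n} undefined p)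
     = (\<Prod>j<b. \<integral>\<^sup>+y. f j y \<partial>Pi_pmf {..<n} undefined (\<lambda>t. p (j * n + t)))"
proof (induction b)
  case (Suc b)
  let ?g = "\<lambda>j y. f j (\<lambda>t. if t < n then y (j * n + t) else undefined)"
  have S: "{..<Suc b * n} = {..<b * n} \<union> {b * n..<b * n + n}" by auto
  have lt: "j * n + t < b * n" if "j < b" "t < n" for j t
  proof -
    have "Suc j * n \<le> b * n" using that by (intro mult_le_mono1) auto
    then show ?thesis using that by simp
  qed
  have "(\<integral>\<^sup>+y. (\<Prod>j<Suc b. ?g j y) \<partial>Pi_pmf {..<Suc b * n} undefined p)
     = (\<integral>\<^sup>+y. \<integral>\<^sup>+z. (\<Prod>j<b. ?g j y) * ?g b z
          \<partial>Pi_pmf {b * n..<b * n + n} undefined p \<partial>Pi_pmf {..<b * n} undefined p)"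
    unfolding S
    by (subst Pi_pmf_union)
       (auto simp: nn_integral_pair_pmf' lt cong: if_cong intro!: nn_integral_cong arg_cong2[where f = "(*)"] prod.cong arg_cong[where f = "f _"] ext)
  also have "\<dots> = (\<integral>\<^sup>+y. (\<Prod>j<b. ?g j y) \<partial>Pi_pmf {..<b * n} undefined p)
       * (\<integral>\<^sup>+z. ?g b z \<partial>Pi_pmf {b * n..<b * n + n} undefined p)"
    by (simp add: nn_integral_cmult nn_integral_multc)
  also have "(\<integral>\<^sup>+z. ?g b z \<partial>Pi_pmf {b * n..<b * n + n} undefined p)
      = (\<integral>\<^sup>+y. f b y \<partial>Pi_pmf {..<n} undefined (\<lambda>t. p (b * n + t)))"
    by (subst Pi_pmf_shift[symmetric]) simp
  finally show ?case by (simp add: Suc.IH)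
qed auto

definition block :: "nat \<Rightarrow> 'a list \<Rightarrow> nat \<Rightarrow> nat \<Rightarrow> 'a" where
  "block n h j = (\<lambda>t. if t < n then h ! (j * n + t) else undefined)"

text \<open>Letters after the last block are integrated out. They occur because codes of every
  length are required, not just of multiples of \<open>b\<close>.\<close>

lemma process_blocks:
  assumes "b * n \<le> l"
  shows "(\<integral>\<^sup>+h. (\<Prod>j<b. f j (block n h j)) \<partial>process (\<lambda>i _. p i) l)
     = (\<Prod>j<b. \<integral>\<^sup>+y. f j y \<partial>Pi_pmf {..<n} undefined (\<lambda>t. p (j * n + t)))"
proof -
  have lt: "j * n + t < b * n" if "j < b" "t < n" for j t
  proof -
    have "Suc j * n \<le> b * n" using that by (intro mult_le_mono1) auto
    then show ?thesis using that by simp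
  qed
  have lt': "j * n + t < l" if "j < b" "t < n" for j t
    using lt[OF that] assms by simp
  let ?g = "\<lambda>y. \<Prod>j<b. f j (\<lambda>t. if t < n then y (j * n + t) else undefined)"
  have "(\<integral>\<^sup>+h. (\<Prod>j<b. f j (block n h j)) \<partial>process (\<lambda>i _. p i) l)
     = (\<integral>\<^sup>+y. ?g y \<partial>map_pmf (\<lambda>h i. if i < l then h ! i else undefined) (process (\<lambda>i _. p i) l))"
    by (auto simp: block_def lt' intro!: nn_integral_cong prod.cong arg_cong[where f = "f _"])
  also have "\<dots> = (\<integral>\<^sup>+y. ?g y \<partial>map_pmf (\<lambda>f x. if x \<in> {..<b * n} then f x else undefined) (Pi_pmf {..<l} undefined p))"
    unfolding process_memoryless by (auto simp: lt intro!: nn_integral_cong prod.cong arg_cong[where f = "f _"])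
  also have "\<dots> = (\<integral>\<^sup>+y. ?g y \<partial>Pi_pmf {..<b * n} undefined p)"
    using assms by (subst Pi_pmf_subset[symmetric]) auto
  also have "\<dots> = (\<Prod>j<b. \<integral>\<^sup>+y. f j y \<partial>Pi_pmf {..<n} undefined (\<lambda>t. p (j * n + t)))"
    by (rule nn_integral_Pi_pmf_blocks)
  finally show ?thesis .
qed

lemma emeasure_process_blocks:
  assumes "b * n \<le> l"
  shows "emeasure (process (\<lambda>i _. p i) l) {h. \<forall>j<b. Q j (block n h j)}
     = (\<Prod>j<b. emeasure (Pi_pmf {..<n} undefined (\<lambda>t. p (j * n + t))) {y. Q j y})"
proof -
  have "emeasure (process (\<lambda>i _. p i) l) {h. \<forall>j<b. Q j (block n h j)}
     = (\<integral>\<^sup>+h. indicator {h. \<forall>j<b. Q j (block n h j)} h \<partial>process (\<lambda>i _. p i) l)" by simp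
  also have "\<dots> = (\<integral>\<^sup>+h. (\<Prod>j<b. indicator {y. Q j y} (block n h j)) \<partial>process (\<lambda>i _. p i) l)"
    by (intro nn_integral_cong) (auto simp: indicator_def)
  also have "\<dots> = (\<Prod>j<b. emeasure (Pi_pmf {..<n} undefined (\<lambda>t. p (j * n + t))) {y. Q j y})"
    by (subst process_blocks[OF assms]) simp
  finally show ?thesis .
qed

lemma emeasure_process_block:
  assumes "b * n \<le> l" "j < b"
  shows "emeasure (process (\<lambda>i _. p i) l) {h. Q (block n h j)}
     = emeasure (Pi_pmf {..<n} undefined (\<lambda>t. p (j * n + t))) {y. Q y}"
proof -
  have "emeasure (process (\<lambda>i _. p i) l) {h. Q (block n h j)}
     = emeasure (process (\<lambda>i _. p i) l) {h. \<forall>i<b. i = j \<longrightarrow> Q (block n h i)}"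
    using assms(2) by (intro arg_cong[where f = "emeasure _"]) auto
  also have "\<dots> = (\<Prod>i<b. emeasure (Pi_pmf {..<n} undefined (\<lambda>t. p (i * n + t))) {y. i = j \<longrightarrow> Q y})"
    by (rule emeasure_process_blocks[OF assms(1)])
  also have "\<dots> = (\<Prod>i<b. if i = j then emeasure (Pi_pmf {..<n} undefined (\<lambda>t. p (i * n + t))) {y. Q y} else 1)"
    by (intro prod.cong) auto
  finally show ?thesis using assms(2) by simp
qed

lemma emeasure_pmf_cong_on:
  assumes "\<And>h. h \<in> A \<Longrightarrow> pmf p h = pmf q h"
  shows "emeasure (measure_pmf p) A = emeasure (measure_pmf q) A"
  unfolding nn_integral_pmf[symmetric] using assms
  by (intro nn_integral_cong) auto

section \<open>Encoders, decoders and the comparison with predetermined inputs\<close>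

locale network_scheme =
  random_scheme K L M \<kappa> \<mu> \<nu> b D T0 W TR TD \<epsilon> \<beta> \<gamma>
  for K :: "nat set" and L :: "nat \<Rightarrow> nat" and M :: nat
    and \<kappa> :: "nat \<Rightarrow> (nat \<Rightarrow> 'a) pmf" and \<mu> :: "nat \<Rightarrow> (nat \<Rightarrow> 'a) \<Rightarrow> 'u pmf"
    and \<nu> :: "(nat \<Rightarrow> nat \<Rightarrow> 'a) \<Rightarrow> 'v pmf"
    and b :: nat and D :: "nat set" and T0 :: "('v \<times> (nat \<Rightarrow> (nat \<Rightarrow> 'a) \<times> 'u)) set"
    and W :: "'v \<times> (nat \<Rightarrow> (nat \<Rightarrow> 'a) \<times> 'u) \<Rightarrow> (nat \<Rightarrow> nat \<Rightarrow> 'y) pmf"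
    and TR :: "nat \<Rightarrow> (nat \<Rightarrow> 'a) \<times> 'u \<Rightarrow> (nat \<Rightarrow> nat \<Rightarrow> 'y) \<Rightarrow> bool"
    and TD :: "nat \<Rightarrow> 'v \<times> (nat \<Rightarrow> (nat \<Rightarrow> 'a) \<times> 'u) \<Rightarrow> (nat \<Rightarrow> nat \<Rightarrow> 'y) \<Rightarrow> bool"
    and \<epsilon> \<beta> \<gamma> +
  fixes G :: "('a, 'y) network" and n :: nat and sx :: "'v \<Rightarrow> nat \<Rightarrow> 'a"
  assumes network: "dm_network G" and K_eq: "K = {2..nodes G}" and n_pos: "0 < n"
    and W_eq: "W z = Pi_pmf {..<n} undefined
      (\<lambda>t. chan G (\<lambda>k\<in>{1..nodes G}. if k = 1 then sx (fst z) t else fst (snd z k) t))"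
    and TR_local: "\<And>k w y y'. k \<in> K \<Longrightarrow> (\<And>t. t < n \<Longrightarrow> y t k = y' t k) \<Longrightarrow> TR k w y = TR k w y'"
    and TD_local: "\<And>d z y y'. d \<in> D \<Longrightarrow> (\<And>t. t < n \<Longrightarrow> y t d = y' t d) \<Longrightarrow> TD d z y = TD d z y'"
    and relay_inp: "\<And>k x t. k \<in> K \<Longrightarrow> x \<in> set_pmf (\<kappa> k) \<Longrightarrow> t < n \<Longrightarrow> x t \<in> inp G k"
    and source_inp: "\<And>xs v t. v \<in> set_pmf (\<nu> xs) \<Longrightarrow> t < n \<Longrightarrow> sx v t \<in> inp G 1"
begin

text \<open>The tests of node \<open>k\<close> read an output vector at \<open>k\<close> only, so a slice may repeat one node's outputs at all nodes.\<close>
definition slice :: "'y list \<Rightarrow> nat \<Rightarrow> nat \<Rightarrow> nat \<Rightarrow> 'y" where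
  "slice ys j = (\<lambda>t _. ys ! (j * n + t))"

text \<open>Each index is decoded relative to the relay's own previous estimate, so it depends on
  past outputs alone. The default 0 keeps the estimate in range when no index or more than one
  passes.\<close>

primrec relay_index where
  "relay_index C k ys 0 = 0"
| "relay_index C k ys (Suc j) =
     (if \<exists>!m. m < L k \<and> TR k (pick (fst (C j) k) (relay_index C k ys j) m) (slice ys j)
      then THE m. m < L k \<and> TR k (pick (fst (C j) k) (relay_index C k ys j) m) (slice ys j) else 0)"

text \<open>A filler letter for the times after the last block.\<close>

definition idle :: "nat \<Rightarrow> 'a" where "idle k = (SOME x. x \<in> inp G k)"

definition candidate where
  "candidate C msgs \<sigma> d ys m \<longleftrightarrow> m \<in> msgs \<and>
     (\<forall>j<b. fst (\<sigma> m j) d = relay_index C d ys j \<and> TD d (br C (\<sigma> m) j) (slice ys j))"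

definition net_code where
  "net_code C msgs \<sigma> =
     \<lparr>src = (\<lambda>i m ys. if (i - 1) div n < b then sx (snd (C ((i - 1) div n)) (\<sigma> m ((i - 1) div n))) ((i - 1) mod n)
         else idle 1),
      relay = (\<lambda>k i ys. if (i - 1) div n < b
         then fst (fst (C ((i - 1) div n)) k (relay_index C k ys ((i - 1) div n))) ((i - 1) mod n) else idle k),
      dec = (\<lambda>d ys. if \<exists>!m. candidate C msgs \<sigma> d ys m then Some (THE m. candidate C msgs \<sigma> d ys m) else None)\<rparr>"

lemma relay_index_less: "k \<in> K \<Longrightarrow> relay_index C k ys j < L k"
proof (induction j)
  case (Suc j)
  let ?Q = "\<lambda>m. m < L k \<and> TR k (pick (fst (C j) k) (relay_index C k ys j) m) (slice ys j)"
  show ?case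
  proof (cases "\<exists>!m. ?Q m")
    case True
    from theI'[OF this] have "(THE m. ?Q m) < L k" by blast
    with True show ?thesis by simp
  qed (use L_pos Suc in simp)
qed (use L_pos in simp)

text \<open>Causality: the index used in block \<open>j\<close> consults only the outputs of earlier
  blocks.\<close>

lemma relay_index_take:
  assumes "k \<in> K" "j * n \<le> i"
  shows "relay_index C k (take i ys) j = relay_index C k ys j"
  using assms(2)
proof (induction j)
  case (Suc j)
  then have "TR k w (slice (take i ys) j) = TR k w (slice ys j)" for w
    by (intro TR_local assms) (auto simp: slice_def)
  then show ?case using Suc by simp
qed simp

text \<open>The inputs if no relay ever errs. Along good histories they are the actual ones, hence both
  processes give good histories the same probability.\<close>
definition ideal_input where
  "ideal_input C s i = (\<lambda>k\<in>{1..nodes G}. if i div n < b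
     then (if k = 1 then sx (fst (br C s (i div n))) (i mod n) else fst (snd (br C s (i div n)) k) (i mod n))
     else idle k)"

definition good_history where
  "good_history C s h \<longleftrightarrow> (\<forall>j<b.
     (\<forall>k\<in>K. TR k (snd (br C s j) k) (block n h j)) \<and>
     (\<forall>k\<in>K. \<forall>m\<in>{..<L k} - {nxt s j k}. \<not> misled C s j k m (block n h j)) \<and>
     (\<forall>d\<in>D. TD d (br C s j) (block n h j))) \<and>
   (\<forall>d\<in>D. \<forall>t\<in>wrong d s. \<not> (\<forall>j<b. TD d (br C t j) (block n h j)))"

lemma snd_br: "k \<in> K \<Longrightarrow> snd (br C s j) k = pick (fst (C j) k) (fst (s j) k) (nxt s j k)"
  by (simp add: br_def branch_def picks_def)

lemma block_index_less: "j < b \<Longrightarrow> t < n \<Longrightarrow> b * n \<le> l \<Longrightarrow> j * n + t < l"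
proof -
  assume *: "j < b" "t < n" "b * n \<le> l"
  then have "Suc j * n \<le> b * n" by (intro mult_le_mono1) auto
  with * show ?thesis by simp
qed

lemma TR_slice:
  assumes "k \<in> K" "j < b" "b * n \<le> length h"
  shows "TR k w (slice (observed k h) j) = TR k w (block n h j)"
  using assms by (intro TR_local) (auto simp: slice_def observed_def block_def block_index_less)

lemma TD_slice:
  assumes "d \<in> D" "j < b" "b * n \<le> length h"
  shows "TD d z (slice (observed d h) j) = TD d z (block n h j)"
  using assms by (intro TD_local) (auto simp: slice_def observed_def block_def block_index_less)

text \<open>The start agrees because the initial estimate 0 is the value of \<open>zero_idx\<close>.
  In a good history the announced index is then the only one that passes, so the estimates follow
  the path.\<close>

lemma relay_index_good:
  assumes "s \<in> paths" "good_history C s h" "b * n \<le> length h" "k \<in> K" "j < b"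
  shows "relay_index C k (observed k h) j = fst (s j) k"
  using assms(5)
proof (induction j)
  case 0
  then show ?case using assms by (simp add: paths_def zero_idx_def)
next
  case (Suc j)
  then have IH: "relay_index C k (observed k h) j = fst (s j) k" and j: "j < b" by auto
  let ?Q = "\<lambda>m. m < L k \<and> TR k (pick (fst (C j) k) (relay_index C k (observed k h) j) m) (slice (observed k h) j)"
  have nl: "nxt s j k < L k" using pathsD(2)[OF assms(1), of j] assms(4) by (auto simp: indices_def)
  have "?Q m \<longleftrightarrow> m = nxt s j k" for m
    using assms j nl by (auto simp: IH TR_slice good_history_def snd_br)
  then have "(\<exists>!m. ?Q m)" "(THE m. ?Q m) = nxt s j k" by auto
  then have "relay_index C k (observed k h) (Suc j) = nxt s j k" by simp
  then show ?case using Suc by (simp add: nxt_def)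
qed

lemma observed_take: "observed k (take i h) = take i (observed k h)"
  by (simp add: observed_def take_map)

lemma inputs_good:
  assumes "s \<in> paths" "good_history C s h" "b * n \<le> length h" "\<sigma> m = s"
  shows "inputs G (net_code C msgs \<sigma>) m (Suc i) (take i h) = ideal_input C s i"
proof
  fix k
  have kK: "k \<in> K \<longleftrightarrow> 2 \<le> k \<and> k \<le> nodes G" by (auto simp: K_eq)
  show "inputs G (net_code C msgs \<sigma>) m (Suc i) (take i h) k = ideal_input C s i k"
  proof (cases "k \<in> K \<and> i div n < b")
    case True
    have "relay_index C k (observed k (take i h)) (i div n) = fst (s (i div n)) k"
      using True assms by (simp add: observed_take relay_index_take relay_index_good)
    with True kK show ?thesis
      by (auto simp: inputs_def net_code_def ideal_input_def snd_br pick_def)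
  next
    case False
    then show ?thesis using assms(4) kK
      by (auto simp: inputs_def net_code_def ideal_input_def br_def branch_def)
  qed
qed

abbreviation "ideal C s \<equiv> process (\<lambda>i _. chan G (ideal_input C s i))"

lemma ideal_block:
  assumes "j < b"
  shows "Pi_pmf {..<n} undefined (\<lambda>t. chan G (ideal_input C s (j * n + t))) = W (br C s j)"
  unfolding W_eq using assms n_pos by (intro Pi_pmf_cong) (auto simp: ideal_input_def cong: if_cong)

text \<open>With predetermined inputs the output blocks are independent with the laws
  \<open>W\<close>, so the union bound over violations of \<open>good_history\<close> yields the
  three sums of \<open>err\<close>.\<close>

lemma emeasure_ideal_bad:
  assumes "s \<in> paths" "b * n \<le> l"
  shows "emeasure (ideal C s l) {h. \<not> good_history C s h} \<le> err C s"
proof -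
  let ?P = "emeasure (measure_pmf (ideal C s l))"
  let ?A = "\<lambda>j. {h. \<not> accepts (br C s j) (block n h j)}"
  let ?B = "\<lambda>j k m. {h. misled C s j k m (block n h j)}"
  let ?B1 = "\<lambda>j k. \<Union>m\<in>{..<L k} - {nxt s j k}. ?B j k m" and ?B2 = "\<lambda>j. \<Union>k\<in>K. \<Union>m\<in>{..<L k} - {nxt s j k}. ?B j k m"
  let ?S2 = "\<lambda>j. \<Sum>k\<in>K. \<Sum>m\<in>{..<L k} - {nxt s j k}. ?P (?B j k m)"
  let ?C = "\<lambda>d t. {h. \<forall>j<b. TD d (br C t j) (block n h j)}"
  let ?C2 = "\<Union>d\<in>D. \<Union>t\<in>wrong d s. ?C d t"
  have fin: "finite (wrong d s)" for d
    by (rule finite_subset[OF _ finite_paths]) (auto simp: wrong_def)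
  have "{h. \<not> good_history C s h} \<subseteq> (\<Union>j<b. ?A j) \<union> (\<Union>j<b. ?B2 j)
      \<union> ?C2"
    unfolding good_history_def by auto
  then have "?P {h. \<not> good_history C s h} \<le> ?P ((\<Union>j<b. ?A j) \<union> (\<Union>j<b. ?B2 j)
      \<union> ?C2)"
    by (intro emeasure_mono) auto
  also have "\<dots> \<le> ?P (\<Union>j<b. ?A j) + ?P (\<Union>j<b. ?B2 j)
      + ?P ?C2"
    by (rule order_trans[OF emeasure_subadditive add_right_mono[OF emeasure_subadditive]]) auto
  also have "\<dots> \<le> (\<Sum>j<b. ?P (?A j)) + (\<Sum>j<b. ?S2 j)
      + (\<Sum>d\<in>D. \<Sum>t\<in>wrong d s. ?P (?C d t))"
  proof (intro add_mono)
    show "?P (\<Union>j<b. ?A j) \<le> (\<Sum>j<b. ?P (?A j))" by (intro emeasure_subadditive_finite) auto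
    have "?P (?B1 j k) \<le> (\<Sum>m\<in>{..<L k} - {nxt s j k}. ?P (?B j k m))" for j k
      by (intro emeasure_subadditive_finite) auto
    moreover have "?P (?B2 j) \<le> (\<Sum>k\<in>K. ?P (?B1 j k))" for j
      by (intro emeasure_subadditive_finite) auto
    ultimately have 1: "?P (?B2 j)
        \<le> ?S2 j" for j
      by (meson order_trans sum_mono)
    have "?P (\<Union>j<b. ?B2 j)
        \<le> (\<Sum>j<b. ?P (?B2 j))"
      by (intro emeasure_subadditive_finite) auto
    also have "\<dots> \<le> (\<Sum>j<b. ?S2 j)"
      by (intro sum_mono 1)
    finally show "?P (\<Union>j<b. ?B2 j)
        \<le> (\<Sum>j<b. ?S2 j)" .
    have 2: "?P (\<Union>t\<in>wrong d s. ?C d t) \<le> (\<Sum>t\<in>wrong d s. ?P (?C d t))" for d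
      using fin by (intro emeasure_subadditive_finite) auto
    have "?P ?C2 \<le> (\<Sum>d\<in>D. ?P (\<Union>t\<in>wrong d s. ?C d t))"
      by (intro emeasure_subadditive_finite) auto
    also have "\<dots> \<le> (\<Sum>d\<in>D. \<Sum>t\<in>wrong d s. ?P (?C d t))" by (intro sum_mono 2)
    finally show "?P ?C2 \<le> (\<Sum>d\<in>D. \<Sum>t\<in>wrong d s. ?P (?C d t))" .
  qed
  also have "\<dots> = err C s"
    unfolding err_def
  proof (intro arg_cong2[where f = "(+)"] sum.cong refl)
    fix j assume j: "j \<in> {..<b}"
    then have jb: "j < b" by simp
    show "?P (?A j) = emeasure (W (br C s j)) {y. \<not> accepts (br C s j) y}"
      by (subst emeasure_process_block[OF assms(2) jb]) (simp add: ideal_block[OF jb])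
    fix k m
    show "?P (?B j k m) = emeasure (W (br C s j)) {y. misled C s j k m y}"
      by (subst emeasure_process_block[OF assms(2) jb]) (simp add: ideal_block[OF jb])
  next
    fix d t
    show "?P (?C d t) = (\<Prod>j<b. emeasure (W (br C s j)) {y. TD d (br C t j) y})"
      by (subst emeasure_process_blocks[OF assms(2)]) (simp add: ideal_block)
  qed
  finally show ?thesis .
qed

text \<open>Another candidate would show the same indices at \<open>d\<close>, hence its path would
  belong to \<open>wrong d (\<sigma> m)\<close>, and a good history rejects such a path in some
  block.\<close>

lemma decodes_good:
  assumes "inj_on \<sigma> msgs" "\<sigma> ` msgs \<subseteq> paths" "m \<in> msgs" "good_history C (\<sigma> m) h" "b * n \<le> length h" "d \<in> D"
  shows "dec (net_code C msgs \<sigma>) d (observed d h) = Some m"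
proof -
  let ?s = "\<sigma> m"
  have s: "?s \<in> paths" and d: "d \<in> K" using assms D_sub by auto
  have c: "candidate C msgs \<sigma> d (observed d h) m' \<longleftrightarrow> m' = m" for m'
  proof
    assume m': "candidate C msgs \<sigma> d (observed d h) m'"
    show "m' = m"
    proof (rule ccontr)
      assume "m' \<noteq> m"
      then have "\<sigma> m' \<noteq> ?s" "\<sigma> m' \<in> paths"
        using assms m' by (auto simp: candidate_def inj_on_def)
      moreover have "\<forall>j<b. fst (\<sigma> m' j) d = fst (?s j) d"
        using m' relay_index_good[OF s assms(4,5) d] by (simp add: candidate_def)
      ultimately have "\<sigma> m' \<in> wrong d ?s" by (simp add: wrong_def)
      moreover have "\<forall>j<b. TD d (br C (\<sigma> m') j) (block n h j)"
        using m' assms by (simp add: candidate_def TD_slice)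
      ultimately show False using assms(4,6) unfolding good_history_def by blast
    qed
  next
    assume "m' = m"
    then show "candidate C msgs \<sigma> d (observed d h) m'"
      using assms relay_index_good[OF s assms(4,5) d]
      by (auto simp: candidate_def TD_slice good_history_def)
  qed
  then have "candidate C msgs \<sigma> d (observed d h) = (\<lambda>m'. m' = m)" by blast
  then show ?thesis by (simp add: net_code_def)
qed

text \<open>Actual and ideal process agree on every good history, hence on the total probability of
  the complement, although the two laws may differ inside it. The actual error is thus bounded by
  the probability of a bad history in the ideal process.\<close>

lemma error_net_code:
  assumes "inj_on \<sigma> msgs" "\<sigma> ` msgs \<subseteq> paths" "m \<in> msgs" "b * n \<le> l"
  shows "emeasure (outputs G (net_code C msgs \<sigma>) m l)
      {h. \<exists>d\<in>D. dec (net_code C msgs \<sigma>) d (observed d h) \<noteq> Some m} \<le> err C (\<sigma> m)"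
proof -
  let ?O = "outputs G (net_code C msgs \<sigma>) m l" and ?I = "ideal C (\<sigma> m) l"
  let ?S = "{h. good_history C (\<sigma> m) h \<and> length h = l}"
  have s: "\<sigma> m \<in> paths" using assms by auto
  have "emeasure ?O ?S = emeasure ?I ?S"
    unfolding outputs_eq_process
    by (intro emeasure_pmf_cong_on pmf_process_eqI) (use assms s in \<open>auto simp: inputs_good\<close>)
  moreover have "emeasure (measure_pmf p) (- A) = 1 - emeasure (measure_pmf p) A" for p :: "(nat \<Rightarrow> 'y) list pmf" and A
    using emeasure_compl[of A "measure_pmf p"] measure_pmf.emeasure_space_1[of p] by (simp add: Compl_eq_Diff_UNIV)
  ultimately have eq: "emeasure ?O (- ?S) = emeasure ?I (- ?S)" by simp
  have "emeasure ?O {h. \<exists>d\<in>D. dec (net_code C msgs \<sigma>) d (observed d h) \<noteq> Some m} \<le> emeasure ?O (- ?S)"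
    using assms by (intro emeasure_mono) (auto simp: decodes_good)
  also have "\<dots> = emeasure ?I (- ?S)" by (rule eq)
  also have "\<dots> \<le> emeasure ?I {h. \<not> good_history C (\<sigma> m) h}"
    by (intro emeasure_mono_AE AE_pmfI) (auto dest: length_process)
  also have "\<dots> \<le> err C (\<sigma> m)" using s assms(4) by (rule emeasure_ideal_bad)
  finally show ?thesis .
qed

lemma idle: "k \<in> {1..nodes G} \<Longrightarrow> idle k \<in> inp G k"
  using network by (auto simp: idle_def dm_network_def some_in_eq)

theorem net_code:
  assumes "C \<in> set_pmf books" "inj_on \<sigma> (messages R l)" "\<sigma> ` messages R l \<subseteq> paths" "b * n \<le> l"
    and e: "\<And>m. m \<in> messages R l \<Longrightarrow> err C (\<sigma> m) \<le> ennreal e" "0 \<le> e"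
  shows "is_code G D R l (net_code C (messages R l) \<sigma>)"
    and "error_prob G D R l (net_code C (messages R l) \<sigma>) \<le> e"
proof -
  let ?c = "net_code C (messages R l) \<sigma>"
  show "is_code G D R l ?c"
    unfolding is_code_def
  proof (intro conjI ballI)
    fix m i ys assume m: "m \<in> messages R l"
    show "src ?c i m ys \<in> inp G 1"
    proof (cases "(i - 1) div n < b")
      case True
      let ?j = "(i - 1) div n"
      have "\<sigma> m ?j \<in> states" using m assms True by (auto intro: pathsD)
      then obtain xs where "snd (C ?j) (\<sigma> m ?j) \<in> set_pmf (\<nu> xs)"
        using books_support(2)[OF assms(1) True] by blast
      then show ?thesis using True source_inp n_pos by (auto simp: net_code_def)
    qed (use idle[of 1] network in \<open>auto simp: net_code_def dm_network_def\<close>)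
  next
    fix k i ys assume k: "k \<in> {2..nodes G}"
    then have k': "k \<in> K" by (simp add: K_eq)
    show "relay ?c k i ys \<in> inp G k"
    proof (cases "(i - 1) div n < b")
      case True
      have "fst (fst (C ((i - 1) div n)) k (relay_index C k ys ((i - 1) div n))) \<in> set_pmf (\<kappa> k)"
        using k' True assms(1) by (intro books_support relay_index_less)
      from relay_inp[OF k' this] show ?thesis using True n_pos by (simp add: net_code_def)
    qed (use idle[of k] k in \<open>auto simp: net_code_def\<close>)
  next
    fix d ys
    show "dec ?c d ys \<in> {None} \<union> Some ` messages R l"
    proof (cases "\<exists>!m. candidate C (messages R l) \<sigma> d ys m")
      case True
      from theI'[OF this] have "(THE m. candidate C (messages R l) \<sigma> d ys m) \<in> messages R l"
        by (simp add: candidate_def)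
      with True show ?thesis by (simp add: net_code_def)
    qed (simp add: net_code_def)
  qed
  have fm: "finite (messages R l)" "messages R l \<noteq> {}" by (auto simp: messages_def)
  have "ennreal (error_prob G D R l ?c) = (\<integral>\<^sup>+m. emeasure (outputs G ?c m l)
      {h. \<exists>d\<in>D. dec ?c d (observed d h) \<noteq> Some m} \<partial>pmf_of_set (messages R l))"
    by (simp add: error_prob_def measure_pmf.emeasure_eq_measure[symmetric] vimage_def)
  also have "\<dots> \<le> (\<integral>\<^sup>+m. ennreal e \<partial>pmf_of_set (messages R l))"
    using fm assms by (intro nn_integral_mono_AE AE_pmfI order_trans[OF error_net_code e(1)]) auto
  also have "\<dots> = ennreal e" by simp
  finally show "error_prob G D R l ?c \<le> e" using e(2) by simp
qed

end

subsection \<open>Entropy form of the bound\<close>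

definition loglik :: "'s pmf \<Rightarrow> ('s \<Rightarrow> 'a) \<Rightarrow> 's \<Rightarrow> real" where
  "loglik P f \<omega> = log 2 (pmf (map_pmf f P) (f \<omega>))"

definition avg :: "'s pmf \<Rightarrow> ('s \<Rightarrow> real) \<Rightarrow> real" where
  "avg P f = (\<Sum>\<omega>\<in>set_pmf P. pmf P \<omega> * f \<omega>)"

definition ent :: "'s pmf \<Rightarrow> ('s \<Rightarrow> 'a) \<Rightarrow> real" where
  "ent P f = - avg P (loglik P f)"

lemma avg_add: "avg P (\<lambda>\<omega>. f \<omega> + g \<omega>) = avg P f + avg P g"
  by (simp add: avg_def algebra_simps sum.distrib)

lemma avg_diff: "avg P (\<lambda>\<omega>. f \<omega> - g \<omega>) = avg P f - avg P g"
  by (simp add: avg_def algebra_simps sum_subtractf)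

lemma avg_sum: "avg P (\<lambda>\<omega>. \<Sum>k\<in>A. f k \<omega>) = (\<Sum>k\<in>A. avg P (f k))"
  unfolding avg_def sum_distrib_left by (rule sum.swap)

lemma avg_cong: "(\<And>\<omega>. \<omega> \<in> set_pmf P \<Longrightarrow> f \<omega> = g \<omega>) \<Longrightarrow> avg P f = avg P g"
  by (simp add: avg_def cong: sum.cong)

lemma avg_loglik: "avg P (loglik P f) = - ent P f"
  by (simp add: ent_def)

lemma pmf_map_pos: "\<omega> \<in> set_pmf P \<Longrightarrow> 0 < pmf (map_pmf f P) (f \<omega>)"
  by (simp add: pmf_positive_iff)

lemma sum_map_pmf:
  fixes g :: "'a \<Rightarrow> real"
  assumes "finite (set_pmf P)"
  shows "(\<Sum>v\<in>set_pmf (map_pmf f P). pmf (map_pmf f P) v * g v) = avg P (\<lambda>\<omega>. g (f \<omega>))"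
proof -
  have "(\<Sum>v\<in>set_pmf (map_pmf f P). pmf (map_pmf f P) v * g v) = measure_pmf.expectation (map_pmf f P) g"
    using assms by (subst integral_measure_pmf_real[where A = "set_pmf (map_pmf f P)"]) (auto simp: mult.commute)
  also have "\<dots> = measure_pmf.expectation P (\<lambda>\<omega>. g (f \<omega>))" by simp
  also have "\<dots> = avg P (\<lambda>\<omega>. g (f \<omega>))"
    using assms by (subst integral_measure_pmf_real[where A = "set_pmf P"]) (auto simp: avg_def mult.commute)
  finally show ?thesis .
qed

lemma pmf_map_cong_kernel:
  assumes "\<And>\<omega>'. \<omega>' \<in> set_pmf P \<Longrightarrow> f \<omega>' = f \<omega> \<longleftrightarrow> g \<omega>' = g \<omega>"
  shows "pmf (map_pmf f P) (f \<omega>) = pmf (map_pmf g P) (g \<omega>)"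
proof -
  have "measure_pmf.prob P (f -` {f \<omega>}) = measure_pmf.prob P (g -` {g \<omega>})"
    using assms by (intro measure_pmf.finite_measure_eq_AE AE_pmfI) auto
  then show ?thesis by (simp add: pmf_map)
qed

text \<open>Entropy depends only on the partition that a variable induces on the support; this
  licenses regrouping tuples and dropping components determined by others.\<close>

lemma ent_cong:
  assumes "\<And>\<omega> \<omega>'. \<omega> \<in> set_pmf P \<Longrightarrow> \<omega>' \<in> set_pmf P \<Longrightarrow> f \<omega>' = f \<omega> \<longleftrightarrow> g \<omega>' = g \<omega>"
  shows "ent P f = ent P g"
  unfolding ent_def loglik_def
  by (intro arg_cong[where f = uminus] avg_cong arg_cong[where f = "log 2"] pmf_map_cong_kernel assms)

lemma cond_info_ent:
  assumes "finite (set_pmf P)"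
  shows "I[P](V ; W | Z) = ent P (\<lambda>\<omega>. (V \<omega>, Z \<omega>)) + ent P (\<lambda>\<omega>. (W \<omega>, Z \<omega>))
      - ent P (\<lambda>\<omega>. (V \<omega>, W \<omega>, Z \<omega>)) - ent P Z"
proof -
  have "I[P](V ; W | Z) = avg P (\<lambda>\<omega>. log 2 (pmf (map_pmf (\<lambda>\<omega>. (V \<omega>, W \<omega>, Z \<omega>)) P) (V \<omega>, W \<omega>, Z \<omega>) * pmf (map_pmf Z P) (Z \<omega>) /
         (pmf (map_pmf (\<lambda>\<omega>. (V \<omega>, Z \<omega>)) P) (V \<omega>, Z \<omega>) * pmf (map_pmf (\<lambda>\<omega>. (W \<omega>, Z \<omega>)) P) (W \<omega>, Z \<omega>))))"
    unfolding cond_info_eq[OF assms]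
    using sum_map_pmf[OF assms, of "\<lambda>\<omega>. (V \<omega>, W \<omega>, Z \<omega>)" "\<lambda>(v, w, z). log 2 (pmf (map_pmf (\<lambda>\<omega>. (V \<omega>, W \<omega>, Z \<omega>)) P) (v, w, z) * pmf (map_pmf Z P) z /
         (pmf (map_pmf (\<lambda>\<omega>. (V \<omega>, Z \<omega>)) P) (v, z) * pmf (map_pmf (\<lambda>\<omega>. (W \<omega>, Z \<omega>)) P) (w, z)))"]
    by (simp add: case_prod_unfold)
  also have "\<dots> = avg P (\<lambda>\<omega>. loglik P (\<lambda>\<omega>. (V \<omega>, W \<omega>, Z \<omega>)) \<omega> + loglik P Z \<omega>
      - (loglik P (\<lambda>\<omega>. (V \<omega>, Z \<omega>)) \<omega> + loglik P (\<lambda>\<omega>. (W \<omega>, Z \<omega>)) \<omega>))"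
  proof (rule avg_cong)
    fix \<omega> assume w: "\<omega> \<in> set_pmf P"
    note pos = pmf_map_pos[OF w, of "\<lambda>\<omega>. (V \<omega>, W \<omega>, Z \<omega>)"] pmf_map_pos[OF w, of Z]
      pmf_map_pos[OF w, of "\<lambda>\<omega>. (V \<omega>, Z \<omega>)"] pmf_map_pos[OF w, of "\<lambda>\<omega>. (W \<omega>, Z \<omega>)"]
    show "log 2 (pmf (map_pmf (\<lambda>\<omega>. (V \<omega>, W \<omega>, Z \<omega>)) P) (V \<omega>, W \<omega>, Z \<omega>) * pmf (map_pmf Z P) (Z \<omega>) /
         (pmf (map_pmf (\<lambda>\<omega>. (V \<omega>, Z \<omega>)) P) (V \<omega>, Z \<omega>) * pmf (map_pmf (\<lambda>\<omega>. (W \<omega>, Z \<omega>)) P) (W \<omega>, Z \<omega>)))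
      = loglik P (\<lambda>\<omega>. (V \<omega>, W \<omega>, Z \<omega>)) \<omega> + loglik P Z \<omega>
      - (loglik P (\<lambda>\<omega>. (V \<omega>, Z \<omega>)) \<omega> + loglik P (\<lambda>\<omega>. (W \<omega>, Z \<omega>)) \<omega>)"
      using pos unfolding loglik_def by (subst log_divide_pos) (auto simp: log_mult_pos mult_pos_pos)
  qed
  also have "\<dots> = ent P (\<lambda>\<omega>. (V \<omega>, Z \<omega>)) + ent P (\<lambda>\<omega>. (W \<omega>, Z \<omega>))
      - ent P (\<lambda>\<omega>. (V \<omega>, W \<omega>, Z \<omega>)) - ent P Z"
    by (simp add: avg_add avg_diff avg_loglik)
  finally show ?thesis .
qed

text \<open>In increasing order, \<open>insert k (A \<inter> {..<k})\<close> is the initial segment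
  belonging to the next element. With entropies for \<open>F\<close> this is the chain rule behind
  the sets S_k^c of the theorem.\<close>

lemma sum_telescope_initial_segments:
  fixes F :: "nat set \<Rightarrow> real"
  assumes "finite A"
  shows "(\<Sum>k\<in>A. F (A \<inter> {..<k}) - F (insert k (A \<inter> {..<k}))) = F {} - F A"
  using assms
proof (induction A rule: finite_linorder_max_induct)
  case (insert b A)
  have "insert b A \<inter> {..<b} = A" using insert.hyps by auto
  moreover have "insert b A \<inter> {..<k} = A \<inter> {..<k}" if "k \<in> A" for k
    using insert.hyps that by auto
  ultimately have "(\<Sum>k\<in>insert b A. F (insert b A \<inter> {..<k}) - F (insert k (insert b A \<inter> {..<k})))
      = (F A - F (insert b A)) + (\<Sum>k\<in>A. F (A \<inter> {..<k}) - F (insert k (A \<inter> {..<k})))"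
    using insert.hyps by (subst sum.insert) auto
  then show ?case by (simp add: insert.IH)
qed simp

lemma restrict_eq_iff: "(\<lambda>k\<in>A. f k) = (\<lambda>k\<in>A. g k) \<longleftrightarrow> (\<forall>k\<in>A. f k = g k)"
proof
  assume "(\<lambda>k\<in>A. f k) = (\<lambda>k\<in>A. g k)"
  from fun_cong[OF this] show "\<forall>k\<in>A. f k = g k" by (metis restrict_apply')
qed (auto simp: restrict_def)

section \<open>Entropies of the joint law and the value of a cut\<close>

locale single_letter =
  fixes G :: "('x, 'y) network" and p :: "'x input_pmf" and D :: "nat set"
  assumes network: "dm_network G" and p: "p \<in> input_pmfs G" and D_sub: "D \<subseteq> {2..nodes G}"
begin

abbreviation "N \<equiv> nodes G"
definition K where "K = {2..nodes G}"
definition P where "P = joint_pmf G p"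

definition aux :: "nat set \<Rightarrow> ('x, 'y) outcome \<Rightarrow> nat \<Rightarrow> 'x \<times> nat" where
  "aux A \<omega> = (\<lambda>k\<in>A. (rvX k \<omega>, rvU k \<omega>))"

abbreviation "XQ k \<equiv> (\<lambda>\<omega> :: ('x, 'y) outcome. (rvX k \<omega>, rvQ \<omega>))"
abbreviation "XYQ k \<equiv> (\<lambda>\<omega> :: ('x, 'y) outcome. (rvX k \<omega>, rvY k \<omega>, rvQ \<omega>))"
abbreviation "UXQ k \<equiv> (\<lambda>\<omega> :: ('x, 'y) outcome. (rvU k \<omega>, rvX k \<omega>, rvQ \<omega>))"
abbreviation "UXYQ k \<equiv> (\<lambda>\<omega> :: ('x, 'y) outcome. (rvU k \<omega>, rvX k \<omega>, rvY k \<omega>, rvQ \<omega>))"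
abbreviation "XsQ \<equiv> (\<lambda>\<omega> :: ('x, 'y) outcome. (rvXs K \<omega>, rvQ \<omega>))"
abbreviation "XXsQ \<equiv> (\<lambda>\<omega> :: ('x, 'y) outcome. (rvX 1 \<omega>, rvXs K \<omega>, rvQ \<omega>))"
abbreviation "allQ \<equiv> (\<lambda>\<omega> :: ('x, 'y) outcome. (rvX 1 \<omega>, aux K \<omega>, rvQ \<omega>))"
abbreviation "allYQ d \<equiv> (\<lambda>\<omega> :: ('x, 'y) outcome. (rvX 1 \<omega>, aux K \<omega>, rvY d \<omega>, rvQ \<omega>))"
abbreviation "auxYQ A d \<equiv> (\<lambda>\<omega> :: ('x, 'y) outcome. (aux A \<omega>, rvY d \<omega>, rvQ \<omega>))"

lemma finite_K [simp]: "finite K" by (simp add: K_def)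

lemma nodes: "{1..N} = insert 1 K"
  using network by (auto simp: K_def dm_network_def)

lemma set_p: "(x, u, q) \<in> set_pmf p \<Longrightarrow> x \<in> PiE {1..N} (inp G)"
  using p by (auto simp: input_pmfs_def)

lemma finite_set_p: "finite (set_pmf p)"
proof -
  obtain AU AQ where *: "\<forall>k\<in>{2..N}. finite (AU k)" "finite (AQ :: nat set)"
    "set_pmf p \<subseteq> PiE {1..N} (inp G) \<times> PiE {2..N} AU \<times> AQ"
    using p by (auto simp: input_pmfs_def)
  have "finite (PiE {1..N} (inp G))" "finite (PiE {2..N} AU)"
    using * network by (auto intro!: finite_PiE simp: dm_network_def)
  then show ?thesis using * by (meson finite_SigmaI finite_subset)
qed

lemma set_P: "set_pmf P = {(x, u, q, y). (x, u, q) \<in> set_pmf p \<and> y \<in> set_pmf (chan G x)}"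
  by (auto simp: P_def joint_pmf_def)

lemma finite_set_P: "finite (set_pmf P)"
proof -
  have "finite (set_pmf (chan G x))" if "(x, u, q) \<in> set_pmf p" for x u q
  proof (rule finite_subset)
    show "set_pmf (chan G x) \<subseteq> PiE {1..N} (outp G)"
      using network set_p[OF that] by (auto simp: dm_network_def)
    show "finite (PiE {1..N} (outp G))"
      using network by (intro finite_PiE) (auto simp: dm_network_def)
  qed
  then show ?thesis using finite_set_p
    by (auto simp: P_def joint_pmf_def)
qed

lemma rvX_cong:
  assumes "\<omega> \<in> set_pmf P" "\<omega>' \<in> set_pmf P"
  shows "rvXs {1..N} \<omega>' = rvXs {1..N} \<omega> \<longleftrightarrow> fst \<omega>' = fst \<omega>"
proof -
  have "fst \<omega> \<in> extensional {1..N}" "fst \<omega>' \<in> extensional {1..N}"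
    using assms by (auto simp: set_P PiE_def dest!: set_p)
  then show ?thesis
    by (auto simp: rvXs_def rvX_def case_prod_unfold fun_eq_iff extensional_def restrict_def) metis
qed

text \<open>The conditional entropy H(Y_d | X^N).\<close>

definition noise_ent :: "nat \<Rightarrow> real" where
  "noise_ent d = - avg P (\<lambda>(x, u, q, y). log 2 (pmf (map_pmf (\<lambda>y. y d) (chan G x)) (y d)))"

text \<open>The output is conditionally independent of \<open>(U, Q)\<close> given the input vector.\<close>
lemma ent_output:
  assumes g: "\<And>\<omega> \<omega>'. \<omega> \<in> set_pmf P \<Longrightarrow> \<omega>' \<in> set_pmf P \<Longrightarrow> g \<omega>' = g \<omega> \<Longrightarrow> fst \<omega>' = fst \<omega>"
    and indep: "\<And>x u q y y'. g (x, u, q, y) = g (x, u, q, y')"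
  shows "ent P (\<lambda>\<omega>. (g \<omega>, rvY d \<omega>)) = ent P g + noise_ent d"
proof -
  have *: "loglik P (\<lambda>\<omega>. (g \<omega>, rvY d \<omega>)) (x, u, q, y)
      = loglik P g (x, u, q, y) + log 2 (pmf (map_pmf (\<lambda>y. y d) (chan G x)) (y d))"
    if w: "(x, u, q, y) \<in> set_pmf P" for x u q y
  proof -
    let ?w = "(x, u, q, y)"
    let ?c = "pmf (map_pmf (\<lambda>y. y d) (chan G x)) (y d)"
    define h where "h = (\<lambda>(x, u, q). g (x, u, q, y))"
    have gh: "g (x, u, q, y') = h (x, u, q)" for x u q y' by (simp add: h_def indep[of x u q y' y])
    have map_g: "map_pmf g P = map_pmf h p"
      unfolding P_def joint_pmf_def map_bind_pmf
      by (simp add: map_pmf_def case_prod_unfold gh bind_assoc_pmf bind_return_pmf)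
    have mg: "pmf (map_pmf g P) (g ?w) = (\<Sum>i\<in>set_pmf p. pmf p i * indicator {g ?w} (h i))"
      unfolding map_g using finite_set_p by (simp add: map_pmf_def pmf_bind integral_measure_pmf_real[where A = "set_pmf p"] indicator_def mult.commute of_bool_def)
    have "map_pmf (\<lambda>\<omega>. (g \<omega>, rvY d \<omega>)) P = bind_pmf p (\<lambda>i. map_pmf (\<lambda>z. (h i, z)) (map_pmf (\<lambda>y. y d) (chan G (fst i))))"
      unfolding P_def joint_pmf_def map_bind_pmf
      by (simp add: case_prod_unfold gh pmf.map_comp o_def rvY_def)
    then have "pmf (map_pmf (\<lambda>\<omega>. (g \<omega>, rvY d \<omega>)) P) (g ?w, y d)
       = (\<Sum>i\<in>set_pmf p. pmf p i * pmf (map_pmf (\<lambda>z. (h i, z)) (map_pmf (\<lambda>y. y d) (chan G (fst i)))) (g ?w, y d))"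
      using finite_set_p by (simp add: pmf_bind integral_measure_pmf_real[where A = "set_pmf p"] mult.commute)
    also have "\<dots> = (\<Sum>i\<in>set_pmf p. pmf p i * (indicator {g ?w} (h i) * ?c))"
    proof (intro sum.cong refl arg_cong2[where f = "(*)"])
      fix i assume i: "i \<in> set_pmf p"
      obtain x' u' q' where i': "i = (x', u', q')" by (cases i)
      show "pmf (map_pmf (\<lambda>z. (h i, z)) (map_pmf (\<lambda>y. y d) (chan G (fst i)))) (g ?w, y d) = indicator {g ?w} (h i) * ?c"
      proof (cases "h i = g ?w")
        case True
        obtain y' where y': "y' \<in> set_pmf (chan G x')" using set_pmf_not_empty[of "chan G x'"] by auto
        then have "(x', u', q', y') \<in> set_pmf P" using i i' by (simp add: set_P)
        moreover have "g (x', u', q', y') = g ?w" using True i' by (simp add: gh)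
        ultimately have "x' = x" using g[OF w] by fastforce
        moreover have "inj (\<lambda>z. (g ?w, z :: 'y))" by (auto intro: injI)
        from pmf_map_inj'[OF this, of "map_pmf (\<lambda>y. y d) (chan G x)" "y d"]
        have "pmf (map_pmf (\<lambda>z. (g ?w, z)) (map_pmf (\<lambda>y. y d) (chan G x))) (g ?w, y d) = ?c" .
        ultimately show ?thesis using True i' by simp
      next
        case False
        then have "pmf (map_pmf (\<lambda>z. (h i, z)) (map_pmf (\<lambda>y. y d) (chan G (fst i)))) (g ?w, y d) = 0"
          by (intro pmf_map_outside) auto
        then show ?thesis using False by simp
      qed
    qed
    also have "\<dots> = pmf (map_pmf g P) (g ?w) * ?c"
      unfolding mg sum_distrib_right by (intro sum.cong) auto
    finally have "pmf (map_pmf (\<lambda>\<omega>. (g \<omega>, rvY d \<omega>)) P) (g ?w, rvY d ?w) = pmf (map_pmf g P) (g ?w) * ?c"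
      by (simp add: rvY_def)
    moreover have "?c > 0" using w by (auto simp: set_P pmf_positive_iff)
    ultimately show ?thesis
      using pmf_map_pos[OF w, of g] by (simp add: loglik_def log_mult_pos)
  qed
  have "ent P (\<lambda>\<omega>. (g \<omega>, rvY d \<omega>)) = - avg P (\<lambda>\<omega>. loglik P g \<omega> + (\<lambda>(x, u, q, y). log 2 (pmf (map_pmf (\<lambda>y. y d) (chan G x)) (y d))) \<omega>)"
    unfolding ent_def by (intro arg_cong[where f = uminus] avg_cong) (use * in auto)
  then show ?thesis by (simp add: avg_add avg_loglik noise_ent_def)
qed

text \<open>I(U_k; Y_k | X_k, Q), expanded into joint entropies.\<close>

definition relay_info :: "nat \<Rightarrow> real" where
  "relay_info k = ent P (UXQ k) + ent P (XYQ k)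
     - ent P (UXYQ k) - ent P (XQ k)"

text \<open>The sum of H(X_k, U_k | Q) over \<open>S\<close> plus H(X_1 | X(K), Q): minus the mean
  log-probability with which codebooks generate these letters separately.\<close>

definition code_ent :: "nat set \<Rightarrow> real" where
  "code_ent S = (\<Sum>k\<in>S. ent P (UXQ k) - ent P rvQ)
     + ent P XXsQ - ent P XsQ"

text \<open>The relative entropy of the law of all letters and Y_d with respect to the law in which
  the letters of \<open>S\<close> and of the source are generated afresh. It is the exponent with
  which a wrong state fails the test.\<close>

definition dest_info :: "nat \<Rightarrow> nat set \<Rightarrow> real" where
  "dest_info d S = code_ent S + ent P (auxYQ (K - S) d)
     - ent P (allYQ d)"

text \<open>The relative entropy of the wanted law of a letter with respect to separate generation
  by the codebooks; it governs how rare typical branches are.\<close>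

definition code_div :: real where
  "code_div = code_ent K + ent P rvQ - ent P allQ"

lemma aux_eq_iff: "aux A \<omega>' = aux A \<omega> \<longleftrightarrow> rvXs A \<omega>' = rvXs A \<omega> \<and> rvUs A \<omega>' = rvUs A \<omega>"
  unfolding aux_def rvXs_def rvUs_def restrict_eq_iff by auto

lemma rvXs_insert: "rvXs (insert k A) \<omega>' = rvXs (insert k A) \<omega> \<longleftrightarrow> rvX k \<omega>' = rvX k \<omega> \<and> rvXs A \<omega>' = rvXs A \<omega>"
  unfolding rvXs_def restrict_eq_iff by auto

lemma rvUs_insert: "rvUs (insert k A) \<omega>' = rvUs (insert k A) \<omega> \<longleftrightarrow> rvU k \<omega>' = rvU k \<omega> \<and> rvUs A \<omega>' = rvUs A \<omega>"
  unfolding rvUs_def restrict_eq_iff by auto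

lemma rvXs_union: "rvXs (A \<union> B) \<omega>' = rvXs (A \<union> B) \<omega> \<longleftrightarrow> rvXs A \<omega>' = rvXs A \<omega> \<and> rvXs B \<omega>' = rvXs B \<omega>"
  unfolding rvXs_def restrict_eq_iff by auto

lemma rvXs_member: "rvXs A \<omega>' = rvXs A \<omega> \<Longrightarrow> k \<in> A \<Longrightarrow> rvX k \<omega>' = rvX k \<omega>"
  unfolding rvXs_def restrict_eq_iff by auto

lemma empty_vec [simp]: "rvXs {} \<omega> = (\<lambda>_. undefined)" "rvUs {} \<omega> = (\<lambda>_. undefined)"
  by (auto simp: rvXs_def rvUs_def)

text \<open>Every information term is expanded into entropies. The noise entropy of Y_k cancels
  within each summand and that of Y_d between the two sides; the entropies of the U and X vectors
  along initial segments of \<open>Sc\<close> telescope.\<close>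

theorem cut_value:
  assumes "S \<subseteq> {1..N}" "1 \<in> S" "d \<in> {1..N} - S"
  defines "Sc \<equiv> {1..N} - S"
  shows "I[P](rvXs S ; (\<lambda>\<omega>. (rvUs Sc \<omega>, rvY d \<omega>)) | (\<lambda>\<omega>. (rvXs Sc \<omega>, rvQ \<omega>)))
      - (\<Sum>k\<in>Sc. I[P](rvU k ; (\<lambda>\<omega>. (rvUs (Sc \<inter> {1..k - 1}) \<omega>, rvXs {1..N} \<omega>)) | (XYQ k))
           + I[P](rvX k ; rvXs (Sc \<inter> {1..k - 1}) | rvQ))
    = dest_info d (S - {1}) - code_div + (\<Sum>k\<in>K - (S - {1}). relay_info k)"
proof -
  let ?X = "rvXs {1..N}"
  have Sc: "Sc = K - (S - {1})" "Sc \<subseteq> K" "finite Sc" "{1..N} = S \<union> Sc"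
    using assms nodes by (auto simp: Sc_def K_def)
  \<comment> \<open>Elements of \<open>Sc\<close> are at least 2, so both sets cut out the same
    part; the second form suits the telescoping lemma.\<close>
  have seg: "Sc \<inter> {1..k - 1} = Sc \<inter> {..<k}" for k
    using Sc(2) by (auto simp: K_def)
  let ?J = "\<lambda>A. ent P (\<lambda>\<omega>. (rvUs A \<omega>, ?X \<omega>, rvQ \<omega>))"
  let ?V = "\<lambda>A. ent P (\<lambda>\<omega>. (rvXs A \<omega>, rvQ \<omega>))"
  have out1: "ent P (\<lambda>\<omega>. (g \<omega>, rvY d \<omega>)) = ent P g + noise_ent d"
    if "g = (\<lambda>\<omega>. (h \<omega>, ?X \<omega>, rvQ \<omega>))" "\<And>x u q y y'. h (x, u, q, y) = h (x, u, q, y')" for g d and h :: "('x, 'y) outcome \<Rightarrow> 'h"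
  proof (rule ent_output)
    show "fst \<omega>' = fst \<omega>" if "\<omega> \<in> set_pmf P" "\<omega>' \<in> set_pmf P" "g \<omega>' = g \<omega>" for \<omega> \<omega>'
      using that \<open>g = _\<close> rvX_cong[OF that(1,2)] by simp
    show "g (x, u, q, y) = g (x, u, q, y')" for x u q y y'
      using that by (simp add: rvXs_def rvX_def rvQ_def)
  qed
  have Ui: "rvUs A (x, u, q, y) = rvUs A (x, u, q, y')" "rvU k (x, u, q, y) = rvU k (x, u, q, y')" for A k and x :: "nat \<Rightarrow> 'x" and u q and y y' :: "nat \<Rightarrow> 'y"
    by (simp_all add: rvUs_def rvU_def)
  have first: "I[P](rvXs S ; (\<lambda>\<omega>. (rvUs Sc \<omega>, rvY d \<omega>)) | (\<lambda>\<omega>. (rvXs Sc \<omega>, rvQ \<omega>)))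
     = ?J {} + ent P (auxYQ Sc d) - (?J Sc + noise_ent d) - ?V Sc"
  proof -
    have 1: "ent P (\<lambda>\<omega>. (rvXs S \<omega>, rvXs Sc \<omega>, rvQ \<omega>)) = ?J {}"
      by (rule ent_cong) (auto simp: Sc(4) rvXs_union simp del: One_nat_def)
    have 2: "ent P (\<lambda>\<omega>. ((rvUs Sc \<omega>, rvY d \<omega>), rvXs Sc \<omega>, rvQ \<omega>)) = ent P (auxYQ Sc d)"
      by (rule ent_cong) (auto simp: aux_eq_iff)
    have "ent P (\<lambda>\<omega>. (rvXs S \<omega>, (rvUs Sc \<omega>, rvY d \<omega>), rvXs Sc \<omega>, rvQ \<omega>))
        = ent P (\<lambda>\<omega>. ((rvUs Sc \<omega>, ?X \<omega>, rvQ \<omega>), rvY d \<omega>))"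
      by (rule ent_cong) (auto simp: Sc(4) rvXs_union simp del: One_nat_def)
    also have "\<dots> = ?J Sc + noise_ent d" by (rule out1[OF refl]) (rule Ui)
    finally show ?thesis using 1 2 by (simp add: cond_info_ent[OF finite_set_P])
  qed
  have second: "I[P](rvU k ; (\<lambda>\<omega>. (rvUs A \<omega>, ?X \<omega>)) | (XYQ k))
     = ent P (UXYQ k) - ent P (XYQ k) + (?J A - ?J (insert k A))"
    if "k \<in> Sc" for k A
  proof -
    have k: "k \<in> {1..N}" using that by (simp add: Sc_def)
    have "ent P (\<lambda>\<omega>. ((rvUs A \<omega>, ?X \<omega>), rvX k \<omega>, rvY k \<omega>, rvQ \<omega>)) = ent P (\<lambda>\<omega>. ((rvUs A \<omega>, ?X \<omega>, rvQ \<omega>), rvY k \<omega>))"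
      by (rule ent_cong) (use k in \<open>auto dest: rvXs_member\<close>)
    also have "\<dots> = ?J A + noise_ent k" by (rule out1[OF refl]) (rule Ui)
    finally have 1: "ent P (\<lambda>\<omega>. ((rvUs A \<omega>, ?X \<omega>), rvX k \<omega>, rvY k \<omega>, rvQ \<omega>)) = ?J A + noise_ent k" .
    have "ent P (\<lambda>\<omega>. (rvU k \<omega>, (rvUs A \<omega>, ?X \<omega>), rvX k \<omega>, rvY k \<omega>, rvQ \<omega>)) = ent P (\<lambda>\<omega>. ((rvUs (insert k A) \<omega>, ?X \<omega>, rvQ \<omega>), rvY k \<omega>))"
      by (rule ent_cong) (use k in \<open>auto simp: rvUs_insert dest: rvXs_member\<close>)
    also have "\<dots> = ?J (insert k A) + noise_ent k" by (rule out1[OF refl]) (rule Ui)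
    finally show ?thesis using 1 by (simp add: cond_info_ent[OF finite_set_P])
  qed
  have third: "I[P](rvX k ; rvXs A | rvQ) = ent P (XQ k) - ent P rvQ + (?V A - ?V (insert k A))" for k A
  proof -
    have "ent P (\<lambda>\<omega>. (rvX k \<omega>, rvXs A \<omega>, rvQ \<omega>)) = ?V (insert k A)"
      by (rule ent_cong) (auto simp: rvXs_insert)
    then show ?thesis by (simp add: cond_info_ent[OF finite_set_P])
  qed
  let ?a = "\<lambda>k. ent P (UXYQ k) - ent P (XYQ k)
     + (ent P (XQ k) - ent P rvQ)"
  have "(\<Sum>k\<in>Sc. I[P](rvU k ; (\<lambda>\<omega>. (rvUs (Sc \<inter> {1..k - 1}) \<omega>, ?X \<omega>)) | (XYQ k))
           + I[P](rvX k ; rvXs (Sc \<inter> {1..k - 1}) | rvQ))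
     = (\<Sum>k\<in>Sc. ?a k + ((?J (Sc \<inter> {..<k}) - ?J (insert k (Sc \<inter> {..<k})))
          + (?V (Sc \<inter> {..<k}) - ?V (insert k (Sc \<inter> {..<k})))))"
    unfolding seg by (intro sum.cong) (auto simp: second third simp del: One_nat_def)
  also have "\<dots> = (\<Sum>k\<in>Sc. ?a k) + ((?J {} - ?J Sc) + (?V {} - ?V Sc))"
    by (simp only: sum.distrib sum_telescope_initial_segments[OF Sc(3), of ?J] sum_telescope_initial_segments[OF Sc(3), of ?V])
  finally have rest: "(\<Sum>k\<in>Sc. I[P](rvU k ; (\<lambda>\<omega>. (rvUs (Sc \<inter> {1..k - 1}) \<omega>, ?X \<omega>)) | (XYQ k))
           + I[P](rvX k ; rvXs (Sc \<inter> {1..k - 1}) | rvQ))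
     = (\<Sum>k\<in>Sc. ?a k) + ((?J {} - ?J Sc) + (?V {} - ?V Sc))" .
  have V0: "?V {} = ent P rvQ" by (rule ent_cong) auto
  have "ent P (allYQ d) = ent P (\<lambda>\<omega>. ((rvUs K \<omega>, ?X \<omega>, rvQ \<omega>), rvY d \<omega>))"
    by (rule ent_cong) (auto simp: nodes rvXs_insert aux_eq_iff simp del: One_nat_def)
  also have "\<dots> = ?J K + noise_ent d" by (rule out1[OF refl]) (rule Ui)
  also have "?J K = ent P allQ"
    by (rule ent_cong) (auto simp: nodes rvXs_insert aux_eq_iff simp del: One_nat_def)
  finally have full: "ent P (allYQ d) = ent P allQ + noise_ent d" .
  have "1 \<notin> K" by (simp add: K_def)
  then have KS: "K - (K - Sc) = Sc" "S - {1} = K - Sc" using Sc(2) assms(1-3) nodes by (auto simp: Sc_def simp del: One_nat_def)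
  have split: "(\<Sum>k\<in>K. f k) = (\<Sum>k\<in>K - Sc. f k) + (\<Sum>k\<in>Sc. f k)" for f :: "nat \<Rightarrow> real"
    using Sc(2) by (simp add: sum.subset_diff)
  show ?thesis
    unfolding first rest V0 KS dest_info_def code_div_def code_ent_def relay_info_def full split
    by (simp add: sum.distrib sum_subtractf algebra_simps)
qed

end

subsection \<open>Sequences of independent letters\<close>

text \<open>Codebooks draw whole words relay by relay, while the density bounds work letter by
  letter. Transposing gives independent columns over time, each with the single-letter law of all
  relays in \<open>S\<close>.\<close>

lemma Pi_pmf_columns:
  assumes S: "finite S"
  shows "map_pmf (\<lambda>w. \<lambda>t\<in>{..<n}. \<lambda>k\<in>S. (fst (w k) t, snd (w k) t))
      (Pi_pmf S undefined (\<lambda>k. bind_pmf (Pi_pmf {..<n} undefined (\<kappa> k))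
         (\<lambda>x. map_pmf (Pair x) (Pi_pmf {..<n} undefined (\<lambda>t. \<mu> k t (x t))))))
    = Pi_pmf {..<n::nat} undefined (\<lambda>t. Pi_pmf S undefined (\<lambda>k. bind_pmf (\<kappa> k t) (\<lambda>x. map_pmf (Pair x) (\<mu> k t x))))"
    (is "map_pmf ?col (Pi_pmf S undefined ?B) = _")
proof -
  let ?l = "\<lambda>k t. bind_pmf (\<kappa> k t) (\<lambda>x. map_pmf (Pair x) (\<mu> k t x))"
  let ?T = "{..<n}" and ?u = undefined
  let ?split = "\<lambda>z. (\<lambda>t\<in>?T. fst (z t), \<lambda>t\<in>?T. snd (z t))"
  have e: "?B = (\<lambda>k. map_pmf ?split (Pi_pmf ?T ?u (?l k)))"
    by (rule ext, rule Pi_pmf_pair_bind[symmetric]) simp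
  have "map_pmf ?col (Pi_pmf S undefined ?B)
      = map_pmf ?col (map_pmf (\<lambda>g. \<lambda>k\<in>S. ?split (g k)) (Pi_pmf S (\<lambda>_. ?u) (\<lambda>k. Pi_pmf ?T ?u (?l k))))"
    unfolding e map_Pi_pmf_restrict[OF S, of "\<lambda>_. ?split"] ..
  also have "\<dots> = map_pmf (\<lambda>h. \<lambda>t\<in>?T. \<lambda>k\<in>S. h t k)
      (map_pmf (\<lambda>x t k. x k t) (Pi_pmf S (\<lambda>_. ?u) (\<lambda>k. Pi_pmf ?T ?u (?l k))))"
    unfolding pmf.map_comp o_def
    by (intro map_pmf_cong refl) (auto simp: restrict_def fun_eq_iff)
  also have "\<dots> = map_pmf (\<lambda>h. \<lambda>t\<in>?T. restrict (h t) S)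
      (Pi_pmf ?T (\<lambda>_. ?u) (\<lambda>t. Pi_pmf S ?u (\<lambda>k. ?l k t)))"
    by (subst Pi_pmf_transpose) (use S in auto)
  also have "\<dots> = Pi_pmf ?T undefined (\<lambda>t. map_pmf (\<lambda>h. restrict h S) (Pi_pmf S ?u (\<lambda>k. ?l k t)))"
    by (rule map_Pi_pmf_restrict) simp
  also have "(\<lambda>t. map_pmf (\<lambda>h. restrict h S) (Pi_pmf S ?u (\<lambda>k. ?l k t))) = (\<lambda>t. Pi_pmf S undefined (\<lambda>k. ?l k t))"
  proof
    fix t
    show "map_pmf (\<lambda>h. restrict h S) (Pi_pmf S ?u (\<lambda>k. ?l k t)) = Pi_pmf S undefined (\<lambda>k. ?l k t)"
      using map_Pi_pmf_restrict[OF S, of "\<lambda>_ x. x" ?u "\<lambda>k. ?l k t"] by simp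
  qed
  finally show ?thesis .
qed

text \<open>The conditional law of \<open>f\<close> given \<open>g = z\<close>. Off the support a
  default with values in the alphabet is needed, since separately drawn relay letters may form a
  combination that \<open>P\<close> excludes.\<close>

definition cnd :: "'s pmf \<Rightarrow> ('s \<Rightarrow> 'a) \<Rightarrow> ('s \<Rightarrow> 'b) \<Rightarrow> 'b \<Rightarrow> 'a pmf" where
  "cnd P f g z = (if \<exists>\<omega>\<in>set_pmf P. g \<omega> = z then map_pmf f (cond_pmf P {\<omega>. g \<omega> = z}) else map_pmf f P)"

lemma set_cnd: "set_pmf (cnd P f g z) \<subseteq> f ` set_pmf P"
proof (cases "\<exists>\<omega>\<in>set_pmf P. g \<omega> = z")
  case True
  then have "set_pmf P \<inter> {\<omega>. g \<omega> = z} \<noteq> {}" by auto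
  then show ?thesis using True by (auto simp: cnd_def set_cond_pmf)
qed (simp add: cnd_def)

lemma measure_cond_pmf:
  assumes "set_pmf P \<inter> s \<noteq> {}"
  shows "measure (cond_pmf P s) A = measure P (A \<inter> s) / measure P s"
proof -
  let ?c = "measure P s"
  have "emeasure (cond_pmf P s) A = (\<integral>\<^sup>+x. ennreal (1 / ?c) * (ennreal (pmf P x) * indicator s x) \<partial>count_space A)"
    unfolding nn_integral_pmf[symmetric]
    by (intro nn_integral_cong) (auto simp: pmf_cond[OF assms] ennreal_mult'[symmetric] indicator_def)
  also have "\<dots> = ennreal (1 / ?c) * (\<integral>\<^sup>+x. ennreal (pmf P x) * indicator s x \<partial>count_space A)"
    by (rule nn_integral_cmult) simp
  also have "(\<integral>\<^sup>+x. ennreal (pmf P x) * indicator s x \<partial>count_space A) = (\<integral>\<^sup>+x. ennreal (pmf P x) \<partial>count_space (A \<inter> s))"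
    by (subst (1 2) nn_integral_count_space_indicator) (auto intro!: nn_integral_cong simp: indicator_def)
  also have "\<dots> = ennreal (measure P (A \<inter> s))"
    by (simp add: nn_integral_pmf measure_pmf.emeasure_eq_measure)
  finally have "ennreal (measure (cond_pmf P s) A) = ennreal (measure P (A \<inter> s) / ?c)"
    by (simp add: measure_pmf.emeasure_eq_measure ennreal_mult'[symmetric])
  then show ?thesis by (subst (asm) ennreal_inj) auto
qed

lemma pmf_cnd: "pmf (map_pmf g P) z * pmf (cnd P f g z) a = pmf (map_pmf (\<lambda>\<omega>. (f \<omega>, g \<omega>)) P) (a, z)"
proof (cases "\<exists>\<omega>\<in>set_pmf P. g \<omega> = z")
  case True
  then have ne: "set_pmf P \<inter> {\<omega>. g \<omega> = z} \<noteq> {}" by auto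
  have "pmf (map_pmf g P) z = measure P {\<omega>. g \<omega> = z}" by (simp add: pmf_map vimage_def)
  moreover have "measure P {\<omega>. g \<omega> = z} > 0"
    using True by (auto simp: measure_pmf_posI)
  moreover have "pmf (map_pmf f (cond_pmf P {\<omega>. g \<omega> = z})) a
      = measure P ({\<omega>. f \<omega> = a} \<inter> {\<omega>. g \<omega> = z}) / measure P {\<omega>. g \<omega> = z}"
    using measure_cond_pmf[OF ne] by (simp add: pmf_map vimage_def)
  ultimately show ?thesis using True by (simp add: cnd_def pmf_map vimage_def Int_def)
next
  case False
  then have "pmf (map_pmf g P) z = 0" "pmf (map_pmf (\<lambda>\<omega>. (f \<omega>, g \<omega>)) P) (a, z) = 0"
    by (auto simp: pmf_eq_0_set_pmf)
  then show ?thesis by simp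
qed

text \<open>Integration against \<open>R\<close> cancels its probability in the denominator. What
  remains is the mass that \<open>J\<close> gives to a part of the fibre of \<open>g\<close> over
  \<open>r\<close>, divided by the mass of the fibre; a zero denominator makes the ratio
  zero.\<close>

lemma nn_integral_density_le_1:
  assumes h: "inj_on h (set_pmf R)" and g: "\<And>z. z \<in> set_pmf R \<Longrightarrow> g (h z) = r"
  shows "(\<integral>\<^sup>+z. ennreal (pmf J (h z) / (pmf (map_pmf g J) r * pmf R z)) \<partial>R) \<le> 1"
proof -
  let ?c = "pmf (map_pmf g J) r" and ?X = "set_pmf R"
  have "(\<integral>\<^sup>+z. ennreal (pmf J (h z) / (?c * pmf R z)) \<partial>R)
     = (\<integral>\<^sup>+z. ennreal (pmf R z) * ennreal (pmf J (h z) / (?c * pmf R z)) \<partial>count_space UNIV)"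
    by (rule nn_integral_measure_pmf)
  also have "\<dots> = (\<integral>\<^sup>+z. ennreal (pmf J (h z) / ?c) * indicator ?X z \<partial>count_space UNIV)"
    by (intro nn_integral_cong) (auto simp: ennreal_mult'[symmetric] indicator_def set_pmf_iff)
  also have "\<dots> = (\<integral>\<^sup>+z. ennreal (pmf J (h z) / ?c) \<partial>count_space ?X)"
    by (simp add: nn_integral_count_space_indicator)
  also have "\<dots> = (\<integral>\<^sup>+z. ennreal (1 / ?c) * ennreal (pmf J (h z)) \<partial>count_space ?X)"
    by (intro nn_integral_cong) (simp add: ennreal_mult'[symmetric])
  also have "\<dots> = ennreal (1 / ?c) * (\<integral>\<^sup>+z. ennreal (pmf J (h z)) \<partial>count_space ?X)"
    by (rule nn_integral_cmult) simp
  also have "(\<integral>\<^sup>+z. ennreal (pmf J (h z)) \<partial>count_space ?X) = (\<integral>\<^sup>+z. ennreal (pmf J z) \<partial>count_space (h ` ?X))"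
    using h by (subst nn_integral_bij_count_space[of h ?X "h ` ?X", symmetric]) (auto simp: bij_betw_def)
  also have "\<dots> = emeasure J (h ` ?X)" by (rule nn_integral_pmf)
  also have "\<dots> \<le> emeasure J (g -` {r})"
    using g by (intro emeasure_mono) auto
  also have "\<dots> = ennreal ?c" by (simp add: pmf_map measure_pmf.emeasure_eq_measure)
  also have "ennreal (1 / ?c) * ennreal ?c \<le> 1" by (simp add: ennreal_mult'[symmetric])
  finally show ?thesis by (simp add: mult_left_mono)
qed

lemma pmf_seq_law_of_large_numbers:
  fixes J :: "'a pmf" and \<phi> :: "'a \<Rightarrow> real"
  assumes fin: "finite (set_pmf J)" and \<eta>: "0 < \<eta>"
  shows "(\<lambda>n. measure_pmf.prob (Pi_pmf {..<n} undefined (\<lambda>_. J)) {g. (\<Sum>t<n. \<phi> (g t)) \<le> real n * (avg J \<phi> - \<eta>)}) \<longlonglongrightarrow> 0"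
proof -
  \<comment> \<open>Inserting 1 keeps \<open>B\<close> positive even if \<open>\<phi>\<close>
    vanishes on the support; Hoeffding's bound divides by it.\<close>
  define B where "B = Max (insert 1 ((\<lambda>a. \<bar>\<phi> a\<bar>) ` set_pmf J))"
  have B1: "1 \<le> B" and B: "\<bar>\<phi> a\<bar> \<le> B" if "a \<in> set_pmf J" for a
    using fin that by (auto simp: B_def)
  have B1: "1 \<le> B" using fin by (auto simp: B_def)
  have bound: "measure_pmf.prob (Pi_pmf {..<n} undefined (\<lambda>_. J)) {g. (\<Sum>t<n. \<phi> (g t)) \<le> real n * (avg J \<phi> - \<eta>)}
     \<le> exp (- (\<eta>\<^sup>2 / (2 * B\<^sup>2)) * real n)" if n: "0 < n" for n
  proof -
    let ?M = "Pi_pmf {..<n} undefined (\<lambda>_. J)"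
    interpret Hoeffding_ineq "measure_pmf ?M" "{..<n}" "\<lambda>t g. \<phi> (g t)" "\<lambda>_. - B" "\<lambda>_. B"
      "\<Sum>t<n. measure_pmf.expectation ?M (\<lambda>g. \<phi> (g t))"
    proof unfold_locales
      show "prob_space.indep_vars (measure_pmf ?M) (\<lambda>_. borel) (\<lambda>t g. \<phi> (g t)) {..<n}"
        by (rule prob_space.indep_vars_compose2[OF measure_pmf.prob_space_axioms indep_vars_Pi_pmf]) auto
      show "AE g in measure_pmf ?M. \<phi> (g t) \<in> {- B..B}" if "t \<in> {..<n}" for t
      proof (rule AE_pmfI)
        fix g assume "g \<in> set_pmf ?M"
        then have "g t \<in> set_pmf J" using that by (auto simp: set_Pi_pmf PiE_dflt_def)
        from B[OF this] show "\<phi> (g t) \<in> {- B..B}" by auto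
      qed
    qed simp_all
    have "measure_pmf.expectation ?M (\<lambda>g. \<phi> (g t)) = avg J \<phi>" if "t < n" for t
    proof -
      have "measure_pmf.expectation ?M (\<lambda>g. \<phi> (g t)) = measure_pmf.expectation (map_pmf (\<lambda>g. g t) ?M) \<phi>" by simp
      also have "\<dots> = measure_pmf.expectation J \<phi>" using that by (subst Pi_pmf_component) auto
      also have "\<dots> = avg J \<phi>"
        using assms(1) by (subst integral_measure_pmf_real[where A = "set_pmf J"]) (auto simp: avg_def mult.commute)
      finally show ?thesis .
    qed
    then have mu: "(\<Sum>t<n. measure_pmf.expectation ?M (\<lambda>g. \<phi> (g t))) = real n * avg J \<phi>" by simp
    have "measure_pmf.prob ?M {g \<in> space ?M. (\<Sum>t<n. \<phi> (g t)) \<le> (\<Sum>t<n. measure_pmf.expectation ?M (\<lambda>g. \<phi> (g t))) - real n * \<eta>}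
      \<le> exp (- 2 * (real n * \<eta>)\<^sup>2 / (\<Sum>t<n. (B - - B)\<^sup>2))"
      using \<eta> n B1 by (intro Hoeffding_ineq_le) auto
    also have "- 2 * (real n * \<eta>)\<^sup>2 / (\<Sum>t<n. (B - - B)\<^sup>2) = - (\<eta>\<^sup>2 / (2 * B\<^sup>2)) * real n"
      using n B1 by (simp add: power2_eq_square field_simps)
    finally show ?thesis unfolding mu by (simp add: algebra_simps)
  qed
  have "(\<lambda>n. exp (- (\<eta>\<^sup>2 / (2 * B\<^sup>2)) * real n)) \<longlonglongrightarrow> 0"
  proof -
    have "\<eta>\<^sup>2 / (2 * B\<^sup>2) > 0" using \<eta> B1 by simp
    then have "filterlim (\<lambda>n. (\<eta>\<^sup>2 / (2 * B\<^sup>2)) * real n) at_top sequentially"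
      by (intro filterlim_tendsto_pos_mult_at_top[OF tendsto_const _ filterlim_real_sequentially])
    then have "filterlim (\<lambda>n. - ((\<eta>\<^sup>2 / (2 * B\<^sup>2)) * real n)) at_bot sequentially"
      by (simp add: filterlim_uminus_at_top)
    from filterlim_compose[OF exp_at_bot this] show ?thesis by simp
  qed
  note lim = this
  have ev: "\<forall>\<^sub>F n in sequentially. measure_pmf.prob (Pi_pmf {..<n} undefined (\<lambda>_. J))
      {g. (\<Sum>t<n. \<phi> (g t)) \<le> real n * (avg J \<phi> - \<eta>)} \<le> exp (- (\<eta>\<^sup>2 / (2 * B\<^sup>2)) * real n)"
    using eventually_gt_at_top[of 0] by eventually_elim (rule bound)
  show ?thesis by (rule tendsto_sandwich[OF _ ev tendsto_const lim]) simp
qed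

lemma pmf_seq_prod_threshold:
  fixes J :: "'a pmf" and \<rho> :: "'a \<Rightarrow> real"
  assumes fin: "finite (set_pmf J)" and \<eta>: "0 < \<eta>" and pos: "\<And>a. a \<in> set_pmf J \<Longrightarrow> 0 < \<rho> a"
    and m: "avg J (\<lambda>a. log 2 (\<rho> a)) = m"
  shows "(\<lambda>n. measure_pmf.prob (Pi_pmf {..<n} undefined (\<lambda>_. J)) {g. (\<Prod>t<n. \<rho> (g t)) < 2 powr (real n * (m - \<eta>))}) \<longlonglongrightarrow> 0"
proof -
  let ?M = "\<lambda>n. Pi_pmf {..<n} undefined (\<lambda>_. J)"
  have "measure_pmf.prob (?M n) {g. (\<Prod>t<n. \<rho> (g t)) < 2 powr (real n * (m - \<eta>))}
     \<le> measure_pmf.prob (?M n) {g. (\<Sum>t<n. log 2 (\<rho> (g t))) \<le> real n * (m - \<eta>)}" for n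
  proof (rule measure_pmf.finite_measure_mono_AE[OF AE_pmfI])
    fix g assume g: "g \<in> set_pmf (?M n)"
    have pos': "\<rho> (g t) > 0" if "t < n" for t
      using g that by (intro pos) (auto simp: set_Pi_pmf PiE_dflt_def)
    then have "(\<Prod>t<n. \<rho> (g t)) = 2 powr (\<Sum>t<n. log 2 (\<rho> (g t)))"
      by (simp add: powr_sum)
    then show "g \<in> {g. (\<Prod>t<n. \<rho> (g t)) < 2 powr (real n * (m - \<eta>))}
      \<longrightarrow> g \<in> {g. (\<Sum>t<n. log 2 (\<rho> (g t))) \<le> real n * (m - \<eta>)}" by simp
  qed simp
  then show ?thesis
    by (intro tendsto_sandwich[OF _ _ tendsto_const pmf_seq_law_of_large_numbers[OF fin \<eta>, of "\<lambda>a. log 2 (\<rho> a)", unfolded m]])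
       (auto intro!: always_eventually)
qed

text \<open>The product of the \<open>\<rho>\<close> is the likelihood ratio of the two product
  laws, and the event caps it by \<open>c\<close>.\<close>

lemma Pi_pmf_change_of_measure:
  assumes \<rho>: "\<And>z. pmf J z = \<rho> z * pmf C z" "\<And>z. 0 \<le> \<rho> z" and fin: "finite T"
  shows "emeasure (Pi_pmf T undefined (\<lambda>_. J)) {g. g \<in> A \<and> (\<Prod>t\<in>T. \<rho> (g t)) \<le> c}
      \<le> ennreal c * emeasure (Pi_pmf T undefined (\<lambda>_. C)) A"
proof -
  let ?J = "Pi_pmf T undefined (\<lambda>_. J)" and ?C = "Pi_pmf T undefined (\<lambda>_. C)"
  let ?A = "{g. g \<in> A \<and> (\<Prod>t\<in>T. \<rho> (g t)) \<le> c}"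
  have p: "pmf ?J g = (\<Prod>t\<in>T. \<rho> (g t)) * pmf ?C g" for g
    using fin by (auto simp: pmf_Pi \<rho>(1) prod.distrib)
  have "emeasure ?J ?A = (\<integral>\<^sup>+g. ennreal (pmf ?J g) \<partial>count_space ?A)" by (rule nn_integral_pmf[symmetric])
  also have "\<dots> \<le> (\<integral>\<^sup>+g. ennreal c * ennreal (pmf ?C g) \<partial>count_space ?A)"
  proof (intro nn_integral_mono)
    fix g assume "g \<in> space (count_space ?A)"
    then have "(\<Prod>t\<in>T. \<rho> (g t)) \<le> c" by simp
    moreover have "0 \<le> (\<Prod>t\<in>T. \<rho> (g t))" using \<rho>(2) by (intro prod_nonneg) auto
    ultimately show "ennreal (pmf ?J g) \<le> ennreal c * ennreal (pmf ?C g)"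
      unfolding p by (auto simp: ennreal_mult'[symmetric] intro!: ennreal_leI mult_right_mono)
  qed
  also have "\<dots> = ennreal c * emeasure ?C ?A" by (simp add: nn_integral_cmult nn_integral_pmf)
  also have "\<dots> \<le> ennreal c * emeasure ?C A" by (intro mult_left_mono emeasure_mono) auto
  finally show ?thesis .
qed

subsection \<open>Single-letter densities\<close>

lemma pmf_bind_Pair: "pmf (bind_pmf A (\<lambda>a. map_pmf (Pair a) (B a))) (a, b) = pmf A a * pmf (B a) b"
proof -
  have "pmf (map_pmf (Pair c) (B c)) (a, b) = pmf (B a) b * indicator {a} c" for c
  proof (cases "c = a")
    case True
    have "inj (Pair a :: 'b \<Rightarrow> _)" by (auto intro: injI)
    from pmf_map_inj'[OF this, of "B a" b] show ?thesis using True by simp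
  next
    case False
    then show ?thesis by (auto intro!: pmf_map_outside)
  qed
  then have "pmf (bind_pmf A (\<lambda>a. map_pmf (Pair a) (B a))) (a, b) = measure_pmf.expectation A (\<lambda>c. pmf (B a) b * indicator {a} c)"
    by (simp add: pmf_bind)
  also have "\<dots> = pmf A a * pmf (B a) b" by (simp add: measure_pmf_single)
  finally show ?thesis .
qed

lemma avg_map_pmf: "finite (set_pmf P) \<Longrightarrow> avg (map_pmf f P) \<phi> = avg P (\<lambda>\<omega>. \<phi> (f \<omega>))"
  using sum_map_pmf[of P f \<phi>] by (simp add: avg_def)

section \<open>Laws of the codeword letters and their density ratios\<close>

context single_letter
begin

text \<open>This is p(u_k | x_k, q). With it \<open>relay_law\<close> is p(x_k, u_k | q), and
  \<open>source_law\<close> is p(x_1 | x_2, ..., x_N, q).\<close>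

definition aux_law :: "nat \<Rightarrow> nat \<Rightarrow> 'x \<Rightarrow> nat pmf" where
  "aux_law q k x = cnd P (rvU k) (XQ k) (x, q)"

definition relay_law :: "nat \<Rightarrow> nat \<Rightarrow> ('x \<times> nat) pmf" where
  "relay_law q k = bind_pmf (cnd P (rvX k) rvQ q) (\<lambda>x. map_pmf (Pair x) (aux_law q k x))"

definition source_law :: "nat \<Rightarrow> (nat \<Rightarrow> 'x) \<Rightarrow> 'x pmf" where
  "source_law q x = cnd P (rvX 1) XsQ (x, q)"

definition xs :: "(nat \<Rightarrow> 'x \<times> nat) \<Rightarrow> nat \<Rightarrow> 'x" where
  "xs w = (\<lambda>k\<in>K. fst (w k))"

text \<open>The probability of generating the relay letters in \<open>S\<close> and the source
  letter afresh; it forms the denominators of \<open>\<rho>D\<close> and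
  \<open>\<rho>C\<close>.\<close>

definition weight :: "nat set \<Rightarrow> nat \<Rightarrow> 'x \<times> (nat \<Rightarrow> 'x \<times> nat) \<Rightarrow> real" where
  "weight S q r = (\<Prod>k\<in>S. pmf (relay_law q k) (snd r k)) * pmf (source_law q (xs (snd r))) (fst r)"

definition letter_of :: "('x, 'y) outcome \<Rightarrow> nat \<times> 'x \<times> (nat \<Rightarrow> 'x \<times> nat)" where
  "letter_of \<omega> = (rvQ \<omega>, rvX 1 \<omega>, aux K \<omega>)"

text \<open>The ratio p(u_k | x_k, y_k, q) / p(u_k | x_k, q), whose mean logarithm is
  \<open>relay_info k\<close>.\<close>

definition \<rho>R :: "nat \<Rightarrow> nat \<Rightarrow> 'x \<times> nat \<Rightarrow> 'y \<Rightarrow> real" where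
  "\<rho>R k q w y = pmf (map_pmf (UXYQ k) P) (snd w, fst w, y, q)
     / (pmf (map_pmf (XYQ k) P) (fst w, y, q) * pmf (aux_law q k (fst w)) (snd w))"

definition \<rho>D :: "nat \<Rightarrow> nat set \<Rightarrow> nat \<Rightarrow> 'x \<times> (nat \<Rightarrow> 'x \<times> nat) \<Rightarrow> 'y \<Rightarrow> real" where
  "\<rho>D d S q r y = pmf (map_pmf (allYQ d) P) (fst r, snd r, y, q)
     / (pmf (map_pmf (auxYQ (K - S) d) P) (restrict (snd r) (K - S), y, q) * weight S q r)"

definition \<rho>C :: "nat \<times> 'x \<times> (nat \<Rightarrow> 'x \<times> nat) \<Rightarrow> real" where
  "\<rho>C z = pmf (map_pmf letter_of P) z / (pmf (map_pmf rvQ P) (fst z) * weight K (fst z) (snd z))"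

definition code_law :: "nat \<Rightarrow> ('x \<times> (nat \<Rightarrow> 'x \<times> nat)) pmf" where
  "code_law q = bind_pmf (Pi_pmf K undefined (relay_law q)) (\<lambda>w. map_pmf (\<lambda>x. (x, w)) (source_law q (xs w)))"

lemma pmf_relay_law: "pmf (relay_law q k) (x, u) = pmf (cnd P (rvX k) rvQ q) x * pmf (aux_law q k x) u"
  by (simp add: relay_law_def pmf_bind_Pair)

lemma pmf_Q_relay_law: "pmf (map_pmf rvQ P) q * pmf (relay_law q k) (x, u)
    = pmf (map_pmf (UXQ k) P) (u, x, q)"
  unfolding pmf_relay_law aux_law_def
  by (simp add: pmf_cnd mult.assoc[symmetric])

lemma xs_aux: "xs (aux K \<omega>) = rvXs K \<omega>"
  by (auto simp: xs_def aux_def rvXs_def)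

lemma aux_apply: "k \<in> K \<Longrightarrow> aux K \<omega> k = (rvX k \<omega>, rvU k \<omega>)"
  by (simp add: aux_def)

lemma log2_factor:
  fixes a b c :: real
  assumes *: "a * b = c" "0 < a" "0 < c"
  shows "0 < b \<and> log 2 b = log 2 c - log 2 a"
proof
  from * show "0 < b" by (metis zero_less_mult_pos)
  with * show "log 2 b = log 2 c - log 2 a" by (auto simp: log_mult_pos)
qed

lemma aux_law_support:
  assumes "\<omega> \<in> set_pmf P"
  shows "0 < pmf (aux_law (rvQ \<omega>) k (rvX k \<omega>)) (rvU k \<omega>) \<and>
     log 2 (pmf (aux_law (rvQ \<omega>) k (rvX k \<omega>)) (rvU k \<omega>))
       = loglik P (UXQ k) \<omega> - loglik P (XQ k) \<omega>"
  unfolding loglik_def aux_law_def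
  by (rule log2_factor[OF pmf_cnd]) (use pmf_map_pos[OF assms] in auto)

lemma relay_law_support:
  assumes "\<omega> \<in> set_pmf P"
  shows "0 < pmf (relay_law (rvQ \<omega>) k) (rvX k \<omega>, rvU k \<omega>) \<and>
     log 2 (pmf (relay_law (rvQ \<omega>) k) (rvX k \<omega>, rvU k \<omega>))
       = loglik P (UXQ k) \<omega> - loglik P rvQ \<omega>"
  unfolding loglik_def
  by (rule log2_factor[OF pmf_Q_relay_law]) (use pmf_map_pos[OF assms] in auto)

lemma source_law_support:
  assumes "\<omega> \<in> set_pmf P"
  shows "0 < pmf (source_law (rvQ \<omega>) (rvXs K \<omega>)) (rvX 1 \<omega>) \<and>
     log 2 (pmf (source_law (rvQ \<omega>) (rvXs K \<omega>)) (rvX 1 \<omega>))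
       = loglik P XXsQ \<omega> - loglik P XsQ \<omega>"
  unfolding loglik_def source_law_def
  by (rule log2_factor[OF pmf_cnd]) (use pmf_map_pos[OF assms] in auto)

definition log_weight :: "nat set \<Rightarrow> ('x, 'y) outcome \<Rightarrow> real" where
  "log_weight S \<omega> = (\<Sum>k\<in>S. loglik P (UXQ k) \<omega> - loglik P rvQ \<omega>)
     + (loglik P XXsQ \<omega> - loglik P XsQ \<omega>)"

lemma weight_support:
  assumes w: "\<omega> \<in> set_pmf P" and S: "S \<subseteq> K"
  shows "0 < weight S (rvQ \<omega>) (rvX 1 \<omega>, aux K \<omega>) \<and> log 2 (weight S (rvQ \<omega>) (rvX 1 \<omega>, aux K \<omega>)) = log_weight S \<omega>"
proof -
  have fin: "finite S" using S by (rule finite_subset) simp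
  have e: "(\<Prod>k\<in>S. pmf (relay_law (rvQ \<omega>) k) (aux K \<omega> k)) = (\<Prod>k\<in>S. pmf (relay_law (rvQ \<omega>) k) (rvX k \<omega>, rvU k \<omega>))"
    using S by (intro prod.cong) (auto simp: aux_apply)
  have pos: "0 < (\<Prod>k\<in>S. pmf (relay_law (rvQ \<omega>) k) (rvX k \<omega>, rvU k \<omega>))"
    using relay_law_support[OF w] by (intro prod_pos) auto
  have "log 2 (\<Prod>k\<in>S. pmf (relay_law (rvQ \<omega>) k) (rvX k \<omega>, rvU k \<omega>))
      = (\<Sum>k\<in>S. log 2 (pmf (relay_law (rvQ \<omega>) k) (rvX k \<omega>, rvU k \<omega>)))"
  proof -
    have "ln (\<Prod>k\<in>S. pmf (relay_law (rvQ \<omega>) k) (rvX k \<omega>, rvU k \<omega>))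
        = (\<Sum>k\<in>S. ln (pmf (relay_law (rvQ \<omega>) k) (rvX k \<omega>, rvU k \<omega>)))"
      by (rule ln_prod) (use relay_law_support[OF w] fin in \<open>auto simp: less_imp_neq[THEN not_sym]\<close>)
    then show ?thesis by (simp add: log_def sum_divide_distrib)
  qed
  then show ?thesis
    using pos source_law_support[OF w] relay_law_support[OF w]
    by (simp add: weight_def e xs_aux log_mult_pos log_weight_def del: One_nat_def)
qed

lemma avg_log_weight: "avg P (log_weight S) = - code_ent S"
  unfolding log_weight_def[abs_def] avg_add avg_sum avg_diff avg_loglik code_ent_def
  by (simp add: sum_subtractf sum_negf)

lemma \<rho>R_support:
  assumes w: "\<omega> \<in> set_pmf P" and k: "k \<in> K"
  shows "0 < \<rho>R k (rvQ \<omega>) (aux K \<omega> k) (rvY k \<omega>) \<and> log 2 (\<rho>R k (rvQ \<omega>) (aux K \<omega> k) (rvY k \<omega>))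
     = loglik P (UXYQ k) \<omega> - (loglik P (XYQ k) \<omega>
       + (loglik P (UXQ k) \<omega> - loglik P (XQ k) \<omega>))"
proof -
  note pos = pmf_map_pos[OF w, of "UXYQ k"]
     pmf_map_pos[OF w, of "XYQ k"] aux_law_support[OF w, of k]
  then show ?thesis
    unfolding \<rho>R_def aux_apply[OF k] fst_conv snd_conv
    by (subst log_divide_pos) (auto simp: log_mult_pos loglik_def)
qed

lemma avg_\<rho>R: "k \<in> K \<Longrightarrow> avg P (\<lambda>\<omega>. log 2 (\<rho>R k (rvQ \<omega>) (aux K \<omega> k) (rvY k \<omega>))) = relay_info k"
  using \<rho>R_support by (subst avg_cong) (auto simp: avg_add avg_diff avg_loglik relay_info_def)

lemma \<rho>D_support:
  assumes w: "\<omega> \<in> set_pmf P" and S: "S \<subseteq> K"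
  shows "0 < \<rho>D d S (rvQ \<omega>) (rvX 1 \<omega>, aux K \<omega>) (rvY d \<omega>) \<and> log 2 (\<rho>D d S (rvQ \<omega>) (rvX 1 \<omega>, aux K \<omega>) (rvY d \<omega>))
     = loglik P (allYQ d) \<omega>
       - (loglik P (auxYQ (K - S) d) \<omega> + log_weight S \<omega>)"
proof -
  have r: "restrict (aux K \<omega>) (K - S) = aux (K - S) \<omega>" by (auto simp: aux_def restrict_def fun_eq_iff)
  note pos = pmf_map_pos[OF w, of "allYQ d"]
     pmf_map_pos[OF w, of "auxYQ (K - S) d"] weight_support[OF w S]
  then show ?thesis
    unfolding \<rho>D_def fst_conv snd_conv r
    by (subst log_divide_pos) (auto simp: log_mult_pos loglik_def)
qed

lemma avg_\<rho>D: "S \<subseteq> K \<Longrightarrow> avg P (\<lambda>\<omega>. log 2 (\<rho>D d S (rvQ \<omega>) (rvX 1 \<omega>, aux K \<omega>) (rvY d \<omega>))) = dest_info d S"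
  using \<rho>D_support[of _ S d] by (subst avg_cong) (auto simp: avg_add avg_diff avg_loglik avg_log_weight dest_info_def)

lemma \<rho>C_support:
  assumes w: "\<omega> \<in> set_pmf P"
  shows "0 < \<rho>C (letter_of \<omega>) \<and> log 2 (\<rho>C (letter_of \<omega>)) = loglik P letter_of \<omega> - (loglik P rvQ \<omega> + log_weight K \<omega>)"
proof -
  note pos = pmf_map_pos[OF w, of letter_of] pmf_map_pos[OF w, of rvQ] weight_support[OF w subset_refl]
  have "fst (letter_of \<omega>) = rvQ \<omega>" "snd (letter_of \<omega>) = (rvX 1 \<omega>, aux K \<omega>)" by (auto simp: letter_of_def)
  then show ?thesis using pos
    unfolding \<rho>C_def by (subst log_divide_pos) (auto simp: log_mult_pos loglik_def)
qed

lemma avg_\<rho>C: "avg P (\<lambda>\<omega>. log 2 (\<rho>C (letter_of \<omega>))) = code_div"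
proof -
  have "ent P letter_of = ent P allQ"
    by (rule ent_cong) (auto simp: letter_of_def)
  then show ?thesis
    using \<rho>C_support by (subst avg_cong) (auto simp: avg_add avg_diff avg_loglik avg_log_weight code_div_def)
qed

lemma nn_integral_\<rho>R: "(\<integral>\<^sup>+u. ennreal (\<rho>R k q (x, u) y) \<partial>aux_law q k x) \<le> 1"
proof -
  let ?J = "map_pmf (UXYQ k) P"
  have "map_pmf snd ?J = map_pmf (XYQ k) P" by (simp add: pmf.map_comp o_def)
  then show ?thesis
    using nn_integral_density_le_1[of "\<lambda>u. (u, x, y, q)" "aux_law q k x" snd "(x, y, q)" ?J]
    by (simp add: \<rho>R_def inj_on_def)
qed

lemma nn_integral_\<rho>D:
  fixes w0 :: "nat \<Rightarrow> 'x \<times> nat"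
  assumes S: "S \<subseteq> K"
  defines "ov \<equiv> \<lambda>w. \<lambda>k\<in>K. if k \<in> S then w k else w0 k"
  shows "(\<integral>\<^sup>+w. \<integral>\<^sup>+x. ennreal (\<rho>D d S q (x, ov w) y) \<partial>source_law q (xs (ov w)) \<partial>Pi_pmf S undefined (relay_law q)) \<le> 1"
proof -
  have fin: "finite S" using S by (rule finite_subset) simp
  let ?R = "bind_pmf (Pi_pmf S undefined (relay_law q)) (\<lambda>w. map_pmf (Pair w) (source_law q (xs (ov w))))"
  let ?J = "map_pmf (allYQ d) P"
  let ?g = "\<lambda>(x :: 'x, w :: nat \<Rightarrow> 'x \<times> nat, y :: 'y, q :: nat). (restrict w (K - S), y, q)"
  let ?h = "\<lambda>(w, x). (x, ov w, y, q)"
  let ?r = "(restrict w0 (K - S), y, q)"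
  have ext: "w \<in> extensional S" if "w \<in> set_pmf (Pi_pmf S undefined (relay_law q))" for w
    using set_Pi_pmf_subset[OF fin, of undefined "relay_law q"] that by (auto simp: extensional_def)
  have rov: "restrict (ov w) (K - S) = restrict w0 (K - S)" for w
    by (auto simp: ov_def restrict_def fun_eq_iff)
  have mg: "map_pmf ?g ?J = map_pmf (auxYQ (K - S) d) P"
    by (auto simp: pmf.map_comp o_def aux_def restrict_def fun_eq_iff intro!: map_pmf_cong)
  have inj: "inj_on ?h (set_pmf ?R)"
  proof (rule inj_onI)
    fix a b assume a: "a \<in> set_pmf ?R" and b: "b \<in> set_pmf ?R" and e: "?h a = ?h b"
    obtain w x w' x' where ab: "a = (w, x)" "b = (w', x')" by (cases a, cases b) auto
    have "w \<in> extensional S" "w' \<in> extensional S" using a b ab ext by auto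
    moreover have "w k = w' k" if "k \<in> S" for k
    proof -
      have "ov w = ov w'" using e ab by simp
      from fun_cong[OF this, of k] show ?thesis using that S by (auto simp: ov_def split: if_splits)
    qed
    ultimately have "w = w'" by (intro extensionalityI)
    then show "a = b" using e ab by simp
  qed
  have "(\<integral>\<^sup>+w. \<integral>\<^sup>+x. ennreal (\<rho>D d S q (x, ov w) y) \<partial>source_law q (xs (ov w)) \<partial>Pi_pmf S undefined (relay_law q))
      = (\<integral>\<^sup>+z. ennreal (\<rho>D d S q (snd z, ov (fst z)) y) \<partial>?R)"
    by simp
  also have "\<dots> = (\<integral>\<^sup>+z. ennreal (pmf ?J (?h z) / (pmf (map_pmf ?g ?J) ?r * pmf ?R z)) \<partial>?R)"
  proof (intro nn_integral_cong_AE AE_pmfI)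
    fix z assume z: "z \<in> set_pmf ?R"
    obtain w x where zw: "z = (w, x)" by (cases z)
    have "w \<in> extensional S" using z zw ext by auto
    then have "pmf (Pi_pmf S undefined (relay_law q)) w = (\<Prod>k\<in>S. pmf (relay_law q k) (w k))"
      using fin by (intro pmf_Pi') (auto simp: extensional_def)
    also have "\<dots> = (\<Prod>k\<in>S. pmf (relay_law q k) (ov w k))"
      using S by (intro prod.cong) (auto simp: ov_def)
    finally have "pmf ?R z = weight S q (x, ov w)"
      by (simp add: zw pmf_bind_Pair weight_def)
    then show "ennreal (\<rho>D d S q (snd z, ov (fst z)) y) = ennreal (pmf ?J (?h z) / (pmf (map_pmf ?g ?J) ?r * pmf ?R z))"
      unfolding mg by (simp add: \<rho>D_def zw rov)
  qed
  also have "\<dots> \<le> 1"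
    by (rule nn_integral_density_le_1[OF inj]) (auto simp: rov)
  finally show ?thesis .
qed

text \<open>The reference law for the change of measure: a letter with q from the joint law and
  everything else generated by the codebooks.\<close>

definition code_joint :: "(nat \<times> 'x \<times> (nat \<Rightarrow> 'x \<times> nat)) pmf" where
  "code_joint = bind_pmf (map_pmf rvQ P) (\<lambda>q. map_pmf (Pair q) (code_law q))"

lemma pmf_code_joint: 
  assumes "w \<in> extensional K"
  shows "pmf code_joint (q, x, w) = pmf (map_pmf rvQ P) q * weight K q (x, w)"
proof -
  let ?B = "bind_pmf (Pi_pmf K undefined (relay_law q)) (\<lambda>w. map_pmf (Pair w) (source_law q (xs w)))"
  have "code_law q = map_pmf (\<lambda>(w, x). (x, w)) ?B"
    by (simp add: code_law_def map_bind_pmf pmf.map_comp o_def)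
  moreover have "inj (\<lambda>(w :: nat \<Rightarrow> 'x \<times> nat, x :: 'x). (x, w))" by (auto intro: injI)
  ultimately have "pmf (code_law q) (x, w) = pmf ?B (w, x)"
    using pmf_map_inj'[of "\<lambda>(w, x). (x, w)" ?B "(w, x)"] by simp
  also have "\<dots> = weight K q (x, w)"
    using assms by (subst pmf_bind_Pair) (auto simp: weight_def extensional_def intro!: pmf_Pi')
  finally show ?thesis by (simp add: code_joint_def pmf_bind_Pair)
qed

text \<open>On the support the weight is positive, so the division in \<open>\<rho>C\<close>
  cancels; off the support both sides vanish with the numerator of \<open>\<rho>C\<close>.\<close>

lemma pmf_letter_of: "pmf (map_pmf letter_of P) z = \<rho>C z * pmf code_joint z"
proof (cases "z \<in> set_pmf (map_pmf letter_of P)")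
  case True
  then obtain \<omega> where w: "\<omega> \<in> set_pmf P" "z = letter_of \<omega>" by auto
  have "aux K \<omega> \<in> extensional K" by (simp add: aux_def)
  then have "pmf code_joint z = pmf (map_pmf rvQ P) (fst z) * weight K (fst z) (snd z)"
    using w by (simp add: letter_of_def pmf_code_joint)
  moreover have "\<dots> > 0"
    using pmf_map_pos[OF w(1), of rvQ] weight_support[OF w(1) subset_refl] w(2) by (simp add: letter_of_def)
  ultimately show ?thesis
    by (cases "weight K (fst z) (snd z) = 0"; cases "pmf (map_pmf rvQ P) (fst z) = 0") (simp_all add: \<rho>C_def)
next
  case False
  then have "pmf (map_pmf letter_of P) z = 0" by (simp add: set_pmf_iff del: set_map_pmf)
  then show ?thesis by (simp add: \<rho>C_def)
qed

definition input_of :: "'x \<times> (nat \<Rightarrow> 'x \<times> nat) \<Rightarrow> nat \<Rightarrow> 'x" where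
  "input_of r = (\<lambda>k\<in>{1..N}. if k = 1 then fst r else fst (snd r k))"

definition output_of :: "('x, 'y) outcome \<Rightarrow> nat \<Rightarrow> 'y" where
  "output_of = (\<lambda>(x, u, q, y). y)"

lemma rvY_output: "rvY d \<omega> = output_of \<omega> d"
  by (cases \<omega>) (simp add: rvY_def output_of_def)

text \<open>The channel depends on the inputs alone, and the input vector can be read back from the
  letter.\<close>

lemma letter_output_law:
  "map_pmf (\<lambda>\<omega>. (letter_of \<omega>, output_of \<omega>)) P
     = bind_pmf (map_pmf letter_of P) (\<lambda>z. map_pmf (Pair z) (chan G (input_of (snd z))))"
proof -
  define l where "l = (\<lambda>(x, u, q). (q, x 1, \<lambda>k\<in>K. (x k, u k)) :: nat \<times> 'x \<times> (nat \<Rightarrow> 'x \<times> nat))"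
  have l: "letter_of (x, u, q, y) = l (x, u, q)" for x u q y
    by (simp add: letter_of_def l_def rvQ_def rvX_def rvU_def aux_def)
  have m: "map_pmf letter_of P = map_pmf l p"
    unfolding P_def joint_pmf_def map_bind_pmf
    by (simp add: case_prod_unfold map_pmf_def bind_assoc_pmf bind_return_pmf l)
  have "map_pmf (\<lambda>\<omega>. (letter_of \<omega>, output_of \<omega>)) P = bind_pmf p (\<lambda>i. map_pmf (Pair (l i)) (chan G (fst i)))"
    unfolding P_def joint_pmf_def map_bind_pmf
    by (simp add: case_prod_unfold l pmf.map_comp o_def output_of_def)
  also have "\<dots> = bind_pmf p (\<lambda>i. map_pmf (Pair (l i)) (chan G (input_of (snd (l i)))))"
  proof (intro bind_pmf_cong refl)
    fix i assume i: "i \<in> set_pmf p"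
    obtain x u q where i': "i = (x, u, q)" by (cases i)
    then have x: "x \<in> extensional {1..N}" using set_p i by (auto simp: PiE_def)
    have "input_of (snd (l i)) = x"
      using x by (auto simp: input_of_def l_def i' K_def restrict_def extensional_def fun_eq_iff)
    then show "map_pmf (Pair (l i)) (chan G (fst i)) = map_pmf (Pair (l i)) (chan G (input_of (snd (l i))))"
      by (simp add: i')
  qed
  finally show ?thesis unfolding m by (simp add: bind_map_pmf)
qed

end

section \<open>Threshold tests, typical inputs and the time-sharing sequence\<close>

context single_letter
begin

text \<open>The exponent lies \<open>\<delta>\<close> below the mean log-ratio: the true word passes
  by the law of large numbers, a fresh one with probability at most the reciprocal of the
  threshold.\<close>

definition relay_ok where
  "relay_ok \<delta> n q k w y \<longleftrightarrow>
     2 powr (real n * (relay_info k - \<delta>)) \<le> (\<Prod>t<n. \<rho>R k (q t) (fst w t, snd w t) (y t k))"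

text \<open>One threshold for each set of possibly wrong relays; against a wrong state only the
  threshold for its own set is used.\<close>

definition dest_ok where
  "dest_ok \<delta> n q d r y \<longleftrightarrow>
     (\<forall>S\<in>Pow (K - {d}). 2 powr (real n * (dest_info d S - \<delta>)) \<le> (\<Prod>t<n. \<rho>D d S (q t) (r t) (y t d)))"

definition good_out where
  "good_out \<delta> n q r y \<longleftrightarrow>
     (\<forall>k\<in>K. 2 powr (real n * (relay_info k - \<delta>)) \<le> (\<Prod>t<n. \<rho>R k (q t) (snd (r t) k) (y t k))) \<and>
     (\<forall>d\<in>D. dest_ok \<delta> n q d r y)"

lemma dest_ok_cong:
  assumes "\<And>t. t < n \<Longrightarrow> q t = q' t" "\<And>t. t < n \<Longrightarrow> r t = r' t" "\<And>t. t < n \<Longrightarrow> y t d = y' t d"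
  shows "dest_ok \<delta> n q d r y = dest_ok \<delta> n q' d r' y'"
proof -
  have "(\<Prod>t<n. \<rho>D d S (q t) (r t) (y t d)) = (\<Prod>t<n. \<rho>D d S (q' t) (r' t) (y' t d))" for S
    using assms by (intro prod.cong) auto
  then show ?thesis by (simp add: dest_ok_def)
qed

lemma good_out_cong:
  assumes "\<And>t. t < n \<Longrightarrow> q t = q' t" "\<And>t. t < n \<Longrightarrow> r t = r' t" "\<And>t. t < n \<Longrightarrow> y t = y' t"
  shows "good_out \<delta> n q r y = good_out \<delta> n q' r' y'"
proof -
  have "(\<Prod>t<n. \<rho>R k (q t) (snd (r t) k) (y t k)) = (\<Prod>t<n. \<rho>R k (q' t) (snd (r' t) k) (y' t k))" for k
    using assms by (intro prod.cong) auto
  moreover have "dest_ok \<delta> n q d r y = dest_ok \<delta> n q' d r' y'" for d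
    using assms by (intro dest_ok_cong) auto
  ultimately show ?thesis by (simp add: good_out_def)
qed

abbreviation "J \<equiv> map_pmf (\<lambda>\<omega>. (letter_of \<omega>, output_of \<omega>)) P"

lemma finite_D: "finite D" using D_sub by (rule finite_subset) simp

lemma bad_out_tendsto_0:
  assumes \<delta>: "0 < \<delta>"
  shows "(\<lambda>n. measure_pmf.prob (Pi_pmf {..<n} undefined (\<lambda>_. J))
     {g. \<not> good_out \<delta> n (\<lambda>t. fst (fst (g t))) (\<lambda>t. snd (fst (g t))) (\<lambda>t. snd (g t))}) \<longlonglongrightarrow> 0"
proof -
  let ?M = "\<lambda>n. measure_pmf.prob (Pi_pmf {..<n} undefined (\<lambda>_. J))"
  let ?r = "\<lambda>k z. \<rho>R k (fst (fst z)) (snd (snd (fst z)) k) (snd z k)"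
  let ?d = "\<lambda>d S z. \<rho>D d S (fst (fst z)) (snd (fst z)) (snd z d)"
  let ?A = "\<lambda>n k. {g. (\<Prod>t<n. ?r k (g t)) < 2 powr (real n * (relay_info k - \<delta>))}"
  let ?B = "\<lambda>n d S. {g. (\<Prod>t<n. ?d d S (g t)) < 2 powr (real n * (dest_info d S - \<delta>))}"
  have fJ: "finite (set_pmf J)" using finite_set_P by simp
  have A: "(\<lambda>n. ?M n (?A n k)) \<longlonglongrightarrow> 0" if k: "k \<in> K" for k
  proof (rule pmf_seq_prod_threshold[OF fJ \<delta>])
    show "avg J (\<lambda>a. log 2 (?r k a)) = relay_info k"
      unfolding avg_map_pmf[OF finite_set_P] avg_\<rho>R[OF k, symmetric] by (simp add: letter_of_def rvY_output)
    show "0 < ?r k a" if "a \<in> set_pmf J" for a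
      using that \<rho>R_support[OF _ k] by (auto simp: letter_of_def rvY_output)
  qed
  have B: "(\<lambda>n. ?M n (?B n d S)) \<longlonglongrightarrow> 0" if S: "S \<subseteq> K" for d S
  proof (rule pmf_seq_prod_threshold[OF fJ \<delta>])
    show "avg J (\<lambda>a. log 2 (?d d S a)) = dest_info d S"
      unfolding avg_map_pmf[OF finite_set_P] avg_\<rho>D[OF S, symmetric] by (simp add: letter_of_def rvY_output)
    show "0 < ?d d S a" if "a \<in> set_pmf J" for a
      using that \<rho>D_support[OF _ S] by (auto simp: letter_of_def rvY_output)
  qed
  let ?bad = "\<lambda>n. {g. \<not> good_out \<delta> n (\<lambda>t. fst (fst (g t))) (\<lambda>t. snd (fst (g t))) (\<lambda>t. snd (g t))}"
  let ?A1 = "\<lambda>n. \<Union>k\<in>K. ?A n k" and ?B1 = "\<lambda>n. \<Union>d\<in>D. \<Union>S\<in>Pow (K - {d}). ?B n d S"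
  let ?U = "\<lambda>n. (\<Sum>k\<in>K. ?M n (?A n k)) + (\<Sum>d\<in>D. \<Sum>S\<in>Pow (K - {d}). ?M n (?B n d S))"
  have lim: "?U \<longlonglongrightarrow> (\<Sum>k\<in>K. 0) + (\<Sum>d\<in>D. \<Sum>S\<in>Pow (K - {d}). 0)"
    by (intro tendsto_add tendsto_sum A B) auto
  have le: "?M n (?bad n) \<le> ?U n" for n
  proof -
    have "?bad n
       \<subseteq> ?A1 n \<union> ?B1 n"
      by (fastforce simp: good_out_def dest_ok_def not_le)
    then have "?M n (?bad n)
       \<le> ?M n (?A1 n \<union> ?B1 n)"
      by (intro measure_pmf.finite_measure_mono) auto
    also have "\<dots> \<le> ?M n (?A1 n) + ?M n (?B1 n)"
      by (intro measure_Un_le) auto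
    also have "\<dots> \<le> ?U n"
    proof (intro add_mono)
      show "?M n (?A1 n) \<le> (\<Sum>k\<in>K. ?M n (?A n k))"
        by (intro measure_UNION_le) auto
      have "?M n (?B1 n) \<le> (\<Sum>d\<in>D. ?M n (\<Union>S\<in>Pow (K - {d}). ?B n d S))"
        using finite_D by (intro measure_UNION_le) auto
      also have "\<dots> \<le> (\<Sum>d\<in>D. \<Sum>S\<in>Pow (K - {d}). ?M n (?B n d S))"
        by (intro sum_mono measure_UNION_le) auto
      finally show "?M n (?B1 n) \<le> (\<Sum>d\<in>D. \<Sum>S\<in>Pow (K - {d}). ?M n (?B n d S))" .
    qed
    finally show ?thesis .
  qed
  show ?thesis
    by (rule tendsto_sandwich[OF _ always_eventually tendsto_const lim[simplified]]) (use le in simp_all)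
qed

text \<open>An upper tail, reduced to the lower-tail lemma by passing to reciprocals.\<close>

lemma weight_overshoot_tendsto_0:
  assumes \<delta>: "0 < \<delta>"
  shows "(\<lambda>n. measure_pmf.prob (Pi_pmf {..<n} undefined (\<lambda>_. map_pmf letter_of P))
     {z. 2 powr (real n * (code_div + \<delta>)) < (\<Prod>t<n. \<rho>C (z t))}) \<longlonglongrightarrow> 0"
proof -
  let ?M = "\<lambda>n. measure_pmf.prob (Pi_pmf {..<n} undefined (\<lambda>_. map_pmf letter_of P))"
  have "(\<lambda>n. ?M n {z. (\<Prod>t<n. inverse (\<rho>C (z t))) < 2 powr (real n * (- code_div - \<delta>))}) \<longlonglongrightarrow> 0"
  proof (rule pmf_seq_prod_threshold[OF _ \<delta>])
    show "avg (map_pmf letter_of P) (\<lambda>a. log 2 (inverse (\<rho>C a))) = - code_div"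
    proof -
      have "avg P (\<lambda>\<omega>. log 2 (inverse (\<rho>C (letter_of \<omega>)))) = avg P (\<lambda>\<omega>. 0 - log 2 (\<rho>C (letter_of \<omega>)))"
        using \<rho>C_support by (intro avg_cong) (simp add: log_inverse)
      also have "\<dots> = - code_div" unfolding avg_diff avg_\<rho>C by (simp add: avg_def)
      finally show ?thesis by (simp add: avg_map_pmf[OF finite_set_P])
    qed
  qed (use finite_set_P \<rho>C_support in auto)
  note lim = this
  have "{z. 2 powr (real n * (code_div + \<delta>)) < (\<Prod>t<n. \<rho>C (z t))}
      \<subseteq> {z. (\<Prod>t<n. inverse (\<rho>C (z t))) < 2 powr (real n * (- code_div - \<delta>))}" for n
  proof safe
    fix z assume *: "2 powr (real n * (code_div + \<delta>)) < (\<Prod>t<n. \<rho>C (z t))"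
    have "(\<Prod>t<n. inverse (\<rho>C (z t))) = inverse (\<Prod>t<n. \<rho>C (z t))" using prod_inversef[of "\<lambda>t. \<rho>C (z t)" "{..<n}"] by (simp add: o_def)
    also have "\<dots> < inverse (2 powr (real n * (code_div + \<delta>)))"
      using * by (intro less_imp_inverse_less) auto
    also have "\<dots> = 2 powr (real n * (- code_div - \<delta>))"
      unfolding powr_minus[symmetric] by (rule arg_cong[where f = "(powr) 2"]) (simp add: algebra_simps)
    finally show "(\<Prod>t<n. inverse (\<rho>C (z t))) < 2 powr (real n * (- code_div - \<delta>))" .
  qed
  then have le: "?M n {z. 2 powr (real n * (code_div + \<delta>)) < (\<Prod>t<n. \<rho>C (z t))}
      \<le> ?M n {z. (\<Prod>t<n. inverse (\<rho>C (z t))) < 2 powr (real n * (- code_div - \<delta>))}" for n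
    by (intro measure_pmf.finite_measure_mono) auto
  show ?thesis
    by (rule tendsto_sandwich[OF _ always_eventually tendsto_const lim]) (use le in simp_all)
qed

definition typical where
  "typical \<delta> \<epsilon> n q r \<longleftrightarrow>
     emeasure (Pi_pmf {..<n} undefined (\<lambda>t. chan G (input_of (r t)))) {y. \<not> good_out \<delta> n q r y} \<le> ennreal \<epsilon>"

lemma typical_cong:
  assumes "\<And>t. t < n \<Longrightarrow> q t = q' t" "\<And>t. t < n \<Longrightarrow> r t = r' t"
  shows "typical \<delta> \<epsilon> n q r = typical \<delta> \<epsilon> n q' r'"
proof -
  have "Pi_pmf {..<n} undefined (\<lambda>t. chan G (input_of (r t))) = Pi_pmf {..<n} undefined (\<lambda>t. chan G (input_of (r' t)))"
    using assms by (intro Pi_pmf_cong) auto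
  moreover have "good_out \<delta> n q r y = good_out \<delta> n q' r' y" for y
    using assms by (intro good_out_cong) auto
  ultimately show ?thesis by (simp add: typical_def)
qed

text \<open>Under the wanted law, atypical sequences have probability at most 1/4 (Markov's
  inequality on the mean \<open>\<epsilon> / 4\<close>), and so do those whose likelihood ratio
  exceeds \<open>c\<close>. The remaining half costs a factor \<open>c\<close> under the codebook
  law, so the mean over \<open>q\<close> is at least \<open>1 / (2 * c)\<close> and some
  \<open>q\<close> reaches \<open>1 / (4 * c)\<close>.\<close>

theorem exists_time_sharing_sequence:
  assumes \<delta>: "0 < \<delta>" and \<epsilon>: "0 < \<epsilon>"
  shows "\<forall>\<^sub>F n in sequentially. \<exists>q. ennreal (1 / 4 * 2 powr (- (real n * (code_div + \<delta>))))
     \<le> emeasure (Pi_pmf {..<n} undefined (\<lambda>t. code_law (q t))) {r. typical \<delta> \<epsilon> n q r}"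
proof -
  have "\<forall>\<^sub>F n in sequentially. measure_pmf.prob (Pi_pmf {..<n} undefined (\<lambda>_. J))
     {g. \<not> good_out \<delta> n (\<lambda>t. fst (fst (g t))) (\<lambda>t. snd (fst (g t))) (\<lambda>t. snd (g t))} < \<epsilon> / 4"
    using bad_out_tendsto_0[OF \<delta>] \<epsilon> by (intro order_tendstoD(2)) auto
  moreover have "\<forall>\<^sub>F n in sequentially. measure_pmf.prob (Pi_pmf {..<n} undefined (\<lambda>_. map_pmf letter_of P))
     {z. 2 powr (real n * (code_div + \<delta>)) < (\<Prod>t<n. \<rho>C (z t))} < 1 / 4"
    using weight_overshoot_tendsto_0[OF \<delta>] by (intro order_tendstoD(2)) auto
  ultimately show ?thesis
  proof eventually_elim
    case (elim n)
    let ?T = "{..<n}" and ?J0 = "map_pmf letter_of P"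
    let ?Jn = "Pi_pmf ?T undefined (\<lambda>_. ?J0)" and ?Cn = "Pi_pmf ?T undefined (\<lambda>_. code_joint)"
    let ?ch = "\<lambda>z. Pi_pmf ?T undefined (\<lambda>t. chan G (input_of (snd (z t))))"
    let ?bad = "\<lambda>z y. \<not> good_out \<delta> n (\<lambda>t. fst (z t)) (\<lambda>t. snd (z t)) y"
    let ?f = "\<lambda>z. emeasure (?ch z) {y. ?bad z y}"
    let ?Qn = "Pi_pmf ?T undefined (\<lambda>_. map_pmf rvQ P)"
    let ?m = "\<lambda>q. emeasure (Pi_pmf ?T undefined (\<lambda>t. code_law (q t))) {r. typical \<delta> \<epsilon> n q r}"
    define c where "c = 2 powr (real n * (code_div + \<delta>))"
    have c: "c > 0" by (simp add: c_def)
    have "(\<integral>\<^sup>+z. ?f z \<partial>?Jn) = emeasure (bind_pmf ?Jn (\<lambda>z. map_pmf (Pair z) (?ch z))) {(z, y). ?bad z y}"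
      by (simp add: vimage_def)
    also have "bind_pmf ?Jn (\<lambda>z. map_pmf (Pair z) (?ch z))
        = map_pmf (\<lambda>g. (\<lambda>t\<in>?T. fst (g t), \<lambda>t\<in>?T. snd (g t))) (Pi_pmf ?T undefined (\<lambda>_. J))"
      unfolding letter_output_law by (rule Pi_pmf_pair_bind[symmetric]) simp
    also have "emeasure \<dots> {(z, y). ?bad z y} = emeasure (Pi_pmf ?T undefined (\<lambda>_. J))
        {g. ?bad (\<lambda>t\<in>?T. fst (g t)) (\<lambda>t\<in>?T. snd (g t))}"
      by (simp add: vimage_def)
    also have "(\<lambda>g. ?bad (\<lambda>t\<in>?T. fst (g t)) (\<lambda>t\<in>?T. snd (g t))) = (\<lambda>g. ?bad (\<lambda>t. fst (g t)) (\<lambda>t. snd (g t)))"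
      by (intro ext arg_cong[where f = Not] good_out_cong) auto
    also have "emeasure (Pi_pmf ?T undefined (\<lambda>_. J)) {g. ?bad (\<lambda>t. fst (g t)) (\<lambda>t. snd (g t))} \<le> ennreal (\<epsilon> / 4)"
      using elim(1) by (simp add: measure_pmf.emeasure_eq_measure ennreal_leI)
    finally have f: "(\<integral>\<^sup>+z. ?f z \<partial>?Jn) \<le> ennreal (\<epsilon> / 4)" .
    have "ennreal \<epsilon> * emeasure ?Jn {z. ennreal \<epsilon> < ?f z} = (\<integral>\<^sup>+z. ennreal \<epsilon> * indicator {z. ennreal \<epsilon> < ?f z} z \<partial>?Jn)"
      by (simp add: nn_integral_cmult)
    also have "\<dots> \<le> (\<integral>\<^sup>+z. ?f z \<partial>?Jn)"
      by (intro nn_integral_mono) (auto simp: indicator_def less_imp_le)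
    finally have "ennreal (\<epsilon> * measure ?Jn {z. ennreal \<epsilon> < ?f z}) \<le> ennreal (\<epsilon> / 4)"
      using f \<epsilon> by (simp add: measure_pmf.emeasure_eq_measure ennreal_mult' order_trans)
    then have "\<epsilon> * measure ?Jn {z. ennreal \<epsilon> < ?f z} \<le> \<epsilon> * (1 / 4)"
      using \<epsilon> by (subst (asm) ennreal_le_iff) auto
    then have 1: "measure ?Jn {z. ennreal \<epsilon> < ?f z} \<le> 1 / 4" using \<epsilon> by simp
    define A where "A = {z. typical \<delta> \<epsilon> n (\<lambda>t. fst (z t)) (\<lambda>t. snd (z t))}"
    have A: "z \<in> A \<longleftrightarrow> ?f z \<le> ennreal \<epsilon>" for z by (simp add: A_def typical_def)
    have "1 = measure ?Jn ({z. z \<in> A \<and> (\<Prod>t\<in>?T. \<rho>C (z t)) \<le> c} \<union> {z. ennreal \<epsilon> < ?f z} \<union> {z. c < (\<Prod>t<n. \<rho>C (z t))})"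
    proof -
      have "{z. z \<in> A \<and> (\<Prod>t\<in>?T. \<rho>C (z t)) \<le> c} \<union> {z. ennreal \<epsilon> < ?f z} \<union> {z. c < (\<Prod>t<n. \<rho>C (z t))} = UNIV"
        by (auto simp: A not_less[symmetric])
      then show ?thesis by simp
    qed
    also have "\<dots> \<le> measure ?Jn {z. z \<in> A \<and> (\<Prod>t\<in>?T. \<rho>C (z t)) \<le> c} + measure ?Jn {z. ennreal \<epsilon> < ?f z}
        + measure ?Jn {z. c < (\<Prod>t<n. \<rho>C (z t))}"
      by (intro order_trans[OF measure_Un_le] add_right_mono measure_Un_le) auto
    finally have half: "1 / 2 \<le> measure ?Jn {z. z \<in> A \<and> (\<Prod>t\<in>?T. \<rho>C (z t)) \<le> c}"
      using 1 elim(2) by (simp add: c_def)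
    have "ennreal (1 / 2) \<le> emeasure ?Jn {z. z \<in> A \<and> (\<Prod>t\<in>?T. \<rho>C (z t)) \<le> c}"
      unfolding measure_pmf.emeasure_eq_measure by (rule ennreal_leI[OF half])
    also have "\<dots> \<le> ennreal c * emeasure ?Cn A"
      by (intro Pi_pmf_change_of_measure pmf_letter_of) (auto simp: \<rho>C_def weight_def intro!: divide_nonneg_nonneg mult_nonneg_nonneg prod_nonneg)
    also have "emeasure ?Cn A = emeasure (map_pmf (\<lambda>g. (\<lambda>t\<in>?T. fst (g t), \<lambda>t\<in>?T. snd (g t))) ?Cn) {(q, r). typical \<delta> \<epsilon> n q r}"
    proof -
      have "typical \<delta> \<epsilon> n (\<lambda>t\<in>?T. fst (g t)) (\<lambda>t\<in>?T. snd (g t)) = typical \<delta> \<epsilon> n (\<lambda>t. fst (g t)) (\<lambda>t. snd (g t))" for g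
        by (intro typical_cong) auto
      then show ?thesis by (simp add: A_def vimage_def)
    qed
    also have "map_pmf (\<lambda>g. (\<lambda>t\<in>?T. fst (g t), \<lambda>t\<in>?T. snd (g t))) ?Cn
        = bind_pmf (?Qn) (\<lambda>q. map_pmf (Pair q) (Pi_pmf ?T undefined (\<lambda>t. code_law (q t))))"
      unfolding code_joint_def by (rule Pi_pmf_pair_bind) simp
    also have "emeasure \<dots> {(q, r). typical \<delta> \<epsilon> n q r}
        = (\<integral>\<^sup>+q. ?m q \<partial>?Qn)"
      by (simp add: vimage_def)
    finally have *: "ennreal (1 / 2) \<le> ennreal c * (\<integral>\<^sup>+q. ?m q \<partial>?Qn)" .
    show ?case
    proof (rule ccontr)
      assume neg: "\<not> ?thesis"
      have pc: "2 powr (- (real n * (code_div + \<delta>))) = 1 / c" by (simp add: c_def powr_minus_divide)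
      have "(\<integral>\<^sup>+q. ?m q \<partial>?Qn)
         \<le> (\<integral>\<^sup>+q. ennreal (1 / 4 * (1 / c)) \<partial>?Qn)"
        using neg unfolding pc by (intro nn_integral_mono) (simp add: not_le less_imp_le)
      then have "ennreal c * (\<integral>\<^sup>+q. ?m q \<partial>?Qn)
         \<le> ennreal c * ennreal (1 / 4 * (1 / c))"
        by (intro mult_left_mono) auto
      also have "\<dots> = ennreal (1 / 4)" using c by (simp add: ennreal_mult'[symmetric])
      finally have "ennreal (1 / 2) \<le> ennreal (1 / 4)" using * by (rule order_trans[rotated])
      then show False by (subst (asm) ennreal_le_iff) auto
    qed
  qed
qed

end

subsection \<open>The block scheme\<close>

lemma emeasure_prod_ge_le:
  fixes f :: "nat \<Rightarrow> 'a \<Rightarrow> real"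
  assumes "0 < c" "\<And>t x. 0 \<le> f t x"
  shows "emeasure (measure_pmf A) {x. c \<le> (\<Prod>t<n. f t x)} \<le> ennreal (1 / c) * (\<integral>\<^sup>+x. (\<Prod>t<n. ennreal (f t x)) \<partial>A)"
proof -
  have "ennreal c * emeasure A {x. c \<le> (\<Prod>t<n. f t x)} = (\<integral>\<^sup>+x. ennreal c * indicator {x. c \<le> (\<Prod>t<n. f t x)} x \<partial>A)"
    by (simp add: nn_integral_cmult)
  also have "\<dots> \<le> (\<integral>\<^sup>+x. (\<Prod>t<n. ennreal (f t x)) \<partial>A)"
    using assms by (intro nn_integral_mono) (auto simp: indicator_def prod_ennreal intro: ennreal_leI)
  finally have "ennreal (1 / c) * (ennreal c * emeasure A {x. c \<le> (\<Prod>t<n. f t x)})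
      \<le> ennreal (1 / c) * (\<integral>\<^sup>+x. (\<Prod>t<n. ennreal (f t x)) \<partial>A)"
    by (intro mult_left_mono) auto
  also have "ennreal (1 / c) * (ennreal c * emeasure A {x. c \<le> (\<Prod>t<n. f t x)}) = emeasure A {x. c \<le> (\<Prod>t<n. f t x)}"
    using assms(1) by (simp add: mult.assoc[symmetric] ennreal_mult'[symmetric])
  finally show ?thesis .
qed

lemma emeasure_pair_pmf_Times:
  "emeasure (measure_pmf (pair_pmf A B)) (X \<times> Y) = emeasure (measure_pmf A) X * emeasure (measure_pmf B) Y"
proof -
  have "emeasure (measure_pmf (pair_pmf A B)) (X \<times> Y) = (\<integral>\<^sup>+z. indicator (X \<times> Y) z \<partial>pair_pmf A B)" by simp
  also have "\<dots> = (\<integral>\<^sup>+a. \<integral>\<^sup>+b. indicator X a * indicator Y b \<partial>B \<partial>A)"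
    by (simp only: nn_integral_pair_pmf' indicator_times fst_conv snd_conv)
  also have "\<dots> = emeasure (measure_pmf A) X * emeasure (measure_pmf B) Y"
    by (simp add: nn_integral_cmult nn_integral_multc)
  finally show ?thesis .
qed

locale coding_block = single_letter G p D
  for G :: "('x, 'y) network" and p :: "'x input_pmf" and D :: "nat set" +
  fixes \<delta> \<epsilon> :: real and n b :: nat and q :: "nat \<Rightarrow> nat" and Ls :: "nat \<Rightarrow> nat" and M :: nat and \<theta> :: real
  assumes n_pos: "0 < n" and b_pos: "0 < b" and Ls_pos: "\<And>k. 0 < Ls k" and \<theta>: "0 < \<theta>" "\<theta> \<le> 1"
begin

definition \<kappa> :: "nat \<Rightarrow> (nat \<Rightarrow> 'x) pmf" where
  "\<kappa> k = Pi_pmf {..<n} undefined (\<lambda>t. cnd P (rvX k) rvQ (q t))"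

definition \<mu> :: "nat \<Rightarrow> (nat \<Rightarrow> 'x) \<Rightarrow> (nat \<Rightarrow> nat) pmf" where
  "\<mu> k x = Pi_pmf {..<n} undefined (\<lambda>t. aux_law (q t) k (x t))"

text \<open>The flag thins the source codebook to an arbitrary real size \<open>M * \<theta>\<close>, which may be below one.\<close>
definition \<nu> :: "(nat \<Rightarrow> nat \<Rightarrow> 'x) \<Rightarrow> ((nat \<Rightarrow> 'x) \<times> bool) pmf" where
  "\<nu> x = pair_pmf (Pi_pmf {..<n} undefined (\<lambda>t. source_law (q t) (\<lambda>k\<in>K. x k t))) (bernoulli_pmf \<theta>)"

definition cols :: "(nat \<Rightarrow> (nat \<Rightarrow> 'x) \<times> (nat \<Rightarrow> nat)) \<Rightarrow> nat \<Rightarrow> nat \<Rightarrow> 'x \<times> nat" where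
  "cols w = (\<lambda>t\<in>{..<n}. \<lambda>k\<in>K. (fst (w k) t, snd (w k) t))"

definition col where
  "col z = (\<lambda>t\<in>{..<n}. (fst (fst z) t, cols (snd z) t))"

text \<open>The flag is required here and in \<open>TD\<close>: typical branches carry it, and a
  wrong one passes with an extra factor \<open>\<theta>\<close>, so \<open>M * \<theta>\<close> acts
  as the number of source words.\<close>

definition T0 :: "(((nat \<Rightarrow> 'x) \<times> bool) \<times> (nat \<Rightarrow> (nat \<Rightarrow> 'x) \<times> (nat \<Rightarrow> nat))) set" where
  "T0 = {z. snd (fst z) \<and> typical \<delta> \<epsilon> n q (col z)}"

definition W :: "((nat \<Rightarrow> 'x) \<times> bool) \<times> (nat \<Rightarrow> (nat \<Rightarrow> 'x) \<times> (nat \<Rightarrow> nat)) \<Rightarrow> (nat \<Rightarrow> nat \<Rightarrow> 'y) pmf" where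
  "W z = Pi_pmf {..<n} undefined (\<lambda>t. chan G (\<lambda>k\<in>{1..nodes G}. if k = 1 then fst (fst z) t else fst (snd z k) t))"

definition TD where
  "TD d z y \<longleftrightarrow> snd (fst z) \<and> dest_ok \<delta> n q d (col z) y"

definition \<beta> :: "nat \<Rightarrow> ennreal" where
  "\<beta> k = ennreal (2 powr - (real n * (relay_info k - \<delta>)))"

definition \<gamma> :: "nat \<Rightarrow> nat set \<Rightarrow> ennreal" where
  "\<gamma> d S = ennreal (\<theta> * 2 powr - (real n * (dest_info d S - \<delta>)))"

lemma W_eq_input: "W z = Pi_pmf {..<n} undefined (\<lambda>t. chan G (input_of (col z t)))"
  unfolding W_def
proof (intro Pi_pmf_cong refl arg_cong[where f = "chan G"] ext)
  fix t k assume "t \<in> {..<n}"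
  then show "(\<lambda>k\<in>{1..nodes G}. if k = 1 then fst (fst z) t else fst (snd z k) t) k = input_of (col z t) k"
    by (auto simp: input_of_def col_def cols_def K_def)
qed

lemma good_out_iff:
  "good_out \<delta> n q (col z) y \<longleftrightarrow> (\<forall>k\<in>K. relay_ok \<delta> n q k (snd z k) y) \<and> (\<forall>d\<in>D. dest_ok \<delta> n q d (col z) y)"
proof -
  have "(\<Prod>t<n. \<rho>R k (q t) (snd (col z t) k) (y t k)) = (\<Prod>t<n. \<rho>R k (q t) (fst (snd z k) t, snd (snd z k) t) (y t k))"
    if "k \<in> K" for k
    using that by (intro prod.cong) (auto simp: col_def cols_def)
  then show ?thesis by (simp add: good_out_def relay_ok_def)
qed

lemma \<rho>R_nonneg: "0 \<le> \<rho>R k a w y" by (simp add: \<rho>R_def)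

lemma \<rho>D_nonneg: "0 \<le> \<rho>D d S a r y"
  by (auto simp: \<rho>D_def weight_def intro!: divide_nonneg_nonneg mult_nonneg_nonneg prod_nonneg)

lemma relay_bound: "emeasure (\<mu> k x) {u. relay_ok \<delta> n q k (x, u) y} \<le> \<beta> k"
proof -
  let ?c = "2 powr (real n * (relay_info k - \<delta>))"
  have "emeasure (\<mu> k x) {u. relay_ok \<delta> n q k (x, u) y}
      \<le> ennreal (1 / ?c) * (\<integral>\<^sup>+u. (\<Prod>t<n. ennreal (\<rho>R k (q t) (x t, u t) (y t k))) \<partial>\<mu> k x)"
    unfolding relay_ok_def fst_conv snd_conv by (rule emeasure_prod_ge_le) (auto simp: \<rho>R_nonneg)
  also have "(\<integral>\<^sup>+u. (\<Prod>t<n. ennreal (\<rho>R k (q t) (x t, u t) (y t k))) \<partial>\<mu> k x)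
      = (\<Prod>t<n. \<integral>\<^sup>+u. ennreal (\<rho>R k (q t) (x t, u) (y t k)) \<partial>aux_law (q t) k (x t))"
    unfolding \<mu>_def by (rule nn_integral_prod_Pi_pmf) simp
  also have "\<dots> \<le> (\<Prod>t<n. 1)"
    by (intro prod_mono_ennreal nn_integral_\<rho>R)
  finally show ?thesis
    by (simp add: \<beta>_def powr_minus_divide mult_left_mono)
qed

text \<open>Of the thresholds in \<open>dest_ok\<close> the one for \<open>S\<close> is kept.
  Markov's inequality leaves the mean of a product of ratios, which over independent columns is a
  product of single-letter means, each at most one; the flag adds \<open>\<theta>\<close>.\<close>

lemma dest_bound:
  assumes S: "S \<subseteq> K - {d}"
  shows "(\<integral>\<^sup>+w'. emeasure (\<nu> (\<lambda>k\<in>K. fst (if k \<in> S then w' k else w k)))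
          {v. TD d (v, \<lambda>k. if k \<in> S then w' k else w k) y}
       \<partial>Pi_pmf S undefined (\<lambda>k. bind_pmf (\<kappa> k) (\<lambda>x. map_pmf (Pair x) (\<mu> k x)))) \<le> \<gamma> d S"
    (is "(\<integral>\<^sup>+w'. ?e w' \<partial>_) \<le> _")
proof -
  let ?A = "Pi_pmf S undefined (\<lambda>k. bind_pmf (\<kappa> k) (\<lambda>x. map_pmf (Pair x) (\<mu> k x)))"
  have SK: "S \<subseteq> K" and fS: "finite S" using S by (auto intro: finite_subset[OF _ finite_K])
  let ?c = "2 powr (real n * (dest_info d S - \<delta>))"
  let ?w0 = "\<lambda>t k. (fst (w k) t, snd (w k) t)"
  let ?ov = "\<lambda>t c. \<lambda>k\<in>K. if k \<in> S then c k else ?w0 t k"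
  let ?colS = "\<lambda>w'. \<lambda>t\<in>{..<n}. \<lambda>k\<in>S. (fst (w' k) t, snd (w' k) t)"
  let ?h = "\<lambda>t c. \<integral>\<^sup>+x. ennreal (\<rho>D d S (q t) (x, ?ov t c) (y t d)) \<partial>source_law (q t) (xs (?ov t c))"
  have e: "?e w' \<le> ennreal (\<theta> * (1 / ?c)) * (\<Prod>t<n. ?h t (?colS w' t))" for w'
  proof -
    let ?u = "\<lambda>k. if k \<in> S then w' k else w k"
    have c1: "cols ?u t = ?ov t (?colS w' t)" if "t < n" for t
      using that by (auto simp: cols_def fun_eq_iff restrict_def)
    have c2: "(\<lambda>k\<in>K. (\<lambda>k\<in>K. fst (?u k)) k t) = xs (?ov t (?colS w' t))" if "t < n" for t
      using that by (auto simp: xs_def fun_eq_iff restrict_def)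
    let ?X = "Pi_pmf {..<n} undefined (\<lambda>t. source_law (q t) (xs (?ov t (?colS w' t))))"
    let ?f = "\<lambda>t x. \<rho>D d S (q t) (x t, ?ov t (?colS w' t)) (y t d)"
    have nu: "\<nu> (\<lambda>k\<in>K. fst (?u k)) = pair_pmf ?X (bernoulli_pmf \<theta>)"
    proof -
      have "source_law (q t) (\<lambda>k\<in>K. (\<lambda>k\<in>K. fst (?u k)) k t) = source_law (q t) (xs (?ov t (?colS w' t)))"
        if "t \<in> {..<n}" for t
        using c2[of t] that by (simp only: lessThan_iff)
      then show ?thesis
        unfolding \<nu>_def by (intro arg_cong2[where f = pair_pmf] Pi_pmf_cong refl)
    qed
    have "{v. TD d (v, ?u) y} \<subseteq> {x. ?c \<le> (\<Prod>t<n. ?f t x)} \<times> {True}"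
    proof (intro subsetI)
      fix v assume "v \<in> {v. TD d (v, ?u) y}"
      then have v: "snd v" and "dest_ok \<delta> n q d (col (v, ?u)) y" by (auto simp: TD_def)
      then have "?c \<le> (\<Prod>t<n. \<rho>D d S (q t) (col (v, ?u) t) (y t d))"
        using S by (auto simp: dest_ok_def)
      also have "\<dots> = (\<Prod>t<n. ?f t (fst v))"
        by (intro prod.cong refl) (simp add: col_def c1)
      finally show "v \<in> {x. ?c \<le> (\<Prod>t<n. ?f t x)} \<times> {True}" using v by (auto simp: mem_Times_iff)
    qed
    then have "?e w' \<le> emeasure (pair_pmf ?X (bernoulli_pmf \<theta>)) ({x. ?c \<le> (\<Prod>t<n. ?f t x)} \<times> {True})"
      unfolding nu by (intro emeasure_mono) auto
    also have "\<dots> = emeasure ?X {x. ?c \<le> (\<Prod>t<n. ?f t x)} * ennreal \<theta>"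
      using \<theta> by (simp add: emeasure_pair_pmf_Times emeasure_pmf_single)
    also have "\<dots> \<le> (ennreal (1 / ?c) * (\<integral>\<^sup>+x. (\<Prod>t<n. ennreal (?f t x)) \<partial>?X)) * ennreal \<theta>"
      by (intro mult_right_mono emeasure_prod_ge_le) (auto simp: \<rho>D_nonneg)
    also have "(\<integral>\<^sup>+x. (\<Prod>t<n. ennreal (?f t x)) \<partial>?X) = (\<Prod>t<n. ?h t (?colS w' t))"
      by (rule nn_integral_prod_Pi_pmf) simp
    also have "(ennreal (1 / ?c) * (\<Prod>t<n. ?h t (?colS w' t))) * ennreal \<theta>
        = ennreal (\<theta> * (1 / ?c)) * (\<Prod>t<n. ?h t (?colS w' t))"
      unfolding ennreal_mult'[OF less_imp_le[OF \<theta>(1)]] by (simp only: ac_simps)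
    finally show ?thesis .
  qed
  have "(\<integral>\<^sup>+w'. ?e w' \<partial>?A) \<le> (\<integral>\<^sup>+w'. ennreal (\<theta> * (1 / ?c)) * (\<Prod>t<n. ?h t (?colS w' t)) \<partial>?A)"
    by (intro nn_integral_mono e)
  also have "\<dots> = ennreal (\<theta> * (1 / ?c)) * (\<integral>\<^sup>+c. (\<Prod>t<n. ?h t (c t)) \<partial>map_pmf ?colS ?A)"
    by (simp add: nn_integral_cmult)
  also have "map_pmf ?colS ?A = Pi_pmf {..<n} undefined (\<lambda>t. Pi_pmf S undefined (relay_law (q t)))"
    unfolding \<kappa>_def \<mu>_def relay_law_def by (rule Pi_pmf_columns[OF fS])
  also have "(\<integral>\<^sup>+c. (\<Prod>t<n. ?h t (c t)) \<partial>\<dots>) = (\<Prod>t<n. \<integral>\<^sup>+c. ?h t c \<partial>Pi_pmf S undefined (relay_law (q t)))"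
    by (rule nn_integral_prod_Pi_pmf) simp
  also have "ennreal (\<theta> * (1 / ?c)) * \<dots> \<le> ennreal (\<theta> * (1 / ?c)) * (\<Prod>t<n. 1)"
    by (intro mult_left_mono prod_mono_ennreal nn_integral_\<rho>D SK) simp
  also have "\<dots> = \<gamma> d S" by (simp add: \<gamma>_def powr_minus_divide)
  finally show ?thesis .
qed

sublocale scheme: random_codebook K Ls M \<kappa> \<mu> \<nu>
  by unfold_locales (simp_all add: Ls_pos)

text \<open>Read by columns, a random branch is a flag and independent letters from
  \<open>code_law\<close>. This transfers the bound of \<open>exists_time_sharing_sequence\<close>
  to the codebook.\<close>

lemma word_law:
  "map_pmf (\<lambda>z. (snd (fst z), col z)) scheme.word
     = pair_pmf (bernoulli_pmf \<theta>) (Pi_pmf {..<n} undefined (\<lambda>t. code_law (q t)))"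
proof -
  let ?T = "{..<n}" and ?B = "bernoulli_pmf \<theta>"
  let ?X = "\<lambda>c. Pi_pmf ?T undefined (\<lambda>t. source_law (q t) (xs (c t)))"
  let ?F = "\<lambda>c. map_pmf (\<lambda>(x, f). (f, \<lambda>t\<in>?T. (x t, c t))) (pair_pmf (?X c) ?B)"
  have "map_pmf (\<lambda>z. (snd (fst z), col z)) scheme.word
     = bind_pmf (Pi_pmf K undefined scheme.letter) (\<lambda>w. map_pmf (\<lambda>v. (snd v, col (v, w))) (\<nu> (scheme.xs_of w)))"
    by (simp add: scheme.word_def map_bind_pmf pmf.map_comp o_def)
  also have "\<dots> = bind_pmf (Pi_pmf K undefined scheme.letter) (\<lambda>w. ?F (cols w))"
  proof (intro bind_pmf_cong refl)
    fix w
    have "(\<lambda>k\<in>K. scheme.xs_of w k t) = xs (cols w t)" if "t < n" for t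
      using that by (auto simp: scheme.xs_of_def xs_def cols_def restrict_def fun_eq_iff)
    then have "\<nu> (scheme.xs_of w) = pair_pmf (?X (cols w)) ?B"
      unfolding \<nu>_def by (intro arg_cong2[where f = pair_pmf] Pi_pmf_cong refl) simp
    then show "map_pmf (\<lambda>v. (snd v, col (v, w))) (\<nu> (scheme.xs_of w)) = ?F (cols w)"
      by (simp add: case_prod_unfold col_def)
  qed
  also have "\<dots> = bind_pmf (map_pmf cols (Pi_pmf K undefined scheme.letter)) ?F"
    by (simp add: bind_map_pmf)
  also have "map_pmf cols (Pi_pmf K undefined scheme.letter) = Pi_pmf ?T undefined (\<lambda>t. Pi_pmf K undefined (relay_law (q t)))"
    unfolding cols_def[abs_def] scheme.letter_def[abs_def] \<kappa>_def \<mu>_def relay_law_def[abs_def] by (rule Pi_pmf_columns) simp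
  also have "bind_pmf \<dots> ?F = bind_pmf (Pi_pmf ?T undefined (\<lambda>t. Pi_pmf K undefined (relay_law (q t))))
      (\<lambda>c. pair_pmf ?B (map_pmf (\<lambda>x. \<lambda>t\<in>?T. (x t, c t)) (?X c)))"
    by (subst pair_commute_pmf) (simp add: pmf.map_comp o_def case_prod_unfold pair_map_pmf2 apsnd_def map_prod_def)
  also have "\<dots> = pair_pmf ?B (bind_pmf (Pi_pmf ?T undefined (\<lambda>t. Pi_pmf K undefined (relay_law (q t))))
      (\<lambda>c. map_pmf (\<lambda>x. \<lambda>t\<in>?T. (x t, c t)) (?X c)))"
    unfolding pair_pmf_def by (subst bind_commute_pmf) (simp add: bind_assoc_pmf)
  also have "bind_pmf (Pi_pmf ?T undefined (\<lambda>t. Pi_pmf K undefined (relay_law (q t))))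
      (\<lambda>c. map_pmf (\<lambda>x. \<lambda>t\<in>?T. (x t, c t)) (?X c)) = Pi_pmf ?T undefined (\<lambda>t. code_law (q t))"
  proof -
    have "map_pmf (\<lambda>x. \<lambda>t\<in>?T. (x t, c t)) (?X c)
        = Pi_pmf ?T undefined (\<lambda>t. map_pmf (\<lambda>x. (x, c t)) (source_law (q t) (xs (c t))))" for c
      using map_Pi_pmf_restrict[of ?T "\<lambda>t x. (x, c t)"] by simp
    then show ?thesis
      unfolding code_law_def by (subst Pi_pmf_bind[where d' = undefined]) simp_all
  qed
  finally show ?thesis .
qed

lemma emeasure_T0:
  "emeasure scheme.word T0 = ennreal \<theta> * emeasure (Pi_pmf {..<n} undefined (\<lambda>t. code_law (q t))) {r. typical \<delta> \<epsilon> n q r}"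
proof -
  have "emeasure scheme.word T0 = emeasure (map_pmf (\<lambda>z. (snd (fst z), col z)) scheme.word) ({True} \<times> {r. typical \<delta> \<epsilon> n q r})"
    by (simp add: T0_def vimage_def)
  also have "\<dots> = ennreal \<theta> * emeasure (Pi_pmf {..<n} undefined (\<lambda>t. code_law (q t))) {r. typical \<delta> \<epsilon> n q r}"
    unfolding word_law emeasure_pair_pmf_Times using \<theta> by (simp add: emeasure_pmf_single)
  finally show ?thesis .
qed

lemma rvX_inp: "\<omega> \<in> set_pmf P \<Longrightarrow> k \<in> {1..N} \<Longrightarrow> rvX k \<omega> \<in> inp G k"
  by (auto simp: set_P rvX_def PiE_iff dest!: set_p)

sublocale net: network_scheme K Ls M \<kappa> \<mu> \<nu> b D T0 W "relay_ok \<delta> n q" TD "ennreal \<epsilon>" \<beta> \<gamma> G n fst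
proof unfold_locales
  show "D \<subseteq> K" using D_sub by (simp add: K_def)
  show "emeasure (W z) {y. \<not> ((\<forall>k\<in>K. relay_ok \<delta> n q k (snd z k) y) \<and> (\<forall>d\<in>D. TD d z y))} \<le> ennreal \<epsilon>" if "z \<in> T0" for z
    using that unfolding W_eq_input by (simp add: T0_def TD_def typical_def good_out_iff)
  show "emeasure (\<mu> k x) {u. relay_ok \<delta> n q k (x, u) y} \<le> \<beta> k" for k x y
    by (rule relay_bound)
  show "(\<integral>\<^sup>+w'. emeasure (\<nu> (scheme.xs_of (\<lambda>k. if k \<in> S then w' k else w k)))
          {v. TD d (v, \<lambda>k. if k \<in> S then w' k else w k) y} \<partial>Pi_pmf S undefined scheme.letter) \<le> \<gamma> d S"
    if "S \<subseteq> K - {d}" for d S w y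
    unfolding scheme.xs_of_def scheme.letter_def[abs_def] by (rule dest_bound[OF that])
  show "relay_ok \<delta> n q k w y = relay_ok \<delta> n q k w y'" if "\<And>t. t < n \<Longrightarrow> y t k = y' t k" for k w y y'
  proof -
    have "(\<Prod>t<n. \<rho>R k (q t) (fst w t, snd w t) (y t k)) = (\<Prod>t<n. \<rho>R k (q t) (fst w t, snd w t) (y' t k))"
      using that by (intro prod.cong) auto
    then show ?thesis by (simp add: relay_ok_def)
  qed
  show "TD d z y = TD d z y'" if "\<And>t. t < n \<Longrightarrow> y t d = y' t d" for d z y y'
    using dest_ok_cong[of n q q "col z" "col z" y d y' \<delta>] that by (auto simp: TD_def)
  show "x t \<in> inp G k" if "k \<in> K" "x \<in> set_pmf (\<kappa> k)" "t < n" for k x t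
  proof -
    have "x t \<in> set_pmf (cnd P (rvX k) rvQ (q t))"
      using that by (auto simp: \<kappa>_def set_Pi_pmf PiE_dflt_def)
    then show ?thesis using set_cnd rvX_inp that by (fastforce simp: K_def)
  qed
  show "fst v t \<in> inp G 1" if "v \<in> set_pmf (\<nu> x)" "t < n" for x v t
  proof -
    have "fst v t \<in> set_pmf (source_law (q t) (\<lambda>k\<in>K. x k t))"
      using that by (auto simp: \<nu>_def set_Pi_pmf PiE_dflt_def)
    then have "fst v t \<in> rvX 1 ` set_pmf P" unfolding source_law_def using set_cnd by fast
    then obtain \<omega> where \<omega>: "\<omega> \<in> set_pmf P" "fst v t = rvX 1 \<omega>" by (rule imageE)
    have "1 \<in> {1..N}" using nodes by auto
    from rvX_inp[OF \<omega>(1) this] show ?thesis unfolding \<omega>(2) .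
  qed
qed (simp_all add: n_pos b_pos network K_def W_def)

end

subsection \<open>Achievable rates\<close>

text \<open>Keeps the set of codes nonempty at every length, and is error-free when 1 is the only
  message.\<close>

lemma trivial_code:
  assumes "dm_network G"
  shows "\<exists>c. is_code G D R n c \<and> (\<forall>d ys. dec c d ys = Some 1)"
proof -
  let ?c = "\<lparr>src = (\<lambda>_ _ _. SOME x. x \<in> inp G 1), relay = (\<lambda>k _ _. SOME x. x \<in> inp G k), dec = (\<lambda>_ _. Some 1)\<rparr>"
  have "(SOME x. x \<in> inp G k) \<in> inp G k" if "k \<in> {1..nodes G}" for k
    using assms that by (auto simp: dm_network_def some_in_eq)
  moreover have "1 \<in> messages R n" by (simp add: messages_def)
  moreover have "1 \<le> nodes G" using assms by (simp add: dm_network_def)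
  ultimately have "is_code G D R n ?c" by (auto simp: is_code_def)
  then show ?thesis by (intro exI[of _ ?c]) simp
qed

abbreviation has_code :: "('x, 'y) network \<Rightarrow> nat set \<Rightarrow> real \<Rightarrow> nat \<Rightarrow> real \<Rightarrow> bool" where
  "has_code G D R n e \<equiv> \<exists>c. is_code G D R n c \<and> error_prob G D R n c \<le> e"

lemma error_prob_nonneg: "0 \<le> error_prob G D R n c"
  by (simp add: error_prob_def)

text \<open>The codes supplied depend on \<open>e\<close>, but one sequence must serve all
  \<open>e\<close>: at each length take a code within \<open>1 / real (Suc n)\<close> of the least
  possible error.\<close>

lemma achievableI:
  assumes "dm_network G" "0 \<le> R"
    and codes: "\<And>e. 0 < e \<Longrightarrow> \<forall>\<^sub>F n in sequentially. has_code G D R n e"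
  shows "achievable G D R"
proof -
  define E where "E n = Inf (error_prob G D R n ` {c. is_code G D R n c})" for n
  have ne: "error_prob G D R n ` {c. is_code G D R n c} \<noteq> {}" for n
    using trivial_code[OF assms(1), of D R n] by blast
  have bdd: "bdd_below (error_prob G D R n ` {c. is_code G D R n c})" for n
    by (rule bdd_belowI[of _ 0]) (auto simp: error_prob_nonneg)
  have "\<exists>c. is_code G D R n c \<and> error_prob G D R n c < E n + 1 / real (Suc n)" for n
    using cInf_lessD[OF ne[of n], of "E n + 1 / real (Suc n)"] by (auto simp: E_def)
  then obtain c where c: "\<And>n. is_code G D R n (c n)" "\<And>n. error_prob G D R n (c n) < E n + 1 / real (Suc n)" by metis
  have "E \<longlonglongrightarrow> 0"
  proof (rule order_tendstoI)
    fix a :: real assume "a < 0"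
    moreover have "0 \<le> E n" for n unfolding E_def by (rule cInf_greatest[OF ne]) (auto simp: error_prob_nonneg)
    ultimately show "\<forall>\<^sub>F n in sequentially. a < E n" by (intro always_eventually allI) (meson less_le_trans)
  next
    fix a :: real assume "0 < a"
    then have "\<forall>\<^sub>F n in sequentially. has_code G D R n (a / 2)" by (intro codes) simp
    then show "\<forall>\<^sub>F n in sequentially. E n < a"
    proof eventually_elim
      case (elim n)
      then obtain c where "is_code G D R n c" "error_prob G D R n c \<le> a / 2" by auto
      then have "E n \<le> a / 2" unfolding E_def by (intro cInf_lower2[OF _ _ bdd]) auto
      then show ?case using \<open>0 < a\<close> by simp
    qed
  qed
  then have "(\<lambda>n. E n + 1 / real (Suc n)) \<longlonglongrightarrow> 0 + 0"
    by (intro tendsto_add LIMSEQ_inverse_real_of_nat[unfolded inverse_eq_divide])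
  then have lim: "(\<lambda>n. E n + 1 / real (Suc n)) \<longlonglongrightarrow> 0" by simp
  have "(\<lambda>n. error_prob G D R n (c n)) \<longlonglongrightarrow> 0"
    by (rule tendsto_sandwich[OF always_eventually always_eventually tendsto_const lim])
       (use c(2) in \<open>simp_all add: error_prob_nonneg less_imp_le\<close>)
  then show ?thesis using assms(2) c(1) unfolding achievable_def by blast
qed

text \<open>Needed because the cut values can be negative. Rate zero leaves a single
  message.\<close>

lemma capacity_nonneg:
  assumes "dm_network G"
  shows "0 \<le> capacity G D"
proof -
  have "achievable G D 0"
  proof (rule achievableI[OF assms])
    fix e :: real assume e: "0 < e"
    have "has_code G D 0 n e" for n
    proof -
      obtain c where c: "is_code G D 0 n c" "\<And>d ys. dec c d ys = Some 1"
        using trivial_code[OF assms] by blast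
      have "messages 0 n = {1}" by (simp add: messages_def)
      then have "error_prob G D 0 n c = 0"
        by (simp add: error_prob_def c(2) pmf_of_set_singleton bind_return_pmf vimage_def)
      then show ?thesis using c e by auto
    qed
    then show "\<forall>\<^sub>F n in sequentially. has_code G D 0 n e" by simp
  qed simp
  then have "ereal 0 \<le> capacity G D" unfolding capacity_def by (intro SUP_upper) simp
  then show ?thesis by (simp add: zero_ereal_def)
qed

section \<open>Codes and error bounds for one block length\<close>

context coding_block
begin

lemma block_code:
  assumes tau: "ennreal t \<le> emeasure (Pi_pmf {..<n} undefined (\<lambda>t. code_law (q t))) {r. typical \<delta> \<epsilon> n q r}" "0 < t"
    and e: "net.err_bound \<le> ennreal e" "0 < e" and M: "0 < M" and l: "b * n \<le> l"
    and card: "2 ^ nat \<lceil>real l * R\<rceil> \<le> real ((\<Prod>k\<in>K. Ls k) ^ (b - 1) * M ^ b) * (\<theta> * t) ^ b / 4"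
  shows "has_code G D R l (6 * e)"
proof -
  have "ennreal (\<theta> * t) = ennreal \<theta> * ennreal t" using \<theta> by (intro ennreal_mult') simp
  also have "\<dots> \<le> ennreal \<theta> * emeasure (Pi_pmf {..<n} undefined (\<lambda>t. code_law (q t))) {r. typical \<delta> \<epsilon> n q r}"
    by (intro mult_left_mono tau) simp
  also have "\<dots> = net.\<tau>" by (simp add: net.\<tau>_def emeasure_T0)
  finally have \<tau>: "ennreal (\<theta> * t) \<le> net.\<tau>" .
  have pos: "0 < \<theta> * t" using \<theta> tau by simp
  then have "0 < net.\<tau>" using \<tau> by (metis ennreal_less_zero_iff less_le_trans)
  then obtain C Pa where C: "C \<in> set_pmf net.books" "Pa \<subseteq> net.paths" "\<And>s. s \<in> Pa \<Longrightarrow> net.err C s \<le> ennreal (6 * e)"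
    "real (card net.paths) * enn2real net.\<tau> ^ b / 4 \<le> real (card Pa)"
    using net.exists_codebook[OF e _ M] by blast
  have "net.\<tau> \<le> 1" unfolding net.\<tau>_def by (rule measure_pmf.emeasure_le_1)
  then have "net.\<tau> < top" by (rule le_less_trans) simp
  then have "\<theta> * t \<le> enn2real net.\<tau>" using enn2real_mono[OF \<tau>] pos by simp
  then have "(\<theta> * t) ^ b \<le> enn2real net.\<tau> ^ b" using pos by (intro power_mono) auto
  then have "real (card net.paths) * (\<theta> * t) ^ b / 4 \<le> real (card net.paths) * enn2real net.\<tau> ^ b / 4"
    by (intro divide_right_mono mult_left_mono) auto
  then have "2 ^ nat \<lceil>real l * R\<rceil> \<le> real (card Pa)"
    using card C(4) unfolding net.card_paths by linarith
  then have "card (messages R l) \<le> card Pa"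
    by (simp add: messages_def flip: of_nat_le_iff)
  moreover have fP: "finite Pa" using C(2) net.finite_paths by (rule finite_subset)
  ultimately obtain \<sigma> where \<sigma>: "\<sigma> ` messages R l \<subseteq> Pa" "inj_on \<sigma> (messages R l)"
    using card_le_inj[of "messages R l" Pa] by (auto simp: messages_def)
  have "net.err C (\<sigma> m) \<le> ennreal (6 * e)" if "m \<in> messages R l" for m
    using \<sigma>(1) that by (intro C(3)) auto
  from net.net_code[OF C(1) \<sigma>(2) _ l this] \<sigma>(1) C(2) e(2) show ?thesis by auto
qed

text \<open>Each count of wrong choices falls short of its test exponent by at least
  \<open>n * \<delta>\<close>, so every product of count and bound is at most \<open>x\<close>;
  there are at most \<open>2 ^ card K\<close> sets \<open>S\<close>.\<close>

lemma err_bound_le: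
  assumes Ls: "\<And>k. k \<in> K \<Longrightarrow> real (Ls k - 1) \<le> 2 powr (real n * (relay_info k - 2 * \<delta>))"
    and M: "real M * \<theta> = 2 powr (real n * R1)" and \<epsilon>: "0 < \<epsilon>"
    and cut: "\<And>d S. d \<in> D \<Longrightarrow> S \<subseteq> K - {d} \<Longrightarrow> (\<Sum>k\<in>S. relay_info k - 2 * \<delta>) + R1 - dest_info d S + \<delta> \<le> - \<delta>"
  defines "x \<equiv> 2 powr - (real n * \<delta>)"
  shows "net.err_bound \<le> ennreal (real b * \<epsilon> + real b * (real (card K) * x) + real (card D) * ((1 + 2 ^ card K * x) ^ b - 1))"
proof -
  have x: "0 < x" by (simp add: x_def)
  have \<Gamma>: "net.\<Gamma> d \<le> ennreal (2 ^ card K * x)" if d: "d \<in> D" for d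
  proof -
    have "(\<Prod>k\<in>S. of_nat (Ls k - 1)) * of_nat M * \<gamma> d S \<le> ennreal x" if S: "S \<in> Pow (K - {d})" for S
    proof -
      have SK: "S \<subseteq> K" using S by auto
      have fS: "finite S" using SK by (rule finite_subset) simp
      have "(\<Prod>k\<in>S. of_nat (Ls k - 1)) * of_nat M * \<gamma> d S
          = ennreal ((\<Prod>k\<in>S. real (Ls k - 1)) * (real M * \<theta>) * 2 powr - (real n * (dest_info d S - \<delta>)))"
        using \<theta> by (simp add: \<gamma>_def ennreal_of_nat_eq_real_of_nat prod_ennreal ennreal_mult'[symmetric] prod_nonneg mult.assoc del: of_nat_diff)
      also have "\<dots> \<le> ennreal ((\<Prod>k\<in>S. 2 powr (real n * (relay_info k - 2 * \<delta>))) * 2 powr (real n * R1) * 2 powr - (real n * (dest_info d S - \<delta>)))"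
        unfolding M using SK Ls by (intro ennreal_leI mult_right_mono prod_mono) auto
      also have "(\<Prod>k\<in>S. 2 powr (real n * (relay_info k - 2 * \<delta>))) * 2 powr (real n * R1) * 2 powr - (real n * (dest_info d S - \<delta>))
          = 2 powr (real n * ((\<Sum>k\<in>S. relay_info k - 2 * \<delta>) + R1 - dest_info d S + \<delta>))"
      proof -
        have "(\<Prod>k\<in>S. 2 powr (real n * (relay_info k - 2 * \<delta>))) = 2 powr (real n * (\<Sum>k\<in>S. relay_info k - 2 * \<delta>))"
          using fS by (subst sum_distrib_left, subst powr_sum) auto
        moreover have "2 powr (real n * s) * 2 powr (real n * R1) * 2 powr - (real n * (dest_info d S - \<delta>))
            = 2 powr (real n * (s + R1 - dest_info d S + \<delta>))" for s
          by (simp add: powr_add[symmetric] algebra_simps)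
        ultimately show ?thesis by simp
      qed
      also have "\<dots> \<le> 2 powr (real n * - \<delta>)"
        using cut[OF d, of S] S by (intro powr_mono mult_left_mono) auto
      finally show ?thesis by (simp add: x_def ennreal_leI)
    qed
    then have "net.\<Gamma> d \<le> (\<Sum>S\<in>Pow (K - {d}). ennreal x)"
      unfolding net.\<Gamma>_def by (intro sum_mono) auto
    also have "\<dots> = ennreal (real (card (Pow (K - {d}))) * x)"
      using x by (simp add: ennreal_of_nat_eq_real_of_nat ennreal_mult'[symmetric] del: card_Pow)
    also have "\<dots> \<le> ennreal (2 ^ card K * x)"
    proof -
      have "card (Pow (K - {d})) \<le> card (Pow K)" by (intro card_mono) auto
      then have "real (card (Pow (K - {d}))) \<le> 2 ^ card K" by (simp add: card_Pow flip: of_nat_le_iff)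
      then show ?thesis using x by (intro ennreal_leI mult_right_mono) auto
    qed
    finally show ?thesis .
  qed
  have r: "of_nat (Ls k - 1) * \<beta> k \<le> ennreal x" if k: "k \<in> K" for k
  proof -
    have "of_nat (Ls k - 1) * \<beta> k = ennreal (real (Ls k - 1) * 2 powr - (real n * (relay_info k - \<delta>)))"
      by (simp add: \<beta>_def ennreal_of_nat_eq_real_of_nat ennreal_mult'[symmetric] del: of_nat_diff)
    also have "\<dots> \<le> ennreal (2 powr (real n * (relay_info k - 2 * \<delta>)) * 2 powr - (real n * (relay_info k - \<delta>)))"
      by (intro ennreal_leI mult_right_mono Ls k) simp
    also have "2 powr (real n * (relay_info k - 2 * \<delta>)) * 2 powr - (real n * (relay_info k - \<delta>)) = x"
      by (simp add: powr_add[symmetric] x_def algebra_simps)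
    finally show ?thesis .
  qed
  have dd: "(1 + net.\<Gamma> d) ^ b - 1 \<le> ennreal ((1 + 2 ^ card K * x) ^ b - 1)" if d: "d \<in> D" for d
  proof -
    have "(1 + net.\<Gamma> d) ^ b \<le> (1 + ennreal (2 ^ card K * x)) ^ b"
      by (intro power_mono add_left_mono \<Gamma> d) simp
    also have "\<dots> = ennreal ((1 + 2 ^ card K * x) ^ b)"
      using x by (simp add: ennreal_power[symmetric] flip: ennreal_1 ennreal_plus)
    finally have "(1 + net.\<Gamma> d) ^ b - 1 \<le> ennreal ((1 + 2 ^ card K * x) ^ b) - ennreal 1"
      by (intro ennreal_minus_mono) auto
    also have "\<dots> = ennreal ((1 + 2 ^ card K * x) ^ b - 1)" by (simp add: ennreal_minus del: ennreal_1)
    finally show ?thesis .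
  qed
  have ge1: "1 \<le> (1 + 2 ^ card K * x) ^ b" using x by (intro one_le_power) simp
  have "net.err_bound \<le> of_nat b * ennreal \<epsilon> + of_nat b * (\<Sum>k\<in>K. ennreal x) + (\<Sum>d\<in>D. ennreal ((1 + 2 ^ card K * x) ^ b - 1))"
    unfolding net.err_bound_def by (intro add_mono mult_left_mono sum_mono r dd) auto
  also have "\<dots> = ennreal (real b * \<epsilon> + real b * (real (card K) * x) + real (card D) * ((1 + 2 ^ card K * x) ^ b - 1))"
    using x \<epsilon> ge1 by (simp add: ennreal_of_nat_eq_real_of_nat ennreal_mult'[symmetric] flip: ennreal_plus)
  finally show ?thesis .
qed

end

section \<open>Choice of the rates and passage to all code lengths\<close>

context single_letter
begin

text \<open>\<open>R1\<close> leaves a margin of \<open>gap / 2\<close> at every cut and a surplus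
  of \<open>gap / 2\<close> over \<open>R\<close> in the number of paths. A quarter of
  \<open>gap\<close> from the surplus pays for the losses in \<open>\<delta>\<close>, the other
  quarter, summed over the blocks, for the index vector missing in the first block.\<close>

lemma achievable_below_cuts:
  assumes R: "0 \<le> R" and gap: "0 < gap"
    and cuts: "\<And>d S. d \<in> D \<Longrightarrow> S \<subseteq> K - {d} \<Longrightarrow>
      R + gap \<le> dest_info d S - code_div + (\<Sum>k\<in>K - S. relay_info k)"
  shows "achievable G D R"
proof (rule achievableI[OF network R])
  fix e :: real assume e: "0 < e"
  define c where "c = real (card K)"
  \<comment> \<open>Every relay rate gives up \<open>2 * \<delta>\<close> and typicality costs
    another \<open>\<delta>\<close>; the total stays within \<open>gap / 4\<close>.\<close>
  define \<delta> where "\<delta> = gap / (8 * (c + 1))"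
  define I where "I = (\<Sum>k\<in>K. relay_info k)"
  define R1 where "R1 = R + gap / 2 + code_div - I"
  \<comment> \<open>The number of blocks is fixed before the block length, so that
    \<open>(1 + 2 ^ card K * ?x n) ^ b - 1\<close> tends to zero.\<close>
  obtain b0 :: nat where b0: "(I + 1) / (gap / 4) \<le> real b0" using real_arch_simple by blast
  define b where "b = Suc b0"
  have b: "0 < b" by (simp add: b_def)
  have "I + 1 \<le> real b0 * (gap / 4)"
    using b0 gap by (simp add: pos_divide_le_eq)
  also have "\<dots> \<le> real b * (gap / 4)" using gap by (intro mult_right_mono) (auto simp: b_def)
  finally have bI: "I + 1 \<le> real b * (gap / 4)" .
  have c0: "0 \<le> c" by (simp add: c_def)
  have \<delta>: "0 < \<delta>" using gap c0 by (simp add: \<delta>_def)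
  have \<delta>c: "2 * \<delta> * (c + 1) = gap / 4" using c0 by (simp add: \<delta>_def field_simps)
  have \<delta>gap: "2 * \<delta> \<le> gap / 4" "2 * \<delta> * c + \<delta> \<le> gap / 4"
    using \<delta> c0 \<delta>c by (auto simp: algebra_simps mult_nonneg_nonneg)
  \<comment> \<open>\<open>e / 6\<close> is the budget of \<open>err_bound\<close>, because
    expurgation loses a factor 6; atypical outputs take half of it.\<close>
  define \<epsilon> where "\<epsilon> = e / 12 / real b"
  have \<epsilon>: "0 < \<epsilon>" using e b by (simp add: \<epsilon>_def)
  let ?x = "\<lambda>n :: nat. 2 powr - (real n * \<delta>)"
  have x0: "?x \<longlonglongrightarrow> 0"
  proof -
    have "(\<lambda>n. (2 powr - \<delta>) ^ n :: real) \<longlonglongrightarrow> 0"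
      using \<delta> by (intro LIMSEQ_power_zero) (simp add: powr_less_one)
    moreover have "(2 powr - \<delta>) ^ n = ?x n" for n
      by (simp add: powr_realpow[symmetric] powr_powr mult.commute)
    ultimately show ?thesis by simp
  qed
  have "(\<lambda>n. real b * (c * ?x n) + real (card D) * ((1 + 2 ^ card K * ?x n) ^ b - 1))
      \<longlonglongrightarrow> real b * (c * 0) + real (card D) * ((1 + 2 ^ card K * 0) ^ b - 1)"
    by (intro tendsto_intros x0)
  then have "(\<lambda>n. real b * (c * ?x n) + real (card D) * ((1 + 2 ^ card K * ?x n) ^ b - 1)) \<longlonglongrightarrow> 0" by simp
  then have small: "\<forall>\<^sub>F n in sequentially. real b * (c * ?x n) + real (card D) * ((1 + 2 ^ card K * ?x n) ^ b - 1) < e / 12"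
    using e by (intro order_tendstoD(2)) auto
  \<comment> \<open>\<open>real b * R\<close> pays for up to \<open>b\<close> letters after the last
    block, \<open>2 * real b\<close> for the factor 1/4 of \<open>t\<close> in each block, and 3 for
    the ceiling and the final division by 4.\<close>
  obtain n0 :: nat where n0: "real b * R + 2 * real b + 3 \<le> real n0" using real_arch_simple by blast
  have "\<forall>\<^sub>F n in sequentially. \<forall>l\<in>{b * n..<b * n + b}. has_code G D R l e"
    using small exists_time_sharing_sequence[OF \<delta> \<epsilon>] eventually_ge_at_top[of "max n0 1"]
  proof eventually_elim
    case (elim n)
    then obtain q where q: "ennreal (1 / 4 * 2 powr (- (real n * (code_div + \<delta>))))
        \<le> emeasure (Pi_pmf {..<n} undefined (\<lambda>t. code_law (q t))) {r. typical \<delta> \<epsilon> n q r}" by blast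
    have n: "0 < n" "real n0 \<le> real n" using elim by auto
    \<comment> \<open>The successor makes the number of indices at least the power, while the number
      of wrong indices stays at most the power.\<close>
    define Ls where "Ls k = Suc (nat \<lfloor>2 powr (real n * (relay_info k - 2 * \<delta>))\<rfloor>)" for k
    define M where "M = nat \<lceil>2 powr (real n * R1)\<rceil>"
    define \<theta> where "\<theta> = 2 powr (real n * R1) / real M"
    define t where "t = 1 / 4 * 2 powr (- (real n * (code_div + \<delta>)))"
    have M: "2 powr (real n * R1) \<le> real M" by (simp add: M_def real_nat_ceiling_ge)
    then have M0: "0 < real M" by (rule less_le_trans[rotated]) simp
    have \<theta>: "0 < \<theta>" "\<theta> \<le> 1" using M M0 by (auto simp: \<theta>_def)
    have M\<theta>: "real M * \<theta> = 2 powr (real n * R1)" using M0 by (simp add: \<theta>_def)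
    have Ls_ge: "2 powr (real n * (relay_info k - 2 * \<delta>)) \<le> real (Ls k)"
      and Ls_le: "real (Ls k - 1) \<le> 2 powr (real n * (relay_info k - 2 * \<delta>))" for k
      unfolding Ls_def by (simp_all add: of_nat_nat) linarith
    interpret coding_block G p D \<delta> \<epsilon> n b q Ls M \<theta>
      by unfold_locales (use n b \<theta> in \<open>auto simp: Ls_def\<close>)
    have cut: "(\<Sum>k\<in>S. relay_info k - 2 * \<delta>) + R1 - dest_info d S + \<delta> \<le> - \<delta>"
      if "d \<in> D" "S \<subseteq> K - {d}" for d S
    proof -
      have SK: "S \<subseteq> K" using that by auto
      have "I = (\<Sum>k\<in>K - S. relay_info k) + (\<Sum>k\<in>S. relay_info k)"
        unfolding I_def using SK by (intro sum.subset_diff) auto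
      moreover have "(\<Sum>k\<in>S. relay_info k - 2 * \<delta>) \<le> (\<Sum>k\<in>S. relay_info k)"
        using \<delta> by (intro sum_mono) simp
      ultimately show ?thesis
        using cuts[OF that] \<delta>gap(1) gap by (simp add: R1_def)
    qed
    have "net.err_bound \<le> ennreal (real b * \<epsilon> + real b * (real (card K) * ?x n) + real (card D) * ((1 + 2 ^ card K * ?x n) ^ b - 1))"
      by (rule err_bound_le[OF Ls_le M\<theta> \<epsilon> cut])
    also have "\<dots> \<le> ennreal (e / 6)"
    proof (rule ennreal_leI)
      have "real b * \<epsilon> = e / 12" using b by (simp add: \<epsilon>_def)
      then show "real b * \<epsilon> + real b * (real (card K) * ?x n) + real (card D) * ((1 + 2 ^ card K * ?x n) ^ b - 1) \<le> e / 6"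
        using elim(1) by (simp add: c_def)
    qed
    finally have eb: "net.err_bound \<le> ennreal (e / 6)" .
    show ?case
    proof
      fix l assume l: "l \<in> {b * n..<b * n + b}"
      have "2 ^ nat \<lceil>real l * R\<rceil> \<le> real ((\<Prod>k\<in>K. Ls k) ^ (b - 1) * M ^ b) * (\<theta> * t) ^ b / 4"
      proof -
        have "real l * R \<le> (real b * real n + real b) * R"
        proof -
          have "real l \<le> real (b * n + b)" using l unfolding of_nat_le_iff by simp
          then show ?thesis using R by (intro mult_right_mono) auto
        qed
        then have lR: "real_of_int \<lceil>real l * R\<rceil> \<le> real n * (real b * R) + real b * R + 1"
          by (simp add: algebra_simps) linarith
        have "(2 :: real) ^ nat \<lceil>real l * R\<rceil> = 2 powr real_of_int \<lceil>real l * R\<rceil>"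
          using R by (simp add: powr_realpow[symmetric])
        also have "\<dots> \<le> 2 powr (real n * (- I + 2 * \<delta> * c + real b * (R + gap / 2 - 2 * \<delta> * c - \<delta>)) - 2 * real b - 2)"
        proof (rule powr_mono)
          have dc: "0 \<le> 2 * \<delta> * c" using \<delta> c0 by simp
          have "real b * (R + gap / 4) \<le> real b * (R + gap / 2 - 2 * \<delta> * c - \<delta>)"
            using \<delta>gap(2) by (intro mult_left_mono) auto
          then have "real b * R + 1 \<le> - I + 2 * \<delta> * c + real b * (R + gap / 2 - 2 * \<delta> * c - \<delta>)"
            unfolding distrib_left[of "real b" R "gap / 4"] using bI dc by linarith
          then have "real n * (real b * R + 1) \<le> real n * (- I + 2 * \<delta> * c + real b * (R + gap / 2 - 2 * \<delta> * c - \<delta>))"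
            by (intro mult_left_mono) auto
          then show "real_of_int \<lceil>real l * R\<rceil> \<le> real n * (- I + 2 * \<delta> * c + real b * (R + gap / 2 - 2 * \<delta> * c - \<delta>)) - 2 * real b - 2"
            using lR n0 n(2) by (simp add: distrib_left)
        qed simp
        also have "\<dots> = (2 powr (real n * (I - 2 * \<delta> * c))) ^ (b - 1) * (2 powr (real n * R1)) ^ b * t ^ b / 4"
        proof -
          have "t = 2 powr (- 2 - real n * (code_div + \<delta>))"
            by (simp add: t_def powr_diff powr_minus_divide powr_add)
          then have "(2 powr (real n * (I - 2 * \<delta> * c))) ^ (b - 1) * (2 powr (real n * R1)) ^ b * t ^ b / 4
            = 2 powr (real n * (I - 2 * \<delta> * c) * real (b - 1)) * 2 powr (real n * R1 * real b)
              * 2 powr ((- 2 - real n * (code_div + \<delta>)) * real b) * 2 powr - 2"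
            by (simp add: powr_realpow[symmetric] powr_powr powr_minus_divide)
          also have "\<dots> = 2 powr (real n * (I - 2 * \<delta> * c) * real (b - 1) + real n * R1 * real b
              + (- 2 - real n * (code_div + \<delta>)) * real b - 2)"
            by (simp add: powr_add[symmetric])
          also have "real n * (I - 2 * \<delta> * c) * real (b - 1) + real n * R1 * real b
              + (- 2 - real n * (code_div + \<delta>)) * real b - 2
              = real n * (- I + 2 * \<delta> * c + real b * (R + gap / 2 - 2 * \<delta> * c - \<delta>)) - 2 * real b - 2"
            by (simp add: R1_def b_def algebra_simps)
          finally show ?thesis by simp
        qed
        also have "\<dots> \<le> (\<Prod>k\<in>K. real (Ls k)) ^ (b - 1) * (2 powr (real n * R1)) ^ b * t ^ b / 4"
        proof -
          have "2 powr (real n * (I - 2 * \<delta> * c)) = (\<Prod>k\<in>K. 2 powr (real n * (relay_info k - 2 * \<delta>)))"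
          proof -
            have "real n * (I - 2 * \<delta> * c) = (\<Sum>k\<in>K. real n * (relay_info k - 2 * \<delta>))"
              by (simp add: I_def c_def sum_distrib_left[symmetric] sum_subtractf)
            then show ?thesis by (simp add: powr_sum)
          qed
          also have "\<dots> \<le> (\<Prod>k\<in>K. real (Ls k))"
            by (intro prod_mono conjI Ls_ge) simp
          finally show ?thesis
            by (intro divide_right_mono mult_right_mono power_mono) (auto simp: t_def)
        qed
        also have "\<dots> = real ((\<Prod>k\<in>K. Ls k) ^ (b - 1) * M ^ b) * (\<theta> * t) ^ b / 4"
          unfolding M\<theta>[symmetric] by (simp add: power_mult_distrib)
        finally show ?thesis .
      qed
      then have "has_code G D R l (6 * (e / 6))"
        using q e M0 l eb by (intro block_code[where t = t]) (auto simp: t_def)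
      then show "has_code G D R l e" by simp
    qed
  qed
  then obtain n1 where n1: "\<And>n l. n1 \<le> n \<Longrightarrow> l \<in> {b * n..<b * n + b} \<Longrightarrow>
      has_code G D R l e"
    unfolding eventually_sequentially by blast
  show "\<forall>\<^sub>F l in sequentially. has_code G D R l e"
    unfolding eventually_sequentially
  proof (rule exI[of _ "n1 * b"], intro allI impI)
    fix l assume "n1 * b \<le> l"
    then have "n1 \<le> l div b" using b by (simp add: less_eq_div_iff_mult_less_eq)
    moreover have "l \<in> {b * (l div b)..<b * (l div b) + b}"
      using b dividend_less_times_div[of b l] by auto
    ultimately show "has_code G D R l e" by (rule n1)
  qed
qed

end

theorem corollary4:
  fixes G :: "('x, 'y) network" and D :: "nat set"
  assumes "dm_network G" and "D \<subseteq> {2..nodes G}"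
  shows "capacity G D \<ge>
    (SUP p\<in>input_pmfs G. INF d\<in>D.
      INF S\<in>{S. S \<subseteq> {1..nodes G} \<and> 1 \<in> S \<and> d \<in> {1..nodes G} - S}.
        let P = joint_pmf G p; Sc = {1..nodes G} - S; Sck = (\<lambda>k. Sc \<inter> {1..k - 1}) in
        ereal (I[P](rvXs S ; (\<lambda>\<omega>. (rvUs Sc \<omega>, rvY d \<omega>)) | (\<lambda>\<omega>. (rvXs Sc \<omega>, rvQ \<omega>)))
          - (\<Sum>k\<in>Sc.
               I[P](rvU k ; (\<lambda>\<omega>. (rvUs (Sck k) \<omega>, rvXs {1..nodes G} \<omega>))
                 | (\<lambda>\<omega>. (rvX k \<omega>, rvY k \<omega>, rvQ \<omega>)))
             + I[P](rvX k ; rvXs (Sck k) | rvQ))))"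
proof (rule SUP_least, goal_cases)
  case (1 p)
  note p = this
  interpret single_letter G p D by unfold_locales (rule assms p)+
  define T where "T d S = dest_info d S - code_div + (\<Sum>k\<in>K - S. relay_info k)" for d S
  let ?cuts = "\<lambda>d. {S. S \<subseteq> {1..nodes G} \<and> 1 \<in> S \<and> d \<in> {1..nodes G} - S}"
  let ?V = "INF d\<in>D. INF S\<in>?cuts d. ereal (T d (S - {1}))"
  have "?V \<le> capacity G D"
  \<comment> \<open>Approaching \<open>?V\<close> from below gives strict inequality at every cut,
    and it also covers an infinite \<open>?V\<close>, which occurs for empty
    \<open>D\<close>.\<close>
  proof (rule dense_le)
    fix x assume x: "x < ?V"
    show "x \<le> capacity G D"
    proof (cases x)
      case (real R)
      show ?thesis
      proof (cases "R < 0")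
        case True
        then have "x \<le> 0" using real by (simp add: zero_ereal_def)
        then show ?thesis using capacity_nonneg[OF assms(1), of D] by (rule order_trans)
      next
        case False
        have lt: "R < T d S" if "d \<in> D" "S \<subseteq> K - {d}" for d S
        proof -
          have one: "1 \<notin> K" by (simp add: K_def)
          have d: "d \<in> K" using that D_sub by (auto simp: K_def)
          have cut: "insert 1 S \<in> ?cuts d" using that one d unfolding nodes by auto
          have "x < ereal (T d (insert 1 S - {1}))"
            using x by (rule less_le_trans) (rule INF_lower2[OF that(1)], rule INF_lower2[OF cut order_refl])
          moreover have "insert 1 S - {1} = S" using that one by auto
          ultimately show ?thesis using real by simp
        qed
        let ?A = "Sigma D (\<lambda>d. Pow (K - {d}))"
        \<comment> \<open>The inserted 1 keeps the set nonempty when \<open>D\<close> is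
          empty.\<close>
        define gap where "gap = Min (insert 1 ((\<lambda>(d, S). T d S - R) ` ?A))"
        have fA: "finite (insert 1 ((\<lambda>(d, S). T d S - R) ` ?A))"
          using finite_D by auto
        have "0 < gap" unfolding gap_def using fA lt by (subst Min_gr_iff) auto
        moreover have "R + gap \<le> T d S" if "d \<in> D" "S \<subseteq> K - {d}" for d S
        proof -
          have "gap \<le> T d S - R" unfolding gap_def using that by (intro Min_le[OF fA]) auto
          then show ?thesis by simp
        qed
        ultimately have "achievable G D R"
          using False unfolding T_def by (intro achievable_below_cuts) auto
        then show ?thesis using real unfolding capacity_def by (intro SUP_upper2[of R]) auto
      qed
    qed (use x in auto)
  qed
  then show ?case
    by (rule order_trans[rotated], unfold Let_def P_def[symmetric], intro eq_refl INF_cong refl arg_cong[where f = ereal])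
       (simp only: mem_Collect_eq T_def cut_value)
qed

end
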